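(* Let $X$ be a Banach space, $f:X\to\mathbb{R}\cup\{+\infty\}$ lower semicontinuous and $\bar x\in[f\le0]$. Let $\tau>0$, $\delta\in(0,\infty]$ and $q>0$. Suppose that either $X$ is Asplund or $f$ is convex, and $$q f^{q-1}(x)\, d(0,\partial f(x))\ge\tau\quad\text{for all } x\in B_\delta(\bar x)\cap[f>0]\text{ with } f^q(x)<\tau\, d(x,[f\le0]).$$ Then $\alpha\tau\, d(x,[f\le0])\le f_+^q(x)$ for all $\alpha\in(0,1]$ and all $x\in B_{\delta/(1+\alpha)}(\bar x)$.
   Context: $[f\le0]=\{x: f(x)\le0\}$, $[f>0]=\{x:f(x)>0\}$, $f_+(x)=\max\{f(x),0\}$; for $f(x)\ge0$, $f^q(x):=[f(x)]^q$, and $f_+^q(x)=[f_+(x)]^q$. $B_\delta(x)$ is the open ball of radius $\delta$ centered at $x$ ($B_\infty(x)=X$). $d(x,A)=\inf_{a\in A}\|x-a\|$ with $d(x,\emptyset)=+\infty$. $\partial f(x)$ is the Fréchet subdifferential: $\{x^*\in X^*:\liminf_{y\to x}\frac{f(y)-f(x)-\langle x^*,y-x\rangle}{\|y-x\|}\ge0\}$ if $f(x)<+\infty$, $\emptyset$ otherwise (equal to the convex subdifferential for convex $f$); $d(0,\partial f(x))=\inf\{\|x^*\|:x^*\in\partial f(x)\}$ ($+\infty$ if empty). A Banach space is Asplund if every continuous convex function on an open convex subset is Fréchet differentiable on a dense subset. *)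

theory Defs
  imports "HOL-Analysis.Analysis"
begin

(* Extended-real valued functions f : X -> R \<union> {+\<infinity>} are modelled as 'a => ereal with f x \<noteq> -\<infinity>. *)

definition lsc_fun :: "('a::metric_space \<Rightarrow> ereal) \<Rightarrow> bool" where
  "lsc_fun f \<longleftrightarrow> (\<forall>x. f x \<le> Liminf (at x) f)"

definition convex_ext :: "('a::real_vector \<Rightarrow> ereal) \<Rightarrow> bool" where
  "convex_ext f \<longleftrightarrow> (\<forall>x y t. 0 \<le> t \<and> t \<le> 1 \<longrightarrow>
      f ((1 - t) *\<^sub>R x + t *\<^sub>R y) \<le> ereal (1 - t) * f x + ereal t * f y)"

definition frechet_subdiff :: "('a::real_normed_vector \<Rightarrow> ereal) \<Rightarrow> 'a \<Rightarrow> ('a \<Rightarrow>\<^sub>L real) set" where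
  "frechet_subdiff f x = (if f x < \<infinity> then
     {xs. 0 \<le> Liminf (at x) (\<lambda>y. (f y - f x - ereal (blinfun_apply xs (y - x))) / ereal (norm (y - x)))}
   else {})"

(* d(0, \<partial>f(x)) with the convention inf \<emptyset> = +\<infinity>. *)
definition dist0_subdiff :: "('a::real_normed_vector \<Rightarrow> ereal) \<Rightarrow> 'a \<Rightarrow> ereal" where
  "dist0_subdiff f x = (INF xs \<in> frechet_subdiff f x. ereal (norm xs))"

definition asplund :: "'a::real_normed_vector itself \<Rightarrow> bool" where
  "asplund _ \<longleftrightarrow> (\<forall>(U::'a set) (g::'a \<Rightarrow> real). open U \<and> convex U \<and> continuous_on U g \<and> convex_on U g
      \<longrightarrow> (\<exists>D \<subseteq> U. U \<subseteq> closure D \<and> (\<forall>x\<in>D. g differentiable (at x))))"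

definition pos_pow :: "ereal \<Rightarrow> real \<Rightarrow> ereal" where
  "pos_pow v q = (if v = \<infinity> then \<infinity> else ereal (max (real_of_ereal v) 0 powr q))"

end

theory Submission
  imports Defs
begin

text \<open>
  Suppose the error bound fails at x. An Ekeland-type principle for the q-th power of
  the positive part of f yields a nearby point y at which \<open>f + c \<parallel>\<cdot> - y\<parallel>\<close> has a local minimum, with
  \<open>q f(y)^(q-1) c < \<tau>\<close>. It remains to produce Frechet subgradients of norm about c near y. For convex
  f a sandwich form of the Hahn-Banach theorem gives one at y itself.

  In an Asplund space the construction has three ingredients. First, f is restricted to a separable
  closed subspace Y chosen so rich that Frechet subgradients of the restriction extend to subgradients
  of f with the same norm: by the sandwich theorem this only concerns finite convex combinations, whose
  near-optimal choices are put into Y. Second, the dual of Y is separable: an uncountable separated set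
  of functionals on Y would make a minimal sublinear majorant of its support function nowhere Frechet
  differentiable. Third, separability of the dual gives convex functions on Y, close to multiples of
  the norm and Frechet differentiable everywhere (a Kadec-type construction in conjugate form), which
  serve as perturbations in a Borwein-Preiss variational principle.
\<close>

section \<open>Sublinear functionals and the Hahn-Banach theorem\<close>

text \<open>The hypothesis speaks only of points of the ball where \<open>f\<close> is positive and
  its q-th power lies below \<tau> times the distance to the zero sublevel set, so the search has to
  end at such a point. Ekeland's principle trades value against distance at a rate \<kappa> <
  \<tau>: from f(x)^q < \<kappa> \<alpha> d, with d the distance of x, it leads to f(y)^q < \<kappa>
  (\<alpha> d - |y - x|), while d - |y - x| bounds the distance of y from below. The same estimate
  gives |y - x| < \<alpha> d \<le> \<alpha> |x - xbar|, whence the radius \<delta>/(1+\<alpha>). The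
  obstacle is the Asplund case: a subgradient of \<open>f\<close> plus a multiple of the norm cannot
  be split at the point itself, because the norm is not differentiable at its centre. With a
  differentiable substitute the splitting is exact, at the price of moving y slightly. The
  inequalities at y are therefore kept strict, and the move must not raise the value of
  \<open>f\<close>, hence \<open>fy \<le> f0\<close> in \<open>fuzzy_subgradient\<close>.\<close>

definition sublinear :: "('a::real_vector \<Rightarrow> real) \<Rightarrow> bool" where
  "sublinear p \<longleftrightarrow> (\<forall>x y. p (x + y) \<le> p x + p y) \<and> (\<forall>t x. 0 < t \<longrightarrow> p (t *\<^sub>R x) = t * p x)"

lemma sublinearI:
  assumes "\<And>x y. p (x + y) \<le> p x + p y" and "\<And>t x. 0 < t \<Longrightarrow> p (t *\<^sub>R x) \<le> t * p x"
  shows "sublinear p"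
proof -
  have "t * p x \<le> p (t *\<^sub>R x)" if "0 < t" for t x
  proof -
    have "p (inverse t *\<^sub>R (t *\<^sub>R x)) \<le> inverse t * p (t *\<^sub>R x)"
      using that by (intro assms(2)) simp
    with that show ?thesis by (simp add: field_simps)
  qed
  with assms show ?thesis by (force simp: sublinear_def intro: antisym)
qed

lemma sublinear_add: "sublinear p \<Longrightarrow> p (x + y) \<le> p x + p y"
  by (simp add: sublinear_def)

lemma sublinear_zero: "sublinear p \<Longrightarrow> p 0 = 0"
proof -
  assume "sublinear p"
  then have "p (2 *\<^sub>R 0) = 2 * p 0" unfolding sublinear_def by (metis zero_less_numeral)
  then show ?thesis by simp
qed

lemma sublinear_scale: "sublinear p \<Longrightarrow> 0 \<le> t \<Longrightarrow> p (t *\<^sub>R x) = t * p x"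
  using sublinear_zero[of p] by (cases "t = 0") (auto simp: sublinear_def)

lemma sublinear_ge_neg: "sublinear p \<Longrightarrow> - p (- x) \<le> p x"
  using sublinear_add[of p x "- x"] sublinear_zero[of p] by simp

text \<open>If \<open>P\<close> is the support function of a set of functionals, then \<open>Q\<close> is that of its intersection with the
  half-space \<open>l w \<ge> - \<beta>\<close>.\<close>
lemma sublinear_tilt:
  fixes P :: "'a::real_vector \<Rightarrow> real"
  assumes P: "sublinear P" and b: "0 \<le> P w + \<beta>"
  obtains Q where "sublinear Q" "\<And>v t. 0 \<le> t \<Longrightarrow> Q v \<le> P (v + t *\<^sub>R w) + t * \<beta>"
    "\<And>v c. (\<And>t. 0 \<le> t \<Longrightarrow> c \<le> P (v + t *\<^sub>R w) + t * \<beta>) \<Longrightarrow> c \<le> Q v"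
proof -
  define Q where "Q v = (INF t\<in>{0..}. P (v + t *\<^sub>R w) + t * \<beta>)" for v
  \<comment> \<open>\<open>0 \<le> P w + \<beta>\<close> says that the half-space meets the set, and
    it keeps the infimum finite.\<close>
  have bdd: "bdd_below ((\<lambda>t. P (v + t *\<^sub>R w) + t * \<beta>) ` {0..})" for v
  proof (intro bdd_belowI2)
    fix t :: real assume t: "t \<in> {0..}"
    have "t * P w \<le> P (v + t *\<^sub>R w) + P (- v)"
      using sublinear_add[OF P, of "v + t *\<^sub>R w" "- v"] sublinear_scale[OF P, of t w] t by simp
    moreover have "0 \<le> t * (P w + \<beta>)" using t b by simp
    ultimately show "- P (- v) \<le> P (v + t *\<^sub>R w) + t * \<beta>" by (simp add: algebra_simps)
  qed
  have le: "Q v \<le> P (v + t *\<^sub>R w) + t * \<beta>" if "0 \<le> t" for v t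
    unfolding Q_def by (rule cINF_lower[OF bdd]) (use that in simp)
  have ge: "c \<le> Q v" if "\<And>t. 0 \<le> t \<Longrightarrow> c \<le> P (v + t *\<^sub>R w) + t * \<beta>" for v c
    unfolding Q_def by (rule cINF_greatest) (use that in auto)
  have "sublinear Q"
  proof (rule sublinearI)
    fix u v
    have "Q (u + v) - Q v \<le> Q u"
    proof (rule ge)
      fix s :: real assume s: "0 \<le> s"
      have "Q (u + v) - (P (u + s *\<^sub>R w) + s * \<beta>) \<le> Q v"
      proof (rule ge)
        fix t :: real assume t: "0 \<le> t"
        have "Q (u + v) \<le> P (u + v + (s + t) *\<^sub>R w) + (s + t) * \<beta>"
          using s t by (intro le) simp
        also have "P (u + v + (s + t) *\<^sub>R w) \<le> P (u + s *\<^sub>R w) + P (v + t *\<^sub>R w)"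
          using sublinear_add[OF P, of "u + s *\<^sub>R w" "v + t *\<^sub>R w"] by (simp add: algebra_simps)
        finally show "Q (u + v) - (P (u + s *\<^sub>R w) + s * \<beta>) \<le> P (v + t *\<^sub>R w) + t * \<beta>"
          by (simp add: algebra_simps)
      qed
      then show "Q (u + v) - Q v \<le> P (u + s *\<^sub>R w) + s * \<beta>" by simp
    qed
    then show "Q (u + v) \<le> Q u + Q v" by simp
  next
    fix r :: real and v assume r: "0 < r"
    have "Q (r *\<^sub>R v) / r \<le> Q v"
    proof (rule ge)
      fix t :: real assume t: "0 \<le> t"
      have "Q (r *\<^sub>R v) \<le> P (r *\<^sub>R v + (r * t) *\<^sub>R w) + r * t * \<beta>"
        using r t by (intro le) simp
      also have "P (r *\<^sub>R v + (r * t) *\<^sub>R w) = r * P (v + t *\<^sub>R w)"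
        using sublinear_scale[OF P, of r "v + t *\<^sub>R w"] r by (simp add: scaleR_add_right)
      finally show "Q (r *\<^sub>R v) / r \<le> P (v + t *\<^sub>R w) + t * \<beta>"
        using r by (simp add: field_simps)
    qed
    then show "Q (r *\<^sub>R v) \<le> r * Q v" using r by (simp add: field_simps)
  qed
  with le ge that show ?thesis by blast
qed

text \<open>Zorn's lemma for the reversed pointwise order. Every sublinear minorant of
  \<open>p\<close> dominates - p(- x), so the infimum over a chain is finite; it is subadditive
  because two members of a chain lie above a common one. The constraint \<open>r\<close> is an
  arbitrary function: an empty \<open>Y\<close> leads to Hahn-Banach, a support function to the
  separability of the dual.\<close>

lemma minimal_sublinear:
  fixes p :: "'a::real_vector \<Rightarrow> real"
  assumes p: "sublinear p" "\<And>y. y \<in> Y \<Longrightarrow> r y \<le> p y"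
  obtains m where "sublinear m" "\<And>x. m x \<le> p x" "\<And>y. y \<in> Y \<Longrightarrow> r y \<le> m y"
    "\<And>m'. sublinear m' \<Longrightarrow> (\<And>x. m' x \<le> m x) \<Longrightarrow> (\<And>y. y \<in> Y \<Longrightarrow> r y \<le> m' y) \<Longrightarrow> m' = m"
proof -
  define A where "A = {m. sublinear m \<and> m \<le> p \<and> (\<forall>y\<in>Y. r y \<le> m y)}"
  have pA: "p \<in> A" using p by (auto simp: A_def)
  have "\<exists>m\<in>A. \<forall>a\<in>A. a \<le> m \<longrightarrow> a = m"
  proof (rule predicate_Zorn)
    show "partial_order_on A (relation_of (\<lambda>a b. b \<le> a) A)"
      by (rule partial_order_on_relation_ofI) auto
    fix C assume C: "C \<in> Chains (relation_of (\<lambda>a b. b \<le> a) A)"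
    then have CA: "C \<subseteq> A" by (auto simp: Chains_def relation_of_def)
    have chain: "a \<le> b \<or> b \<le> a" if "a \<in> C" "b \<in> C" for a b
      using C that by (auto simp: Chains_def relation_of_def)
    show "\<exists>u\<in>A. \<forall>a\<in>C. u \<le> a"
    proof (cases "C = {}")
      case True
      with pA show ?thesis by auto
    next
      case False
      define u where "u x = (INF a\<in>C. a x)" for x
      have bdd: "bdd_below ((\<lambda>a. a x) ` C)" for x
      proof (rule bdd_belowI2)
        fix a assume "a \<in> C"
        then have "sublinear a" "a \<le> p" using CA by (auto simp: A_def)
        then show "- p (- x) \<le> a x"
          using sublinear_ge_neg[of a x] le_funD[of a p "- x"] by linarith
      qed
      have le: "u x \<le> a x" if "a \<in> C" for a x
        unfolding u_def by (rule cINF_lower[OF bdd that])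
      have ge: "c \<le> u x" if "\<And>a. a \<in> C \<Longrightarrow> c \<le> a x" for c x
        unfolding u_def using False that by (rule cINF_greatest)
      have "sublinear u"
      proof (rule sublinearI)
        fix x y
        have "u (x + y) - u y \<le> u x"
        proof (rule ge)
          fix a assume a: "a \<in> C"
          have "u (x + y) - a x \<le> u y"
          proof (rule ge)
            fix b assume b: "b \<in> C"
            obtain d where d: "d \<in> C" "d \<le> a" "d \<le> b" using chain[OF a b] a b by auto
            have "u (x + y) \<le> d (x + y)" by (rule le[OF d(1)])
            also have "\<dots> \<le> d x + d y" using d(1) CA by (auto simp: A_def sublinear_def)
            also have "\<dots> \<le> a x + b y" using le_funD[OF d(2), of x] le_funD[OF d(3), of y] by simp
            finally show "u (x + y) - a x \<le> b y" by simp
          qed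
          then show "u (x + y) - u y \<le> a x" by simp
        qed
        then show "u (x + y) \<le> u x + u y" by simp
      next
        fix t :: real and x assume t: "0 < t"
        have "u (t *\<^sub>R x) / t \<le> u x"
        proof (rule ge)
          fix a assume a: "a \<in> C"
          have "u (t *\<^sub>R x) \<le> a (t *\<^sub>R x)" by (rule le[OF a])
          also have "\<dots> = t * a x" using a t CA by (auto simp: A_def sublinear_def)
          finally show "u (t *\<^sub>R x) / t \<le> a x" using t by (simp add: field_simps)
        qed
        then show "u (t *\<^sub>R x) \<le> t * u x" using t by (simp add: field_simps)
      qed
      moreover obtain a where a: "a \<in> C" using False by auto
      then have "a \<le> p" using CA by (auto simp: A_def)
      then have "u \<le> p" using le[OF a] by (auto simp: le_fun_def intro: order_trans)
      moreover have "\<forall>y\<in>Y. r y \<le> u y" using CA by (auto intro!: ge simp: A_def)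
      ultimately show ?thesis using le by (auto simp: A_def le_fun_def intro!: bexI[of _ u])
    qed
  qed
  then obtain m where m: "m \<in> A" and min: "\<And>a. a \<in> A \<Longrightarrow> a \<le> m \<Longrightarrow> a = m" by blast
  show ?thesis
  proof (rule that[of m])
    fix m' assume m': "sublinear m'" "\<And>x. m' x \<le> m x" "\<And>y. y \<in> Y \<Longrightarrow> r y \<le> m' y"
    then have "m' \<le> m" by (simp add: le_fun_def)
    moreover from this have "m' \<le> p" using m by (auto simp: A_def intro: order_trans)
    ultimately show "m' = m" using m' by (intro min) (auto simp: A_def)
  qed (use m in \<open>auto simp: A_def le_fun_def\<close>)
qed

text \<open>A minimal sublinear functional is additive: tilting \<open>m\<close> in direction w with
  \<beta> = - m w yields a sublinear functional below \<open>m\<close> (t = 0), hence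
  \<open>m\<close> itself, and t = 1 then reads m v + m w \<le> m (v + w).\<close>

lemma Hahn_Banach_sublinear:
  fixes p :: "'a::real_vector \<Rightarrow> real"
  assumes "sublinear p"
  obtains l where "linear l" "\<And>x. l x \<le> p x"
proof -
  obtain m where m: "sublinear m" "\<And>x. m x \<le> p x"
    and min: "\<And>m'. sublinear m' \<Longrightarrow> (\<And>x. m' x \<le> m x) \<Longrightarrow> m' = m"
    using minimal_sublinear[OF assms, of "{}" "\<lambda>_. 0"] by auto
  have add: "m (v + w) = m v + m w" for v w
  proof -
    obtain Q where Q: "sublinear Q" "\<And>v t. 0 \<le> t \<Longrightarrow> Q v \<le> m (v + t *\<^sub>R w) + t * (- m w)"
      by (rule sublinear_tilt[OF m(1), of w "- m w"]) auto
    have "Q = m" using Q(2)[of 0] by (intro min Q(1)) simp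
    then have "m v \<le> m (v + w) - m w" using Q(2)[of 1 v] by simp
    with sublinear_add[OF m(1), of v w] show ?thesis by simp
  qed
  have neg: "m (- v) = - m v" for v
    using add[of v "- v"] sublinear_zero[OF m(1)] by simp
  have "m (t *\<^sub>R v) = t * m v" for t v
  proof (cases "0 \<le> t")
    case False
    then have "m ((- t) *\<^sub>R v) = (- t) * m v" by (intro sublinear_scale m(1)) simp
    then show ?thesis using neg[of "t *\<^sub>R v"] by simp
  qed (rule sublinear_scale[OF m(1)])
  with add have "linear m" by (intro linearI) auto
  with m(2) that show ?thesis by blast
qed

text \<open>Think of \<open>C\<close> as an epigraph lying above -K |h|. The sublinear functional is
  the inf-convolution of the cone generated by \<open>C\<close> with K times the norm; the assumed
  lower bound makes it finite. The norm bound comes from the vertex of the cone, the inequality on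
  \<open>C\<close> from evaluating at the point (h, s) itself.\<close>

lemma sandwich_functional:
  fixes C :: "('a::real_normed_vector \<times> real) set"
  assumes C: "convex C" and K: "0 \<le> K" and lb: "\<And>h s. (h, s) \<in> C \<Longrightarrow> 0 \<le> s + K * norm h"
  obtains xs :: "'a \<Rightarrow>\<^sub>L real" where "norm xs \<le> K" "\<And>h s. (h, s) \<in> C \<Longrightarrow> blinfun_apply xs h \<le> s"
proof -
  define \<Gamma> where "\<Gamma> = insert 0 {t *\<^sub>R c | t c. 0 < t \<and> c \<in> C}"
  have scale: "t *\<^sub>R c \<in> \<Gamma>" if "c \<in> \<Gamma>" "0 < t" for c t
    using that unfolding \<Gamma>_def by (force intro: mult_pos_pos)
  have add: "c + d \<in> \<Gamma>" if cd: "c \<in> \<Gamma>" "d \<in> \<Gamma>" for c d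
  proof (cases "c = 0 \<or> d = 0")
    case False
    then obtain s t c' d' where st: "0 < s" "0 < t" "c' \<in> C" "d' \<in> C" "c = s *\<^sub>R c'" "d = t *\<^sub>R d'"
      using cd by (auto simp: \<Gamma>_def)
    have "(s / (s + t)) *\<^sub>R c' + (t / (s + t)) *\<^sub>R d' \<in> C"
      using st by (intro convexD[OF C]) (auto simp: add_divide_distrib[symmetric])
    then have "(s + t) *\<^sub>R ((s / (s + t)) *\<^sub>R c' + (t / (s + t)) *\<^sub>R d') \<in> \<Gamma>"
      using add_pos_pos[OF st(1,2)] unfolding \<Gamma>_def by blast
    with st show ?thesis by (simp add: scaleR_add_right)
  qed (use cd in auto)
  have lb\<Gamma>: "0 \<le> snd c + K * norm (fst c)" if "c \<in> \<Gamma>" for c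
  proof -
    have "0 \<le> t * s + K * norm (t *\<^sub>R h)" if "0 < t" "(h, s) \<in> C" for t h s
    proof -
      have "0 \<le> t * (s + K * norm h)" using lb[OF that(2)] that(1) by simp
      with that(1) show ?thesis by (simp add: algebra_simps)
    qed
    with that show ?thesis by (auto simp: \<Gamma>_def)
  qed
  define p where "p v = (INF c\<in>\<Gamma>. snd c + K * norm (v - fst c))" for v
  have below: "- K * norm v \<le> snd c + K * norm (v - fst c)" if "c \<in> \<Gamma>" for v c
  proof -
    have "K * norm (fst c) \<le> K * (norm v + norm (v - fst c))"
      using K norm_triangle_sub[of "fst c" v] by (intro mult_left_mono) (auto simp: norm_minus_commute)
    with lb\<Gamma>[OF that] show ?thesis by (simp add: algebra_simps)
  qed
  have ple: "p v \<le> snd c + K * norm (v - fst c)" if "c \<in> \<Gamma>" for v c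
    unfolding p_def by (rule cINF_lower[OF bdd_belowI2[OF below] that])
  have pge: "b \<le> p v" if "\<And>c. c \<in> \<Gamma> \<Longrightarrow> b \<le> snd c + K * norm (v - fst c)" for b v
    unfolding p_def by (rule cINF_greatest) (use that in \<open>auto simp: \<Gamma>_def\<close>)
  have "sublinear p"
  proof (rule sublinearI)
    fix u v
    have "p (u + v) - p v \<le> p u"
    proof (rule pge)
      fix c assume c: "c \<in> \<Gamma>"
      have "p (u + v) - (snd c + K * norm (u - fst c)) \<le> p v"
      proof (rule pge)
        fix d assume d: "d \<in> \<Gamma>"
        have "p (u + v) \<le> snd (c + d) + K * norm (u + v - fst (c + d))" by (intro ple add c d)
        also have "K * norm (u + v - fst (c + d)) \<le> K * (norm (u - fst c) + norm (v - fst d))"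
          using K norm_triangle_ineq[of "u - fst c" "v - fst d"]
          by (intro mult_left_mono) (auto simp: algebra_simps)
        finally show "p (u + v) - (snd c + K * norm (u - fst c)) \<le> snd d + K * norm (v - fst d)"
          by (simp add: algebra_simps)
      qed
      then show "p (u + v) - p v \<le> snd c + K * norm (u - fst c)" by simp
    qed
    then show "p (u + v) \<le> p u + p v" by simp
  next
    fix t :: real and v assume t: "0 < t"
    have "p (t *\<^sub>R v) / t \<le> p v"
    proof (rule pge)
      fix c assume c: "c \<in> \<Gamma>"
      have "p (t *\<^sub>R v) \<le> snd (t *\<^sub>R c) + K * norm (t *\<^sub>R v - fst (t *\<^sub>R c))"
        by (intro ple scale c t)
      also have "norm (t *\<^sub>R v - fst (t *\<^sub>R c)) = t * norm (v - fst c)"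
        using t by (simp flip: scaleR_diff_right)
      finally show "p (t *\<^sub>R v) / t \<le> snd c + K * norm (v - fst c)"
        using t by (simp add: field_simps)
    qed
    then show "p (t *\<^sub>R v) \<le> t * p v" using t by (simp add: field_simps)
  qed
  then obtain l where l: "linear l" "\<And>x. l x \<le> p x" using Hahn_Banach_sublinear by blast
  have "l v \<le> K * norm v" for v
    using l(2)[of v] ple[of 0 v] by (simp add: \<Gamma>_def)
  from this this[of "- v" for v] have bnd: "norm (l v) \<le> norm v * K" for v
    using linear_neg[OF l(1), of v] by (smt (verit) mult.commute norm_minus_cancel real_norm_def)
  have bl: "bounded_linear l"
    using l(1) bnd by (intro bounded_linear.intro bounded_linear_axioms.intro) auto
  have "norm (Blinfun l) \<le> K"
    using bnd K by (intro norm_blinfun_bound) (auto simp: bounded_linear_Blinfun_apply[OF bl] mult.commute)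
  moreover have "Blinfun l h \<le> s" if "(h, s) \<in> C" for h s
  proof -
    have "(h, s) \<in> \<Gamma>" using that unfolding \<Gamma>_def by (force intro: exI[of _ "1::real"])
    then have "p h \<le> s" using ple[of "(h, s)" h] by simp
    with l(2)[of h] show ?thesis by (simp add: bounded_linear_Blinfun_apply[OF bl])
  qed
  ultimately show ?thesis by (rule that)
qed

text \<open>The sandwich theorem for the single point (- x, - norm x).\<close>

lemma norming_functional:
  fixes x :: "'a::real_normed_vector"
  obtains xs :: "'a \<Rightarrow>\<^sub>L real" where "norm xs \<le> 1" "blinfun_apply xs x = norm x"
proof -
  obtain xs :: "'a \<Rightarrow>\<^sub>L real" where xs: "norm xs \<le> 1" "blinfun_apply xs (- x) \<le> - norm x"
    using sandwich_functional[of "{(- x, - norm x)}" 1] by auto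
  have "blinfun_apply xs x \<le> norm x"
    using norm_blinfun[of xs x] mult_right_mono[OF xs(1), of "norm x"] by auto
  with xs that show ?thesis by (auto simp: blinfun.minus_right)
qed

section \<open>Separability of duals of separable subspaces of Asplund spaces\<close>

text \<open>Functionals on \<open>Y\<close> are represented by functions on the whole space whose values outside \<open>Y\<close> are irrelevant.\<close>
definition dual_ball :: "'a::real_normed_vector set \<Rightarrow> ('a \<Rightarrow> real) set" where
  "dual_ball Y = {a. (\<forall>u\<in>Y. \<forall>v\<in>Y. a (u + v) = a u + a v) \<and> (\<forall>u\<in>Y. \<forall>r. a (r *\<^sub>R u) = r * a u)
                   \<and> (\<forall>u\<in>Y. \<bar>a u\<bar> \<le> norm u)}"

lemma dual_ball_add: "a \<in> dual_ball Y \<Longrightarrow> u \<in> Y \<Longrightarrow> v \<in> Y \<Longrightarrow> a (u + v) = a u + a v"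
  and dual_ball_scale: "a \<in> dual_ball Y \<Longrightarrow> u \<in> Y \<Longrightarrow> a (r *\<^sub>R u) = r * a u"
  and dual_ball_le: "a \<in> dual_ball Y \<Longrightarrow> u \<in> Y \<Longrightarrow> \<bar>a u\<bar> \<le> norm u"
  by (auto simp: dual_ball_def)

lemma dual_ball_minus: "a \<in> dual_ball Y \<Longrightarrow> u \<in> Y \<Longrightarrow> a (- u) = - a u"
  using dual_ball_scale[of a Y u "- 1"] by simp

lemma dual_ball_diff: "subspace Y \<Longrightarrow> a \<in> dual_ball Y \<Longrightarrow> u \<in> Y \<Longrightarrow> v \<in> Y \<Longrightarrow> a (u - v) = a u - a v"
  using dual_ball_add[of a Y u "- v"] dual_ball_minus[of a Y v] subspace_neg[of Y v] by simp

text \<open>The Asplund property concerns the whole space while the functionals live on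
  \<open>Y\<close>, so the support function of \<open>A'\<close> is extended by a minimal sublinear
  majorant \<open>P\<close>, and its point of differentiability \<open>x0\<close> may lie off
  \<open>Y\<close>. Minimality still forces a slice of \<open>P\<close> at \<open>x0\<close> to
  contain elements of \<open>A'\<close>, and two distinct ones since countable half-space traces
  have been discarded. Differentiability makes the elements of a small slice nearly agree on
  \<open>Y\<close>, against the separation.\<close>

lemma separated_in_dual_ball_countable:
  fixes Y :: "'a::real_normed_vector set"
  assumes asp: "asplund TYPE('a)" and Y: "subspace Y"
    and T: "countable T" "T \<subseteq> Y" "Y \<subseteq> closure T"
    and A: "A \<subseteq> dual_ball Y" and \<epsilon>: "0 < \<epsilon>"
    and sep: "\<And>a b. a \<in> A \<Longrightarrow> b \<in> A \<Longrightarrow> a \<noteq> b \<Longrightarrow> \<exists>u\<in>Y. \<epsilon> * norm u < \<bar>a u - b u\<bar>"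
  shows "countable A"
proof (rule ccontr)
  assume unc: "uncountable A"
  define Hs where "Hs y \<gamma> = {a\<in>A. \<gamma> < a y}" for y and \<gamma> :: real
  \<comment> \<open>\<open>T\<close> and the rationals give countably many half-spaces, so throwing
    away their countable traces costs only countably many functionals.\<close>
  define N where "N = (\<Union>(y, \<gamma>)\<in>{(y, \<gamma>). (y, \<gamma>) \<in> T \<times> \<rat> \<and> countable (Hs y \<gamma>)}. Hs y \<gamma>)"
  have cN: "countable N"
    unfolding N_def
  proof (rule countable_UN)
    show "countable {(y, \<gamma>). (y, \<gamma>) \<in> T \<times> \<rat> \<and> countable (Hs y \<gamma>)}"
      by (rule countable_subset[of _ "T \<times> (\<rat> :: real set)"]) (use T(1) countable_rat in auto)
  qed auto
  \<comment> \<open>every half-space defined by an element of \<open>Y\<close> that meets \<open>A'\<close> contains two of its points\<close>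
  define A' where "A' = A - N"
  have A'A: "A' \<subseteq> A" by (auto simp: A'_def)
  have A'B: "a \<in> dual_ball Y" if "a \<in> A'" for a using that A A'A by auto
  have "A' \<noteq> {}" using uncountable_minus_countable[OF unc cN] by (metis A'_def countable_empty)
  have second: "\<exists>b\<in>A'. b \<noteq> a \<and> \<gamma> < b y" if a: "a \<in> A'" and y: "y \<in> Y" and g: "\<gamma> < a y" for a y \<gamma>
  proof -
    \<comment> \<open>A quarter of the gap: replacing y by a point of \<open>T\<close> costs less
      than e at either end, which leaves an interval for the rational level.\<close>
    define e where "e = (a y - \<gamma>) / 4"
    have e: "0 < e" using g by (simp add: e_def)
    obtain y' where y': "y' \<in> T" "dist y' y < e"
      using T(3) y e by (meson closure_approachable subsetD)
    have y'Y: "y' \<in> Y" using y' T by auto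
    obtain \<gamma>' where g': "\<gamma>' \<in> \<rat>" "\<gamma> + e < \<gamma>'" "\<gamma>' < a y - e"
      using Rats_dense_in_real[of "\<gamma> + e" "a y - e"] e by (auto simp: e_def field_simps)
    have close: "\<bar>b y - b y'\<bar> < e" if "b \<in> A" for b
      using dual_ball_diff[OF Y _ y y'Y, of b] dual_ball_le[of b Y "y - y'"] that A y'(2)
        subspace_diff[OF Y y y'Y] by (force simp: dist_norm norm_minus_commute)
    have aA: "a \<in> A" using a A'A by auto
    then have "a \<in> Hs y' \<gamma>'" using close[OF aA] g' by (auto simp: Hs_def)
    then have "uncountable (Hs y' \<gamma>')" using a y'(1) g'(1) by (auto simp: A'_def N_def)
    then have "uncountable (Hs y' \<gamma>' - (N \<union> {a}))"
      using cN by (intro uncountable_minus_countable) auto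
    then obtain b where b: "b \<in> Hs y' \<gamma>'" "b \<notin> N" "b \<noteq> a"
      by (metis DiffE UnCI countable_empty ex_in_conv singletonI)
    then have "b \<in> A'" "\<gamma>' < b y'" by (auto simp: A'_def Hs_def)
    moreover have "\<gamma> < b y" using close[of b] calculation A'A g' by force
    ultimately show ?thesis using b by blast
  qed
  define r where "r y = (SUP a\<in>A'. a y)" for y
  have bdd: "bdd_above ((\<lambda>a. a y) ` A')" if "y \<in> Y" for y
    using dual_ball_le[OF A'B that] by (intro bdd_aboveI2[of _ _ "norm y"]) force
  have rle: "r y \<le> norm y" if "y \<in> Y" for y
    unfolding r_def using dual_ball_le[OF A'B that] \<open>A' \<noteq> {}\<close> by (intro cSUP_least) (auto simp: abs_le_iff)
  have rge: "a y \<le> r y" if "y \<in> Y" "a \<in> A'" for y a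
    unfolding r_def by (rule cSUP_upper[OF that(2) bdd[OF that(1)]])
  have "sublinear (norm :: 'a \<Rightarrow> real)" by (rule sublinearI) (auto simp: norm_triangle_ineq)
  then obtain P where P: "sublinear P" "\<And>x. P x \<le> norm x" "\<And>y. y \<in> Y \<Longrightarrow> r y \<le> P y"
    and Pmin: "\<And>Q. sublinear Q \<Longrightarrow> (\<And>x. Q x \<le> P x) \<Longrightarrow> (\<And>y. y \<in> Y \<Longrightarrow> r y \<le> Q y) \<Longrightarrow> Q = P"
    using minimal_sublinear[of norm Y r] rle by blast
  have lip: "P x - P z \<le> norm (x - z)" for x z
    using sublinear_add[OF P(1), of "x - z" z] P(2)[of "x - z"] by simp
  have "\<bar>P x - P z\<bar> \<le> norm (x - z)" for x z
    using lip[of x z] lip[of z x] by (simp add: abs_le_iff norm_minus_commute)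
  then have "1-lipschitz_on UNIV P" by (intro lipschitz_onI) (auto simp: dist_real_def dist_norm)
  then have cont: "continuous_on UNIV P" by (rule lipschitz_on_continuous_on)
  have "convex_on UNIV P"
  proof (rule convex_onI)
    fix t :: real and x y :: 'a assume "0 < t" "t < 1"
    then show "P ((1 - t) *\<^sub>R x + t *\<^sub>R y) \<le> (1 - t) * P x + t * P y"
      using sublinear_add[OF P(1), of "(1 - t) *\<^sub>R x" "t *\<^sub>R y"]
        sublinear_scale[OF P(1), of t y] sublinear_scale[OF P(1), of "1 - t" x] by simp
  qed auto
  with cont asp obtain D where D: "UNIV \<subseteq> closure D" "\<forall>x\<in>D. P differentiable (at x)"
    unfolding asplund_def by (metis open_UNIV convex_UNIV)
  from D(1) have "D \<noteq> {}" by auto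
  with D(2) obtain x0 P' where P': "(P has_derivative P') (at x0)"
    unfolding differentiable_def by blast
  then have linP': "linear P'" using has_derivative_linear by blast
  obtain \<delta> where \<delta>: "0 < \<delta>" "\<And>v. norm v < \<delta> \<Longrightarrow> \<bar>P (x0 + v) - P x0 - P' v\<bar> \<le> \<epsilon> / 8 * norm v"
  proof -
    have "0 < \<epsilon> / 8" using \<epsilon> by simp
    with P' obtain d where "0 < d" "\<And>y. norm (y - x0) < d \<Longrightarrow> norm (P y - P x0 - P' (y - x0)) \<le> \<epsilon> / 8 * norm (y - x0)"
      unfolding has_derivative_at_alt by blast
    from this(1) this(2)[of "x0 + v" for v] show ?thesis by (intro that[of d]) auto
  qed
  define s where "s = \<delta> / 2"
  have s: "0 < s" "s < \<delta>" using \<delta>(1) by (auto simp: s_def)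
  \<comment> \<open>The depth \<epsilon> s/8 of the slice equals the differentiability error at
    radius s; together they give \<epsilon> s/4 in \<open>near\<close>, so two elements of the slice
    differ by at most \<epsilon> s/2 on vectors of norm s.\<close>
  define \<beta> where "\<beta> = P x0 - \<epsilon> * s / 8"
  \<comment> \<open>otherwise cutting off the slice of \<open>P\<close> at \<open>x0\<close> would contradict minimality\<close>
  have "\<exists>y\<in>Y. \<exists>t\<ge>0. P (y - t *\<^sub>R x0) + t * \<beta> < r y"
  proof (rule ccontr)
    assume "\<not> ?thesis"
    then have *: "r y \<le> P (y - t *\<^sub>R x0) + t * \<beta>" if "y \<in> Y" "0 \<le> t" for y t
      using that by (meson not_less)
    have 0: "0 \<in> Y" by (rule subspace_0[OF Y])
    obtain a where "a \<in> A'" using \<open>A' \<noteq> {}\<close> by auto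
    then have "0 \<le> r 0" using rge[OF 0, of a] dual_ball_scale[OF A'B 0, of a 0] by simp
    then have "0 \<le> P (- x0) + \<beta>" using *[OF 0, of 1] by simp
    then obtain Q where Q: "sublinear Q" "\<And>v t. 0 \<le> t \<Longrightarrow> Q v \<le> P (v + t *\<^sub>R (- x0)) + t * \<beta>"
      "\<And>v c. (\<And>t. 0 \<le> t \<Longrightarrow> c \<le> P (v + t *\<^sub>R (- x0)) + t * \<beta>) \<Longrightarrow> c \<le> Q v"
      using sublinear_tilt[OF P(1), of "- x0" \<beta>] by blast
    have "Q = P"
      by (rule Pmin[OF Q(1)]) (use Q(2)[of 0] in simp, rule Q(3), use * in simp)
    then have "P x0 \<le> \<beta>" using Q(2)[of 1 x0] sublinear_zero[OF P(1)] by simp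
    moreover have "0 < \<epsilon> * s" using \<epsilon> s by simp
    ultimately show False by (simp add: \<beta>_def)
  qed
  then obtain y t where y: "y \<in> Y" and t: "0 \<le> t" and yt: "P (y - t *\<^sub>R x0) + t * \<beta> < r y" by blast
  define \<gamma> where "\<gamma> = P (y - t *\<^sub>R x0) + t * \<beta>"
  obtain a where a: "a \<in> A'" "\<gamma> < a y"
    using yt less_cSUP_iff[OF \<open>A' \<noteq> {}\<close> bdd[OF y]] by (auto simp: r_def \<gamma>_def)
  then obtain b where b: "b \<in> A'" "b \<noteq> a" "\<gamma> < b y" using second[OF a(1) y a(2)] by blast
  have "t \<noteq> 0" using P(3)[OF y] rge[OF y a(1)] a(2) by (auto simp: \<gamma>_def)
  with t have t: "0 < t" by simp
  \<comment> \<open>An element of \<open>A'\<close> has no value at \<open>x0\<close>. The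
    inequality for all w in \<open>Y\<close> is what l x0 > \<beta> would give for an extension l
    \<le> P of it, and it follows from \<gamma> < a y without any extension.\<close>
  have slice: "a w < P (x0 + w) - \<beta>" if a: "a \<in> A'" "\<gamma> < a y" and w: "w \<in> Y" for a w
  proof -
    have tw: "t *\<^sub>R w \<in> Y" using subspace_scale[OF Y w] .
    have "a y + t * a w = a (y + t *\<^sub>R w)"
      using dual_ball_add[OF A'B[OF a(1)] y tw] dual_ball_scale[OF A'B[OF a(1)] w] by simp
    also have "\<dots> \<le> P (y + t *\<^sub>R w)"
      using rge[OF subspace_add[OF Y y tw] a(1)] P(3)[OF subspace_add[OF Y y tw]] by simp
    also have "\<dots> \<le> P (y - t *\<^sub>R x0) + P (t *\<^sub>R (x0 + w))"
      using sublinear_add[OF P(1), of "y - t *\<^sub>R x0" "t *\<^sub>R (x0 + w)"] by (simp add: scaleR_add_right)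
    also have "P (t *\<^sub>R (x0 + w)) = t * P (x0 + w)" using sublinear_scale[OF P(1)] t by simp
    finally have "t * a w < t * (P (x0 + w) - \<beta>)" using a(2) by (simp add: \<gamma>_def algebra_simps)
    then show ?thesis using t by simp
  qed
  have near: "\<bar>a w - P' w\<bar> \<le> \<epsilon> * s / 4" if a: "a \<in> A'" "\<gamma> < a y" and w: "w \<in> Y" "norm w = s" for a w
  proof -
    have "\<bar>P (x0 + w) - P x0 - P' w\<bar> \<le> \<epsilon> / 8 * s" "\<bar>P (x0 - w) - P x0 + P' w\<bar> \<le> \<epsilon> / 8 * s"
      using \<delta>(2)[of w] \<delta>(2)[of "- w"] w s linear_neg[OF linP', of w] by auto
    then have up: "P (x0 + w) - P x0 \<le> P' w + \<epsilon> * s / 8" "P (x0 - w) - P x0 \<le> - P' w + \<epsilon> * s / 8"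
      unfolding abs_le_iff by argo+
    have "a w \<le> P' w + \<epsilon> * s / 4"
      using slice[OF a w(1)] up(1) unfolding \<beta>_def by argo
    moreover have "- a w \<le> - P' w + \<epsilon> * s / 4"
      using slice[OF a subspace_neg[OF Y w(1)]] up(2) dual_ball_minus[OF A'B[OF a(1)] w(1)]
      unfolding \<beta>_def diff_conv_add_uminus by argo
    ultimately show ?thesis unfolding abs_le_iff by argo
  qed
  obtain u where u: "u \<in> Y" "\<epsilon> * norm u < \<bar>a u - b u\<bar>" using sep[of a b] a b A'A by blast
  have "u \<noteq> 0"
    using u dual_ball_le[OF A'B[OF a(1)] u(1)] dual_ball_le[OF A'B[OF b(1)] u(1)] by auto
  define w where "w = (s / norm u) *\<^sub>R u"
  have w: "w \<in> Y" "norm w = s" using u \<open>u \<noteq> 0\<close> s subspace_scale[OF Y] by (auto simp: w_def)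
  have "a w - b w = s / norm u * (a u - b u)"
    unfolding w_def dual_ball_scale[OF A'B[OF a(1)] u(1)] dual_ball_scale[OF A'B[OF b(1)] u(1)]
    by (simp only: right_diff_distrib)
  then have "\<bar>a w - b w\<bar> = s / norm u * \<bar>a u - b u\<bar>" using s by (simp add: abs_mult)
  moreover have "s / norm u * (\<epsilon> * norm u) < s / norm u * \<bar>a u - b u\<bar>"
    using u \<open>u \<noteq> 0\<close> s by (intro mult_strict_left_mono) auto
  ultimately have "s * \<epsilon> < \<bar>a w - b w\<bar>" using \<open>u \<noteq> 0\<close> by simp
  moreover have "\<bar>a w - b w\<bar> \<le> \<epsilon> * s / 4 + \<epsilon> * s / 4"
    using near[OF a w] near[OF b(1,3) w] by linarith
  moreover have "0 < \<epsilon> * s" using \<epsilon> s by simp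
  ultimately show False by (simp add: mult.commute)
qed

text \<open>By Zorn there is a maximal \<epsilon>-separated subset of the dual ball; it is
  countable, and maximality makes it an \<epsilon>-net. The union over \<epsilon> = 1/(n+1) is dense
  in the dual norm.\<close>

lemma dual_ball_separable:
  fixes Y :: "'a::real_normed_vector set"
  assumes asp: "asplund TYPE('a)" and Y: "subspace Y"
    and T: "countable T" "T \<subseteq> Y" "Y \<subseteq> closure T"
  obtains D where "countable D" "D \<subseteq> dual_ball Y"
    "\<And>a \<epsilon>. a \<in> dual_ball Y \<Longrightarrow> 0 < \<epsilon> \<Longrightarrow> \<exists>d\<in>D. \<forall>u\<in>Y. \<bar>a u - d u\<bar> \<le> \<epsilon> * norm u"
proof -
  have "\<exists>A. A \<subseteq> dual_ball Y \<and> countable A \<and> (\<forall>a\<in>dual_ball Y. \<exists>d\<in>A. \<forall>u\<in>Y. \<bar>a u - d u\<bar> \<le> \<epsilon> * norm u)"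
    if \<epsilon>: "0 < \<epsilon>" for \<epsilon>
  proof -
    define R where "R a b \<longleftrightarrow> (\<exists>u\<in>Y. \<epsilon> * norm u < \<bar>a u - b u\<bar>)" for a b :: "'a \<Rightarrow> real"
    have Rsym: "R a b \<longleftrightarrow> R b a" for a b by (auto simp: R_def abs_minus_commute)
    have "\<exists>M\<in>{A. A \<subseteq> dual_ball Y \<and> pairwise R A}. \<forall>X\<in>{A. A \<subseteq> dual_ball Y \<and> pairwise R A}. M \<subseteq> X \<longrightarrow> X = M"
    proof (rule subset_Zorn')
      fix C assume C: "subset.chain {A. A \<subseteq> dual_ball Y \<and> pairwise R A} C"
      then have sub: "\<And>A. A \<in> C \<Longrightarrow> A \<subseteq> dual_ball Y \<and> pairwise R A"
        and lin: "\<And>A B. A \<in> C \<Longrightarrow> B \<in> C \<Longrightarrow> A \<subseteq> B \<or> B \<subseteq> A"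
        by (auto simp: subset_chain_def)
      have "R a b" if ab: "A \<in> C" "B \<in> C" "a \<in> A" "b \<in> B" "a \<noteq> b" for A B a b
      proof -
        obtain E where "E \<in> C" "a \<in> E" "b \<in> E" using lin[OF ab(1,2)] ab by blast
        with sub[of E] ab(5) show ?thesis by (simp add: pairwise_def)
      qed
      with sub show "\<Union>C \<in> {A. A \<subseteq> dual_ball Y \<and> pairwise R A}"
        unfolding pairwise_def by blast
    qed
    then obtain M where M: "M \<subseteq> dual_ball Y" "pairwise R M"
      and max: "\<And>X. X \<subseteq> dual_ball Y \<Longrightarrow> pairwise R X \<Longrightarrow> M \<subseteq> X \<Longrightarrow> X = M" by auto
    have "countable M"
      using separated_in_dual_ball_countable[OF asp Y T M(1) \<epsilon>] M(2) by (simp add: pairwise_def R_def)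
    moreover have "\<exists>d\<in>M. \<forall>u\<in>Y. \<bar>a u - d u\<bar> \<le> \<epsilon> * norm u" if a: "a \<in> dual_ball Y" for a
    proof (rule ccontr)
      assume "\<not> ?thesis"
      then have *: "R a d" if "d \<in> M" for d using that by (fastforce simp: R_def not_le)
      have "insert a M = M"
        using M a * Rsym by (intro max) (auto simp: pairwise_insert)
      with * have "R a a" by blast
      with \<epsilon> show False by (auto simp: R_def not_less[symmetric] mult_less_0_iff)
    qed
    ultimately show ?thesis using M(1) by blast
  qed
  then have "\<forall>n. \<exists>A. A \<subseteq> dual_ball Y \<and> countable A
      \<and> (\<forall>a\<in>dual_ball Y. \<exists>d\<in>A. \<forall>u\<in>Y. \<bar>a u - d u\<bar> \<le> inverse (Suc n) * norm u)" by simp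
  then obtain A where A: "\<And>n. A n \<subseteq> dual_ball Y" "\<And>n. countable (A n)"
      "\<And>n a. a \<in> dual_ball Y \<Longrightarrow> \<exists>d\<in>A n. \<forall>u\<in>Y. \<bar>a u - d u\<bar> \<le> inverse (Suc n) * norm u"
    by metis
  show ?thesis
  proof (rule that[of "\<Union>n. A n"])
    fix a and \<epsilon> :: real assume a: "a \<in> dual_ball Y" "0 < \<epsilon>"
    obtain n where n: "inverse (real (Suc n)) < \<epsilon>" using reals_Archimedean a by blast
    obtain d where d: "d \<in> A n" "\<forall>u\<in>Y. \<bar>a u - d u\<bar> \<le> inverse (Suc n) * norm u" using A(3)[OF a(1)] by blast
    have "inverse (Suc n) * norm u \<le> \<epsilon> * norm u" for u :: 'a using n by (intro mult_right_mono) auto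
    with d show "\<exists>d\<in>\<Union>n. A n. \<forall>u\<in>Y. \<bar>a u - d u\<bar> \<le> \<epsilon> * norm u" by (meson UNIV_I UN_I order_trans)
  qed (use A in auto)
qed

section \<open>Smooth functions on a space with separable dual\<close>

lemma Cauchy_of_square_bound:
  fixes u :: "nat \<Rightarrow> real"
  assumes "\<And>j k. (u j - u k)\<^sup>2 \<le> C * (inverse (Suc j) + inverse (Suc k))"
  shows "Cauchy u"
proof (rule CauchyI)
  fix e :: real assume e: "0 < e"
  have "(\<lambda>j. \<bar>C\<bar> * (inverse (Suc j) + inverse (Suc j))) \<longlonglongrightarrow> \<bar>C\<bar> * (0 + 0)"
    by (intro tendsto_intros LIMSEQ_inverse_real_of_nat)
  then have "\<forall>\<^sub>F j in sequentially. \<bar>C\<bar> * (inverse (Suc j) + inverse (Suc j)) < e\<^sup>2"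
    using e by (intro order_tendstoD) auto
  then obtain M where M: "\<bar>C\<bar> * (inverse (Suc M) + inverse (Suc M)) < e\<^sup>2"
    by (auto simp: eventually_sequentially)
  have "norm (u j - u k) < e" if "M \<le> j" "M \<le> k" for j k
  proof -
    have "(u j - u k)\<^sup>2 \<le> \<bar>C\<bar> * (inverse (Suc j) + inverse (Suc k))"
      by (rule order_trans[OF assms mult_right_mono[OF abs_ge_self]]) simp
    also have "\<dots> \<le> \<bar>C\<bar> * (inverse (Suc M) + inverse (Suc M))"
    proof (rule mult_left_mono)
      show "inverse (real (Suc j)) + inverse (real (Suc k)) \<le> inverse (real (Suc M)) + inverse (real (Suc M))"
        using that le_imp_inverse_le[of "real (Suc M)" "real (Suc j)"] le_imp_inverse_le[of "real (Suc M)" "real (Suc k)"]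
        by (intro add_mono) simp_all
    qed simp
    finally have "(u j - u k)\<^sup>2 < e\<^sup>2" using M by simp
    then have "\<bar>u j - u k\<bar>\<^sup>2 < e\<^sup>2" by simp
    then have "\<bar>u j - u k\<bar> < e" by (rule power2_less_imp_less) (use e in simp)
    then show ?thesis by simp
  qed
  then show "\<exists>M. \<forall>m\<ge>M. \<forall>n\<ge>M. norm (u m - u n) < e" by blast
qed

text \<open>Norm density of \<open>d\<close>, not just pointwise density, is what the Asplund
  property provides; it enters through \<open>p_small\<close>.\<close>

locale separable_dual =
  fixes Y :: "'a::real_normed_vector set" and e :: "nat \<Rightarrow> 'a" and d :: "nat \<Rightarrow> 'a \<Rightarrow> real"
  assumes Y: "subspace Y"
    and e: "\<And>n. e n \<in> Y" "\<And>n. norm (e n) \<le> 1"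
    and e_dense: "\<And>u \<epsilon>. u \<in> Y \<Longrightarrow> norm u \<le> 1 \<Longrightarrow> 0 < \<epsilon> \<Longrightarrow> \<exists>n. norm (u - e n) < \<epsilon>"
    and d: "\<And>n. d n \<in> dual_ball Y"
    and d_dense: "\<And>a \<epsilon>. a \<in> dual_ball Y \<Longrightarrow> 0 < \<epsilon> \<Longrightarrow> \<exists>n. \<forall>u\<in>Y. \<bar>a u - d n u\<bar> \<le> \<epsilon> * norm u"
begin

abbreviation "B \<equiv> dual_ball Y"

text \<open>A weak neighbourhood of 0 within a ball. The radius 2 leaves room for differences of two
  vectors of the unit ball.\<close>

definition slab :: "nat \<Rightarrow> 'a set" where
  "slab n = {w\<in>Y. norm w \<le> 2 \<and> (\<forall>k<n. \<bar>d k w\<bar> \<le> inverse (Suc n))}"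

text \<open>A Kadec-type seminorm, roughly a distance of \<open>a\<close> from the span of the first
  n functionals. It is lower semicontinuous for pointwise convergence, and it becomes small for
  suitable n; smallness of \<open>p n\<close> and closeness at finitely many \<open>e m\<close>
  together control the dual norm.\<close>

definition p :: "nat \<Rightarrow> ('a \<Rightarrow> real) \<Rightarrow> real" where
  "p n a = (SUP w\<in>slab n. \<bar>a w\<bar>)"

definition wt :: "('a \<Rightarrow> real) \<Rightarrow> nat \<Rightarrow> real" where
  "wt a n = (1/2)^n * ((p n a)\<^sup>2 + (a (e n))\<^sup>2)"

text \<open>A bounded strictly convex function on the dual ball: the squares supply the convexity,
  the geometric weights the convergence.\<close>

definition h :: "('a \<Rightarrow> real) \<Rightarrow> real" where
  "h a = suminf (wt a)"

text \<open>The Fenchel conjugate of \<theta> h over the dual ball. For \<theta> \<ge> 0 it lies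
  between norm - 10 \<theta> and the norm on \<open>Y\<close>; for \<theta> > 0 the strict convexity
  of \<open>h\<close> turns into smoothness of \<open>G\<close>.\<close>

definition G :: "real \<Rightarrow> 'a \<Rightarrow> real" where
  "G \<theta> x = (SUP a\<in>B. a x - \<theta> * h a)"

section \<open>Bounds and quantitative convexity of the penalty \<open>h\<close>\<close>

lemma slabD: "w \<in> slab n \<Longrightarrow> w \<in> Y" "w \<in> slab n \<Longrightarrow> norm w \<le> 2"
  by (auto simp: slab_def)

lemma zero_slab: "0 \<in> slab n"
proof -
  have "d k 0 = 0" for k using dual_ball_scale[OF d subspace_0[OF Y], of k 0] by simp
  then show ?thesis by (auto simp: slab_def subspace_0[OF Y])
qed

lemma slab_le2: "a \<in> B \<Longrightarrow> w \<in> slab n \<Longrightarrow> \<bar>a w\<bar> \<le> 2"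
  using dual_ball_le slabD by force

lemma p_ge: "a \<in> B \<Longrightarrow> w \<in> slab n \<Longrightarrow> \<bar>a w\<bar> \<le> p n a"
  unfolding p_def by (rule cSUP_upper) (auto intro!: bdd_aboveI2 slab_le2)

lemma p_le: "(\<And>w. w \<in> slab n \<Longrightarrow> \<bar>a w\<bar> \<le> c) \<Longrightarrow> p n a \<le> c"
  unfolding p_def by (rule cSUP_least) (use zero_slab in auto)

lemma p_nonneg: "a \<in> B \<Longrightarrow> 0 \<le> p n a"
  using p_ge[OF _ zero_slab, of a n] by linarith

lemma p_le2: "a \<in> B \<Longrightarrow> p n a \<le> 2"
  by (intro p_le slab_le2)

lemma e_le1: "a \<in> B \<Longrightarrow> \<bar>a (e n)\<bar> \<le> 1"
  using dual_ball_le[OF _ e(1)] e(2) order_trans by blast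

lemma wt_nonneg: "0 \<le> wt a n"
  by (simp add: wt_def)

lemma wt_le: "a \<in> B \<Longrightarrow> wt a n \<le> 5 * (1/2)^n"
proof -
  assume a: "a \<in> B"
  have "(p n a)\<^sup>2 \<le> 2\<^sup>2" using p_le2[OF a] p_nonneg[OF a] by (intro power_mono)
  moreover have "(a (e n))\<^sup>2 \<le> 1" using e_le1[OF a] by (simp add: abs_square_le_1)
  ultimately have "(1/2)^n * ((p n a)\<^sup>2 + (a (e n))\<^sup>2) \<le> (1/2)^n * 5"
    by (intro mult_left_mono) auto
  then show ?thesis by (simp add: wt_def)
qed

lemma summable_wt: "a \<in> B \<Longrightarrow> summable (wt a)"
proof (rule summable_comparison_test')
  show "summable (\<lambda>n. 5 * (1/2::real)^n)" by (intro summable_mult summable_geometric) simp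
  show "norm (wt a n) \<le> 5 * (1/2)^n" if "a \<in> B" "0 \<le> n" for n
    using wt_le[OF that(1)] wt_nonneg by simp
qed

lemma h_nonneg: "a \<in> B \<Longrightarrow> 0 \<le> h a"
  unfolding h_def by (intro suminf_nonneg summable_wt wt_nonneg)

lemma h_le: "a \<in> B \<Longrightarrow> h a \<le> 10"
proof -
  assume a: "a \<in> B"
  have "h a \<le> (\<Sum>n. 5 * (1/2::real)^n)"
    unfolding h_def by (intro suminf_le wt_le summable_wt a summable_mult summable_geometric) simp
  also have "\<dots> = 10" by (subst suminf_mult) (auto simp: suminf_geometric summable_geometric)
  finally show ?thesis .
qed

lemma scaled_in_B: "a \<in> B \<Longrightarrow> 0 \<le> s \<Longrightarrow> s \<le> 1 \<Longrightarrow> (\<lambda>u. s * a u) \<in> B"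
  by (auto simp: dual_ball_def algebra_simps abs_mult) (meson abs_ge_zero mult_left_le_one_le order_trans)

lemma h_scaled:
  assumes "a \<in> B" "0 \<le> s" "s \<le> 1"
  shows "h (\<lambda>u. s * a u) \<le> s\<^sup>2 * 10"
proof -
  have "p n (\<lambda>u. s * a u) \<le> s * p n a" for n
    using assms by (intro p_le) (auto simp: abs_mult intro!: mult_left_mono p_ge)
  then have "(p n (\<lambda>u. s * a u))\<^sup>2 \<le> (s * p n a)\<^sup>2" for n
    using p_nonneg[OF scaled_in_B[OF assms]] by (intro power_mono) auto
  then have "wt (\<lambda>u. s * a u) n \<le> s\<^sup>2 * wt a n" for n
  proof -
    have "(1/2)^n * ((p n (\<lambda>u. s * a u))\<^sup>2 + (s * a (e n))\<^sup>2) \<le> (1/2)^n * ((s * p n a)\<^sup>2 + (s * a (e n))\<^sup>2)"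
      using \<open>\<And>n. (p n (\<lambda>u. s * a u))\<^sup>2 \<le> (s * p n a)\<^sup>2\<close> by (intro mult_left_mono add_right_mono) auto
    also have "\<dots> = s\<^sup>2 * ((1/2)^n * ((p n a)\<^sup>2 + (a (e n))\<^sup>2))"
      unfolding power_mult_distrib by (simp only: distrib_left mult.left_commute)
    finally show ?thesis by (simp add: wt_def)
  qed
  then have "h (\<lambda>u. s * a u) \<le> (\<Sum>n. s\<^sup>2 * wt a n)"
    unfolding h_def using assms by (intro suminf_le summable_wt scaled_in_B summable_mult) auto
  also have "\<dots> = s\<^sup>2 * h a" unfolding h_def by (rule suminf_mult[OF summable_wt[OF assms(1)]])
  also have "\<dots> \<le> s\<^sup>2 * 10" by (intro mult_left_mono h_le assms) auto
  finally show ?thesis .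
qed

lemma mid_in_B: "a \<in> B \<Longrightarrow> b \<in> B \<Longrightarrow> (\<lambda>u. (a u + b u) / 2) \<in> B"
  unfolding dual_ball_def by (auto simp: algebra_simps add_divide_distrib) (smt (verit, best) field_sum_of_halves)

text \<open>The parallelogram identity applied to each square, together with midpoint convexity of
  \<open>p n\<close>. Keeping the surplus of a single index n is enough to compare
  near-maximizers.\<close>

lemma h_mid:
  assumes a: "a \<in> B" and b: "b \<in> B"
  shows "h (\<lambda>u. (a u + b u) / 2) + (1/2)^n * ((p n a - p n b)\<^sup>2 + (a (e n) - b (e n))\<^sup>2) / 4
           \<le> (h a + h b) / 2"
proof -
  define m where "m = (\<lambda>u. (a u + b u) / 2)"
  have m: "m \<in> B" unfolding m_def by (rule mid_in_B[OF a b])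
  define \<delta> where "\<delta> n = (1/2)^n * ((p n a - p n b)\<^sup>2 + (a (e n) - b (e n))\<^sup>2) / 4" for n
  have \<delta>0: "0 \<le> \<delta> n" for n by (simp add: \<delta>_def)
  have le: "wt m n + \<delta> n \<le> (wt a n + wt b n) / 2" for n
  proof -
    have "p n m \<le> (p n a + p n b) / 2"
    proof (rule p_le)
      fix w assume "w \<in> slab n"
      from p_ge[OF a this] p_ge[OF b this] show "\<bar>m w\<bar> \<le> (p n a + p n b) / 2" by (auto simp: m_def)
    qed
    then have "(p n m)\<^sup>2 \<le> ((p n a + p n b) / 2)\<^sup>2" using p_nonneg[OF m] by (intro power_mono)
    then have "(p n m)\<^sup>2 + (m (e n))\<^sup>2 + ((p n a - p n b)\<^sup>2 + (a (e n) - b (e n))\<^sup>2) / 4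
        \<le> (((p n a)\<^sup>2 + (a (e n))\<^sup>2) + ((p n b)\<^sup>2 + (b (e n))\<^sup>2)) / 2"
      by (simp add: m_def power2_eq_square field_simps)
    then have "(1/2)^n * ((p n m)\<^sup>2 + (m (e n))\<^sup>2 + ((p n a - p n b)\<^sup>2 + (a (e n) - b (e n))\<^sup>2) / 4)
        \<le> (1/2)^n * ((((p n a)\<^sup>2 + (a (e n))\<^sup>2) + ((p n b)\<^sup>2 + (b (e n))\<^sup>2)) / 2)"
      by (intro mult_left_mono) auto
    then show ?thesis by (simp add: wt_def \<delta>_def algebra_simps)
  qed
  have sab: "summable (\<lambda>n. (wt a n + wt b n) / 2)"
    by (intro summable_divide summable_add summable_wt a b)
  have "\<delta> n \<le> (wt a n + wt b n) / 2" for n using le[of n] wt_nonneg[of m n] by linarith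
  then have s\<delta>: "summable \<delta>" using \<delta>0 by (intro summable_comparison_test'[OF sab]) auto
  have "\<delta> n \<le> suminf \<delta>" using sum_le_suminf[OF s\<delta>, of "{n}"] \<delta>0 by auto
  moreover have "h m + suminf \<delta> = (\<Sum>n. wt m n + \<delta> n)"
    unfolding h_def by (intro suminf_add summable_wt m s\<delta>)
  moreover have "\<dots> \<le> (\<Sum>n. (wt a n + wt b n) / 2)"
    by (intro suminf_le le summable_add summable_wt m s\<delta> sab)
  moreover have "\<dots> = (h a + h b) / 2"
    unfolding h_def using suminf_add[OF summable_wt[OF a] summable_wt[OF b]]
      suminf_divide[OF summable_add[OF summable_wt[OF a] summable_wt[OF b]], of 2] by simp
  ultimately show ?thesis by (simp add: m_def \<delta>_def)
qed

section \<open>The conjugate \<open>G\<close> as a smooth substitute for the norm\<close>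

lemma zero_in_B: "(\<lambda>_. 0) \<in> B"
  by (auto simp: dual_ball_def)

lemma G_ge: "a \<in> B \<Longrightarrow> 0 \<le> \<theta> \<Longrightarrow> x \<in> Y \<Longrightarrow> a x - \<theta> * h a \<le> G \<theta> x"
  unfolding G_def
proof (rule cSUP_upper, assumption, rule bdd_aboveI2)
  fix a assume "0 \<le> \<theta>" "x \<in> Y" "a \<in> B"
  then show "a x - \<theta> * h a \<le> norm x"
    using dual_ball_le[of a Y x] h_nonneg[of a] mult_nonneg_nonneg[of \<theta> "h a"] by linarith
qed

lemma G_le: "(\<And>a. a \<in> B \<Longrightarrow> a x - \<theta> * h a \<le> c) \<Longrightarrow> G \<theta> x \<le> c"
  unfolding G_def by (rule cSUP_least) (use zero_in_B in auto)

text \<open>Test the supremum with s times a norming functional: the gain is linear in s and the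
  penalty quadratic. With s = 1 this says that \<open>G\<close> is close to the norm, with small s
  that \<open>G\<close> controls the norm near 0 in spite of the additive loss.\<close>

lemma G_lower:
  assumes "0 \<le> \<theta>" "x \<in> Y" "0 \<le> s" "s \<le> 1"
  shows "s * norm x - 10 * \<theta> * s\<^sup>2 \<le> G \<theta> x"
proof -
  obtain xs :: "'a \<Rightarrow>\<^sub>L real" where xs: "norm xs \<le> 1" "blinfun_apply xs x = norm x"
    by (rule norming_functional)
  have "\<bar>blinfun_apply xs u\<bar> \<le> norm u" for u
    using norm_blinfun[of xs u] mult_right_mono[OF xs(1), of "norm u"] by auto
  then have "blinfun_apply xs \<in> B" by (auto simp: dual_ball_def blinfun.add_right blinfun.scaleR_right)
  from scaled_in_B[OF this assms(3,4)] h_scaled[OF this assms(3,4)]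
  have "(\<lambda>u. s * blinfun_apply xs u) \<in> B" "\<theta> * h (\<lambda>u. s * blinfun_apply xs u) \<le> \<theta> * (s\<^sup>2 * 10)"
    using assms by (auto intro: mult_left_mono)
  with G_ge[OF this(1) assms(1,2)] show ?thesis by (simp add: xs(2) algebra_simps)
qed

lemma G_nonneg: "0 \<le> \<theta> \<Longrightarrow> x \<in> Y \<Longrightarrow> 0 \<le> G \<theta> x"
  using G_lower[of \<theta> x 0] by simp

lemma G_lipschitz: "0 \<le> \<theta> \<Longrightarrow> x \<in> Y \<Longrightarrow> z \<in> Y \<Longrightarrow> G \<theta> x \<le> G \<theta> z + norm (x - z)"
proof (rule G_le)
  fix a assume *: "0 \<le> \<theta>" "x \<in> Y" "z \<in> Y" "a \<in> B"
  have "a x - a z \<le> norm (x - z)"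
    using dual_ball_diff[OF Y *(4,2,3)] dual_ball_le[OF *(4) subspace_diff[OF Y *(2,3)]] by simp
  with G_ge[OF *(4,1,3)] show "a x - \<theta> * h a \<le> G \<theta> z + norm (x - z)" by linarith
qed

lemma G_zero: "0 \<le> \<theta> \<Longrightarrow> G \<theta> 0 = 0"
proof (rule antisym)
  assume \<theta>: "0 \<le> \<theta>"
  show "G \<theta> 0 \<le> 0"
  proof (rule G_le)
    fix a assume a: "a \<in> B"
    show "a 0 - \<theta> * h a \<le> 0"
      using dual_ball_scale[OF a subspace_0[OF Y], of 0] mult_nonneg_nonneg[OF \<theta> h_nonneg[OF a]] by simp
  qed
  show "0 \<le> G \<theta> 0" by (rule G_nonneg[OF \<theta> subspace_0[OF Y]])
qed

text \<open>The midpoint of \<open>a\<close> and \<open>b\<close> competes in the supremum; as its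
  penalty is lower by the surplus of \<open>h_mid\<close>, that surplus is bounded by the average
  defect of \<open>a\<close> and \<open>b\<close>.\<close>

lemma near_maximizers:
  assumes "a \<in> B" "b \<in> B" "0 \<le> \<theta>" "x \<in> Y"
  shows "\<theta> * (1/2)^n * ((p n a - p n b)\<^sup>2 + (a (e n) - b (e n))\<^sup>2) / 4
           \<le> G \<theta> x - ((a x - \<theta> * h a) + (b x - \<theta> * h b)) / 2"
proof -
  have "(a x + b x) / 2 - \<theta> * h (\<lambda>u. (a u + b u) / 2) \<le> G \<theta> x"
    using G_ge[OF mid_in_B[OF assms(1,2)] assms(3,4)] by simp
  moreover have "\<theta> * (h (\<lambda>u. (a u + b u) / 2) + (1/2)^n * ((p n a - p n b)\<^sup>2 + (a (e n) - b (e n))\<^sup>2) / 4)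
      \<le> \<theta> * ((h a + h b) / 2)"
    by (intro mult_left_mono h_mid assms)
  then have "\<theta> * h (\<lambda>u. (a u + b u) / 2)
      + \<theta> * (1/2)^n * ((p n a - p n b)\<^sup>2 + (a (e n) - b (e n))\<^sup>2) / 4 \<le> (\<theta> * h a + \<theta> * h b) / 2"
    unfolding distrib_left[of \<theta>] by (simp only: distrib_left times_divide_eq_right mult.assoc)
  ultimately show ?thesis unfolding add_divide_distrib diff_divide_distrib by linarith
qed

text \<open>A sequential Banach-Alaoglu argument: convergence on the dense \<open>e n\<close>
  spreads over the unit ball by the common Lipschitz bound, and to \<open>Y\<close> by
  homogeneity.\<close>

lemma pointwise_limit:
  assumes a: "\<And>j. a j \<in> B" and C: "\<And>n. Cauchy (\<lambda>j. a j (e n))"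
  obtains b where "b \<in> B" "\<And>y. y \<in> Y \<Longrightarrow> (\<lambda>j. a j y) \<longlonglongrightarrow> b y"
proof -
  have ball: "Cauchy (\<lambda>j. a j y)" if y: "y \<in> Y" "norm y \<le> 1" for y
  proof (rule CauchyI)
    fix \<epsilon> :: real assume \<epsilon>: "0 < \<epsilon>"
    then obtain n where n: "norm (y - e n) < \<epsilon> / 3" using e_dense[OF y, of "\<epsilon> / 3"] by auto
    obtain M where M: "\<And>j k. j \<ge> M \<Longrightarrow> k \<ge> M \<Longrightarrow> norm (a j (e n) - a k (e n)) < \<epsilon> / 3"
      using CauchyD[OF C, of "\<epsilon> / 3" n] \<epsilon> by auto
    have *: "\<bar>a j y - a j (e n)\<bar> < \<epsilon> / 3" for j
      using dual_ball_diff[OF Y a[of j] y(1) e(1)[of n]]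
        dual_ball_le[OF a[of j] subspace_diff[OF Y y(1) e(1)[of n]]] n by linarith
    have "norm (a j y - a k y) < \<epsilon>" if "j \<ge> M" "k \<ge> M" for j k
      using M[OF that] *[of j] *[of k] unfolding real_norm_def by linarith
    then show "\<exists>M. \<forall>m\<ge>M. \<forall>n\<ge>M. norm (a m y - a n y) < \<epsilon>" by blast
  qed
  have "convergent (\<lambda>j. a j y)" if y: "y \<in> Y" for y
  proof -
    define y' where "y' = (inverse (norm y + 1)) *\<^sub>R y"
    have y': "y' \<in> Y" "norm y' \<le> 1"
      using y subspace_scale[OF Y] by (auto simp: y'_def divide_simps not_less add_nonneg_nonneg)
    have "y = (norm y + 1) *\<^sub>R y'" using norm_ge_zero[of y] unfolding y'_def
      by (metis add_nonneg_eq_0_iff left_inverse right_inverse scaleR_one scaleR_scaleR zero_le_one zero_neq_one)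
    then have "a j y = (norm y + 1) * a j y'" for j using dual_ball_scale[OF a y'(1)] by metis
    moreover have "convergent (\<lambda>j. (norm y + 1) * a j y')"
      using ball[OF y'] by (intro convergent_mult convergent_const) (simp add: Cauchy_convergent_iff)
    ultimately show ?thesis by simp
  qed
  then have lim: "(\<lambda>j. a j y) \<longlonglongrightarrow> lim (\<lambda>j. a j y)" if "y \<in> Y" for y
    using that by (simp add: convergent_LIMSEQ_iff)
  have "(\<lambda>y. lim (\<lambda>j. a j y)) \<in> B"
    unfolding dual_ball_def
  proof (intro CollectI conjI ballI allI)
    fix u v assume uv: "u \<in> Y" "v \<in> Y"
    have "(\<lambda>j. a j (u + v)) \<longlonglongrightarrow> lim (\<lambda>j. a j u) + lim (\<lambda>j. a j v)"
      using tendsto_add[OF lim[OF uv(1)] lim[OF uv(2)]] dual_ball_add[OF a uv] by simp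
    then show "lim (\<lambda>j. a j (u + v)) = lim (\<lambda>j. a j u) + lim (\<lambda>j. a j v)" by (rule limI)
  next
    fix u r assume u: "u \<in> Y"
    have "(\<lambda>j. a j (r *\<^sub>R u)) \<longlonglongrightarrow> r * lim (\<lambda>j. a j u)"
      using tendsto_mult_left[OF lim[OF u], of r] dual_ball_scale[OF a u] by simp
    then show "lim (\<lambda>j. a j (r *\<^sub>R u)) = r * lim (\<lambda>j. a j u)" by (rule limI)
  next
    fix u assume u: "u \<in> Y"
    show "\<bar>lim (\<lambda>j. a j u)\<bar> \<le> norm u"
      using tendsto_rabs[OF lim[OF u]] dual_ball_le[OF a u] by (intro LIMSEQ_le_const2) auto
  qed
  from this lim show ?thesis by (rule that)
qed

text \<open>By \<open>near_maximizers\<close> a maximizing sequence is Cauchy at each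
  \<open>e n\<close> and in each \<open>p n\<close>, so it has a pointwise limit. \<open>h\<close>
  is lower semicontinuous along it because each \<open>p n\<close> is a supremum of
  evaluations.\<close>

lemma maximizer_exists:
  assumes \<theta>: "0 < \<theta>" and x: "x \<in> Y"
  obtains a where "a \<in> B" "a x - \<theta> * h a = G \<theta> x"
proof -
  have "\<exists>a\<in>B. G \<theta> x - inverse (Suc j) < a x - \<theta> * h a" for j
  proof (rule ccontr)
    assume "\<not> ?thesis"
    then have "G \<theta> x \<le> G \<theta> x - inverse (Suc j)" by (intro G_le) (auto simp: not_less)
    then show False by simp
  qed
  then obtain a where a: "\<And>j. a j \<in> B" "\<And>j. G \<theta> x - inverse (Suc j) < a j x - \<theta> * h (a j)" by metis
  have both: "(p n (a j) - p n (a k))\<^sup>2 + (a j (e n) - a k (e n))\<^sup>2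
      \<le> 4 * 2^n / \<theta> * (inverse (Suc j) + inverse (Suc k))" for j k n
  proof -
    have "\<theta> * (1/2)^n * ((p n (a j) - p n (a k))\<^sup>2 + (a j (e n) - a k (e n))\<^sup>2) / 4
        \<le> inverse (Suc j) + inverse (Suc k)"
      using near_maximizers[OF a(1) a(1) less_imp_le[OF \<theta>] x, of n j k] a(2)[of j] a(2)[of k]
        positive_imp_inverse_positive[OF of_nat_0_less_iff[THEN iffD2, OF zero_less_Suc], of j, where 'a=real]
        positive_imp_inverse_positive[OF of_nat_0_less_iff[THEN iffD2, OF zero_less_Suc], of k, where 'a=real]
      by argo
    then have "4 * 2^n / \<theta> * (\<theta> * (1/2)^n * ((p n (a j) - p n (a k))\<^sup>2 + (a j (e n) - a k (e n))\<^sup>2) / 4)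
        \<le> 4 * 2^n / \<theta> * (inverse (Suc j) + inverse (Suc k))"
      using \<theta> by (intro mult_left_mono) auto
    then show ?thesis using \<theta> by (simp add: power_one_over)
  qed
  have "(p n (a j) - p n (a k))\<^sup>2 \<le> 4 * 2^n / \<theta> * (inverse (Suc j) + inverse (Suc k))"
       "(a j (e n) - a k (e n))\<^sup>2 \<le> 4 * 2^n / \<theta> * (inverse (Suc j) + inverse (Suc k))" for j k n
    using both[of n j k] by (smt (verit) zero_le_power2)+
  then have Cp: "Cauchy (\<lambda>j. p n (a j))" and Ce: "Cauchy (\<lambda>j. a j (e n))" for n
    by (blast intro: Cauchy_of_square_bound)+
  obtain b where b: "b \<in> B" "\<And>y. y \<in> Y \<Longrightarrow> (\<lambda>j. a j y) \<longlonglongrightarrow> b y"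
    using pointwise_limit[of a] a(1) Ce by blast
  obtain L where L: "\<And>n. (\<lambda>j. p n (a j)) \<longlonglongrightarrow> L n"
    using Cp unfolding Cauchy_convergent_iff convergent_def by metis
  have pL: "p n b \<le> L n" for n
  proof (rule p_le)
    fix w assume w: "w \<in> slab n"
    show "\<bar>b w\<bar> \<le> L n"
      using tendsto_rabs[OF b(2)[OF slabD(1)[OF w]]] L[of n] p_ge[OF a(1) w]
      by (intro LIMSEQ_le) auto
  qed
  have "\<theta> * h b \<le> b x - G \<theta> x"
  proof -
    \<comment> \<open>Limits are taken in finite partial sums; the bound is uniform in N and so
      passes to the series.\<close>
    have "sum (wt b) {..<N} \<le> (b x - G \<theta> x) / \<theta>" for N
    proof -
      have "sum (wt b) {..<N} \<le> (\<Sum>n<N. (1/2)^n * ((L n)\<^sup>2 + (b (e n))\<^sup>2))"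
        unfolding wt_def using pL p_nonneg[OF b(1)]
        by (intro sum_mono mult_left_mono add_right_mono power_mono) auto
      also have "\<dots> \<le> (b x - G \<theta> x + 0) / \<theta>"
      proof (rule LIMSEQ_le)
        show "(\<lambda>j. sum (wt (a j)) {..<N}) \<longlonglongrightarrow> (\<Sum>n<N. (1/2)^n * ((L n)\<^sup>2 + (b (e n))\<^sup>2))"
          unfolding wt_def by (intro tendsto_intros L b(2) e(1))
        show "(\<lambda>j. (a j x - G \<theta> x + inverse (Suc j)) / \<theta>) \<longlonglongrightarrow> (b x - G \<theta> x + 0) / \<theta>"
          using \<theta> by (intro tendsto_intros LIMSEQ_inverse_real_of_nat b(2) x) auto
        have "sum (wt (a j)) {..<N} \<le> (a j x - G \<theta> x + inverse (Suc j)) / \<theta>" for j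
        proof -
          have "sum (wt (a j)) {..<N} \<le> h (a j)"
            unfolding h_def by (intro sum_le_suminf summable_wt a wt_nonneg) auto
          also have "h (a j) \<le> (a j x - G \<theta> x + inverse (Suc j)) / \<theta>"
            using a(2)[of j] \<theta> by (simp add: pos_le_divide_eq mult.commute)
          finally show ?thesis .
        qed
        then show "\<exists>M. \<forall>j\<ge>M. sum (wt (a j)) {..<N} \<le> (a j x - G \<theta> x + inverse (Suc j)) / \<theta>" by blast
      qed
      finally show ?thesis by simp
    qed
    then have "h b \<le> (b x - G \<theta> x) / \<theta>"
      unfolding h_def by (intro suminf_le_const summable_wt b)
    then show ?thesis using \<theta> by (simp add: pos_le_divide_eq mult.commute)
  qed
  with G_ge[OF b(1) _ x, of \<theta>] \<theta> have "b x - \<theta> * h b = G \<theta> x" by simp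
  with b(1) show ?thesis by (rule that)
qed

text \<open>Pigeonhole: the values of the first n functionals at the \<open>e m\<close> are rounded
  to a grid, finitely many cells occur, and one index per cell suffices.\<close>

lemma finite_net:
  obtains F where "finite F" "\<And>u. u \<in> Y \<Longrightarrow> norm u \<le> 1 \<Longrightarrow> \<exists>m\<in>F. u - e m \<in> slab n"
proof -
  \<comment> \<open>The mesh 1/N is half the slab width: one half pays for replacing u by some
    \<open>e m'\<close>, the other for passing to the representative of its cell.\<close>
  define N where "N = 2 * real (Suc n)"
  have N: "0 < N" by (simp add: N_def)
  define c where "c m = restrict (\<lambda>k. \<lfloor>d k (e m) * N\<rfloor>) {..<n}" for m
  have "c m \<in> PiE {..<n} (\<lambda>_. {- \<lceil>N\<rceil> .. \<lceil>N\<rceil>})" for m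
  proof -
    have "- \<lceil>N\<rceil> \<le> \<lfloor>d k (e m) * N\<rfloor> \<and> \<lfloor>d k (e m) * N\<rfloor> \<le> \<lceil>N\<rceil>" for k
    proof -
      have "\<bar>d k (e m) * N\<bar> \<le> N"
        using e_le1[OF d, of k m] N by (simp add: abs_mult mult_left_le_one_le)
      then show ?thesis by (auto simp: le_floor_iff floor_le_iff abs_le_iff) linarith+
    qed
    then show ?thesis by (auto simp: c_def)
  qed
  then have "range c \<subseteq> PiE {..<n} (\<lambda>_. {- \<lceil>N\<rceil> .. \<lceil>N\<rceil>})" by auto
  then have "finite (range c)" by (rule finite_subset) (intro finite_PiE; simp)
  then obtain F where F: "finite F" "range c = c ` F"
    using finite_subset_image[of "range c" c UNIV] by auto
  show ?thesis
  proof (rule that[OF F(1)])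
    fix u assume u: "u \<in> Y" "norm u \<le> 1"
    obtain m' where m': "norm (u - e m') < 1 / N" using e_dense[OF u, of "1 / N"] N by auto
    have "c m' \<in> c ` F" using F(2) by blast
    then obtain m where m: "m \<in> F" "c m = c m'" by auto
    have "\<bar>d k (u - e m)\<bar> \<le> inverse (Suc n)" if k: "k < n" for k
    proof -
      have "\<lfloor>d k (e m) * N\<rfloor> = \<lfloor>d k (e m') * N\<rfloor>" using fun_cong[OF m(2), of k] k by (simp add: c_def)
      then have "\<bar>d k (e m') * N - d k (e m) * N\<bar> < 1" by linarith
      then have "\<bar>d k (e m') - d k (e m)\<bar> * N < 1" using N by (simp add: abs_mult flip: left_diff_distrib)
      then have "\<bar>d k (e m') - d k (e m)\<bar> < 1 / N" using N by (simp add: pos_less_divide_eq)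
      moreover have "\<bar>d k u - d k (e m')\<bar> < 1 / N"
        using dual_ball_diff[OF Y d u(1) e(1)] dual_ball_le[OF d subspace_diff[OF Y u(1) e(1)]] m'
        by (metis order_le_less_trans)
      moreover have "1 / N + 1 / N = inverse (Suc n)" by (simp add: N_def field_simps)
      ultimately show ?thesis using dual_ball_diff[OF Y d u(1) e(1), of k m] by linarith
    qed
    moreover have "norm (u - e m) \<le> 2" using norm_triangle_ineq4[of u "e m"] u e(2)[of m] by linarith
    ultimately have "u - e m \<in> slab n" using subspace_diff[OF Y u(1) e(1)] by (simp add: slab_def)
    with m(1) show "\<exists>m\<in>F. u - e m \<in> slab n" by blast
  qed
qed

text \<open>Take \<open>d k\<close> close to \<open>a\<close> in norm and n > k large: on
  \<open>slab n\<close> the functional \<open>d k\<close> is tiny, and the difference costs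
  \<epsilon>/4 times the radius 2.\<close>

lemma p_small:
  assumes a: "a \<in> B" and \<epsilon>: "0 < \<epsilon>"
  obtains n where "p n a \<le> \<epsilon>"
proof -
  obtain k where k: "\<And>u. u \<in> Y \<Longrightarrow> \<bar>a u - d k u\<bar> \<le> \<epsilon> / 4 * norm u" using d_dense[OF a, of "\<epsilon> / 4"] \<epsilon> by auto
  obtain n0 where n0: "inverse (real (Suc n0)) < \<epsilon> / 2" using reals_Archimedean[of "\<epsilon> / 2"] \<epsilon> by auto
  define n where "n = max n0 (Suc k)"
  have "inverse (real (Suc n)) \<le> inverse (real (Suc n0))"
    by (rule le_imp_inverse_le) (auto simp: n_def)
  with n0 have n: "inverse (real (Suc n)) < \<epsilon> / 2" by linarith
  have kn: "k < n" by (simp add: n_def)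
  have "p n a \<le> \<epsilon>"
  proof (rule p_le)
    fix w assume w: "w \<in> slab n"
    have "\<bar>d k w\<bar> \<le> inverse (real (Suc n))" using w kn by (auto simp: slab_def)
    moreover have "\<epsilon> / 4 * norm w \<le> \<epsilon> / 4 * 2" using slabD(2)[OF w] \<epsilon> by (intro mult_left_mono) auto
    ultimately show "\<bar>a w\<bar> \<le> \<epsilon>" using k[OF slabD(1)[OF w]] n by linarith
  qed
  then show ?thesis by (rule that)
qed

text \<open>The unit ball lies in a finite set of \<open>e m\<close> plus a slab on which
  \<open>a\<close> is small. A near-maximizer \<open>b\<close> agrees with \<open>a\<close> up to
  \<epsilon>/8 at those \<open>e m\<close>, and \<open>p n b\<close> is close to
  \<open>p n a\<close>, so \<open>b\<close> is small on the slab too.\<close>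

lemma strong_maximizer:
  assumes \<theta>: "0 < \<theta>" and x: "x \<in> Y" and a: "a \<in> B" "a x - \<theta> * h a = G \<theta> x" and \<epsilon>: "0 < \<epsilon>"
  obtains \<gamma> where "0 < \<gamma>"
    "\<And>b u. b \<in> B \<Longrightarrow> G \<theta> x - \<gamma> \<le> b x - \<theta> * h b \<Longrightarrow> u \<in> Y \<Longrightarrow> \<bar>a u - b u\<bar> \<le> \<epsilon> * norm u"
proof -
  obtain n where n: "p n a \<le> \<epsilon> / 8" using p_small[OF a(1), of "\<epsilon> / 8"] \<epsilon> by auto
  obtain F where F: "finite F" "\<And>u. u \<in> Y \<Longrightarrow> norm u \<le> 1 \<Longrightarrow> \<exists>m\<in>F. u - e m \<in> slab n"
    using finite_net[of n] by blast
  \<comment> \<open>The weights decrease, so the one at the largest index \<open>M\<close> decides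
    the admissible defect \<gamma>.\<close>
  define M where "M = Max (insert n F)"
  have M: "n \<le> M" "\<And>m. m \<in> F \<Longrightarrow> m \<le> M" using F(1) by (auto simp: M_def)
  define \<gamma> where "\<gamma> = \<theta> * (1/2)^M * (\<epsilon> / 8)\<^sup>2 / 4"
  have \<gamma>: "0 < \<gamma>" using \<theta> \<epsilon> by (simp add: \<gamma>_def)
  show ?thesis
  proof (rule that[OF \<gamma>])
    fix b u assume b: "b \<in> B" "G \<theta> x - \<gamma> \<le> b x - \<theta> * h b" and u: "u \<in> Y"
    have close: "(p m a - p m b)\<^sup>2 + (a (e m) - b (e m))\<^sup>2 \<le> (\<epsilon> / 8)\<^sup>2" if "m \<le> M" for m
    proof -
      let ?X = "(p m a - p m b)\<^sup>2 + (a (e m) - b (e m))\<^sup>2"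
      have "\<theta> * (1/2)^m * ?X / 4 \<le> \<gamma>"
        using near_maximizers[OF a(1) b(1) less_imp_le[OF \<theta>] x, of m] a(2) b(2) \<gamma> by argo
      also have "\<gamma> \<le> \<theta> * (1/2)^m * (\<epsilon> / 8)\<^sup>2 / 4"
        unfolding \<gamma>_def using \<theta> that
        by (intro divide_right_mono mult_right_mono mult_left_mono power_decreasing) auto
      finally have "(\<theta> * (1/2)^m) * ?X \<le> (\<theta> * (1/2)^m) * (\<epsilon> / 8)\<^sup>2" by simp
      then show ?thesis using \<theta> by (subst (asm) mult_le_cancel_left_pos) auto
    qed
    have "(p n a - p n b)\<^sup>2 \<le> (\<epsilon> / 8)\<^sup>2" using close[OF M(1)] zero_le_power2[of "a (e n) - b (e n)"] by linarith
    then have "\<bar>p n a - p n b\<bar> \<le> \<epsilon> / 8" using \<epsilon> abs_le_square_iff[of "p n a - p n b" "\<epsilon> / 8"] by simp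
    then have pb: "p n b \<le> \<epsilon> / 4" using n by linarith
    have ball: "\<bar>a u - b u\<bar> \<le> \<epsilon>" if u: "u \<in> Y" "norm u \<le> 1" for u
    proof -
      obtain m where m: "m \<in> F" "u - e m \<in> slab n" using F(2)[OF u] by blast
      have "(a (e m) - b (e m))\<^sup>2 \<le> (\<epsilon> / 8)\<^sup>2"
        using close[OF M(2)[OF m(1)]] zero_le_power2[of "p m a - p m b"] by linarith
      then have "\<bar>a (e m) - b (e m)\<bar> \<le> \<epsilon> / 8"
        using \<epsilon> abs_le_square_iff[of "a (e m) - b (e m)" "\<epsilon> / 8"] by simp
      then show ?thesis
        using p_ge[OF a(1) m(2)] p_ge[OF b(1) m(2)] n pb \<epsilon>
          dual_ball_diff[OF Y a(1) u(1) e(1)[of m]] dual_ball_diff[OF Y b(1) u(1) e(1)[of m]] by linarith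
    qed
    show "\<bar>a u - b u\<bar> \<le> \<epsilon> * norm u"
    proof (cases "u = 0")
      case True
      then show ?thesis using dual_ball_le[OF a(1) u] dual_ball_le[OF b(1) u] by simp
    next
      case False
      define v where "v = inverse (norm u) *\<^sub>R u"
      have v: "v \<in> Y" "norm v \<le> 1" using u False subspace_scale[OF Y] by (auto simp: v_def)
      have "a u - b u = norm u * (a v - b v)"
        using dual_ball_scale[OF a(1) u] dual_ball_scale[OF b(1) u] False
        by (simp add: v_def field_simps)
      then have "\<bar>a u - b u\<bar> = norm u * \<bar>a v - b v\<bar>" by (simp add: abs_mult)
      also have "\<dots> \<le> norm u * \<epsilon>" by (intro mult_left_mono ball v) auto
      finally show ?thesis by (simp add: mult.commute)
    qed
  qed
qed

text \<open>Smulian's test: a strong maximizer is a Frechet derivative of the conjugate. Functionals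
  with defect above \<gamma> cannot catch up while norm v < \<gamma>/2, and the others are within
  \<epsilon> of \<open>a\<close>. The upper estimate is the half of differentiability that a
  function added to \<open>f\<close> has to satisfy.\<close>

lemma G_smooth:
  assumes \<theta>: "0 < \<theta>" and x: "x \<in> Y"
  obtains a where "a \<in> B"
    "\<And>\<epsilon>. 0 < \<epsilon> \<Longrightarrow> \<exists>\<delta>>0. \<forall>v\<in>Y. norm v < \<delta> \<longrightarrow> G \<theta> (x + v) \<le> G \<theta> x + a v + \<epsilon> * norm v"
proof -
  obtain a where a: "a \<in> B" "a x - \<theta> * h a = G \<theta> x" by (rule maximizer_exists[OF \<theta> x])
  show ?thesis
  proof (rule that[OF a(1)])
    fix \<epsilon> :: real assume \<epsilon>: "0 < \<epsilon>"
    obtain \<gamma> where \<gamma>: "0 < \<gamma>"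
      "\<And>b u. b \<in> B \<Longrightarrow> G \<theta> x - \<gamma> \<le> b x - \<theta> * h b \<Longrightarrow> u \<in> Y \<Longrightarrow> \<bar>a u - b u\<bar> \<le> \<epsilon> * norm u"
      using strong_maximizer[OF \<theta> x a \<epsilon>] by blast
    have "G \<theta> (x + v) \<le> G \<theta> x + a v + \<epsilon> * norm v" if v: "v \<in> Y" "norm v < \<gamma> / 2" for v
    proof (rule G_le)
      fix b assume b: "b \<in> B"
      have eq: "b (x + v) = b x + b v" by (rule dual_ball_add[OF b x v(1)])
      show "b (x + v) - \<theta> * h b \<le> G \<theta> x + a v + \<epsilon> * norm v"
      proof (cases "G \<theta> x - \<gamma> \<le> b x - \<theta> * h b")
        case True
        then show ?thesis using \<gamma>(2)[OF b True v(1)] G_ge[OF b _ x, of \<theta>] \<theta> eq by linarith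
      next
        case False
        moreover have "0 \<le> \<epsilon> * norm v" using \<epsilon> by simp
        ultimately show ?thesis
          using dual_ball_le[OF b v(1)] dual_ball_le[OF a(1) v(1)] v(2) eq by linarith
      qed
    qed
    then show "\<exists>\<delta>>0. \<forall>v\<in>Y. norm v < \<delta> \<longrightarrow> G \<theta> (x + v) \<le> G \<theta> x + a v + \<epsilon> * norm v"
      using \<gamma>(1) by (intro exI[of _ "\<gamma> / 2"]) auto
  qed
qed

end

section \<open>A Borwein-Preiss variational principle\<close>

text \<open>Closedness of the epigraph of an extended-valued function with domain \<open>M\<close>,
  expressed by its real values there: limits of points with bounded values stay in the domain.
  Convergent bounds \<open>bs\<close> allow a continuous perturbation to be moved to the other
  side.\<close>

definition seq_lsc_on :: "'a::topological_space set \<Rightarrow> ('a \<Rightarrow> real) \<Rightarrow> bool" where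
  "seq_lsc_on M F \<longleftrightarrow> (\<forall>zs z bs b. (\<forall>k. zs k \<in> M) \<and> zs \<longlonglongrightarrow> z \<and> (\<forall>k. F (zs k) \<le> bs k) \<and> bs \<longlonglongrightarrow> b
     \<longrightarrow> z \<in> M \<and> F z \<le> b)"

lemma seq_lsc_onI:
  assumes "\<And>zs z bs b. (\<And>k. zs k \<in> M) \<Longrightarrow> zs \<longlonglongrightarrow> z \<Longrightarrow> (\<And>k. F (zs k) \<le> bs k) \<Longrightarrow> bs \<longlonglongrightarrow> b
    \<Longrightarrow> z \<in> M \<and> F z \<le> b"
  shows "seq_lsc_on M F"
  using assms unfolding seq_lsc_on_def by metis

lemma seq_lsc_onD:
  assumes "seq_lsc_on M F" "\<And>k. zs k \<in> M" "zs \<longlonglongrightarrow> z" "\<And>k. F (zs k) \<le> bs k" "bs \<longlonglongrightarrow> b"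
  shows "z \<in> M \<and> F z \<le> b"
  using assms unfolding seq_lsc_on_def by blast

text \<open>Either \<open>y\<close> is itself nearly optimal, or a nearly optimal point lies
  strictly below it.\<close>

lemma near_minimizer_below:
  fixes F :: "'a \<Rightarrow> real"
  assumes y: "y \<in> M" and low: "\<And>z. z \<in> M \<Longrightarrow> c \<le> F z" and \<epsilon>: "0 < \<epsilon>"
  obtains y' where "y' \<in> M" "F y' \<le> F y" "\<And>z. z \<in> M \<Longrightarrow> F y' - \<epsilon> \<le> F z"
proof -
  define m where "m = (INF z\<in>M. F z)"
  have bdd: "bdd_below (F ` M)" by (rule bdd_belowI2[OF low])
  have m: "m \<le> F z" if "z \<in> M" for z
    unfolding m_def by (rule cINF_lower[OF bdd that])
  show ?thesis
  proof (cases "F y \<le> m + \<epsilon>")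
    case True
    show ?thesis by (rule that[of y]) (use True y m in force)+
  next
    case False
    have "m < m + \<epsilon>" using \<epsilon> by simp
    then obtain y' where y': "y' \<in> M" "F y' < m + \<epsilon>"
      using cINF_less_iff[OF _ bdd, of "m + \<epsilon>"] y unfolding m_def by blast
    show ?thesis by (rule that[of y']) (use False y' m in force)+
  qed
qed

text \<open>Each new point nearly minimizes the current perturbed function, and the next
  perturbation adds \<open>\<mu> n * g (z - y n)\<close>, which vanishes at \<open>y n\<close>.
  Minimality up to \<mu> n/(n+1) bounds g(y j - y n) by 1/(n+1), and \<open>gauge\<close> makes the
  points Cauchy. \<open>g\<close> and \<open>\<phi>0\<close> are parameters so that the norm gives
  Ekeland's principle and a smooth \<open>g\<close> the Borwein-Preiss version.\<close>

lemma variational_principle: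
  fixes F \<phi>0 g :: "'a::banach \<Rightarrow> real"
  assumes x0: "x0 \<in> M" and MZ: "M \<subseteq> Z" and Z: "closed Z"
    and lsc: "seq_lsc_on M F"
    and low: "\<And>z. z \<in> M \<Longrightarrow> F x0 + \<phi>0 x0 - \<epsilon>0 \<le> F z + \<phi>0 z"
    and cont: "continuous_on Z \<phi>0"
    and g_lip: "\<And>z w y. z \<in> Z \<Longrightarrow> w \<in> Z \<Longrightarrow> y \<in> Z \<Longrightarrow> g (z - y) \<le> g (w - y) + norm (z - w)"
    and g_nonneg: "\<And>z y. z \<in> Z \<Longrightarrow> y \<in> Z \<Longrightarrow> 0 \<le> g (z - y)" and g0: "g 0 = 0"
    and gauge: "\<And>\<epsilon>. 0 < \<epsilon> \<Longrightarrow> \<exists>\<delta>>0. \<forall>z\<in>Z. \<forall>y\<in>Z. g (z - y) \<le> \<delta> \<longrightarrow> norm (z - y) \<le> \<epsilon>"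
    and \<mu>: "\<And>i. 0 < \<mu> i" "summable \<mu>"
  obtains y ybar where "\<And>i. y i \<in> M" "y \<longlonglongrightarrow> ybar" "ybar \<in> M" "F ybar + \<phi>0 ybar \<le> F x0 + \<phi>0 x0"
    "\<And>z. z \<in> M \<Longrightarrow> F ybar + \<phi>0 ybar + (\<Sum>i. \<mu> i * g (ybar - y i)) \<le> F z + \<phi>0 z + (\<Sum>i. \<mu> i * g (z - y i))"
proof -
  \<comment> \<open>The defect of the given starting point is \<epsilon>0 and cannot be prescribed,
    so the estimate \<open>gy\<close> starts at n = 1.\<close>
  define \<epsilon> where "\<epsilon> n = (if n = 0 then \<epsilon>0 else \<mu> n * inverse (Suc n))" for n
  \<comment> \<open>The state consists of the perturbation collected so far and the current
    point.\<close>
  define P where "P n st \<longleftrightarrow> (n = 0 \<longrightarrow> st = (\<phi>0, x0)) \<and> snd st \<in> M \<and> (\<forall>z\<in>M. \<phi>0 z \<le> fst st z)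
      \<and> (\<forall>z\<in>M. F (snd st) + fst st (snd st) - \<epsilon> n \<le> F z + fst st z)" for n and st :: "('a \<Rightarrow> real) \<times> 'a"
  define Q where "Q n st st' \<longleftrightarrow> fst st' = (\<lambda>z. fst st z + \<mu> n * g (z - snd st))
      \<and> F (snd st') + fst st' (snd st') \<le> F (snd st) + fst st' (snd st)"
    for n and st st' :: "('a \<Rightarrow> real) \<times> 'a"
  have "\<exists>st. \<forall>n. P n (st n) \<and> Q n (st n) (st (Suc n))"
  proof (rule dependent_nat_choice)
    show "\<exists>st. P 0 st" using x0 low by (auto simp: P_def \<epsilon>_def)
  next
    fix st n assume st: "P n st"
    obtain \<phi> y where [simp]: "st = (\<phi>, y)" by (cases st)
    have y: "y \<in> M" "\<And>z. z \<in> M \<Longrightarrow> \<phi>0 z \<le> \<phi> z" using st by (auto simp: P_def)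
    define \<phi>' where "\<phi>' = (\<lambda>z. \<phi> z + \<mu> n * g (z - y))"
    have \<phi>': "\<phi>0 z \<le> \<phi>' z" if "z \<in> M" for z
      using y(2)[OF that] mult_nonneg_nonneg[OF less_imp_le[OF \<mu>(1)[of n]] g_nonneg[of z y]] that y(1) MZ
      by (force simp: \<phi>'_def)
    have "F x0 + \<phi>0 x0 - \<epsilon>0 \<le> F z + \<phi>' z" if "z \<in> M" for z
      using low[OF that] \<phi>'[OF that] by linarith
    moreover have "0 < \<epsilon> (Suc n)" using \<mu>(1) by (simp add: \<epsilon>_def)
    ultimately obtain y' where "y' \<in> M" "F y' + \<phi>' y' \<le> F y + \<phi>' y"
        "\<And>z. z \<in> M \<Longrightarrow> F y' + \<phi>' y' - \<epsilon> (Suc n) \<le> F z + \<phi>' z"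
      using near_minimizer_below[OF y(1), of "F x0 + \<phi>0 x0 - \<epsilon>0" "\<lambda>z. F z + \<phi>' z" "\<epsilon> (Suc n)"] by blast
    with \<phi>' have "P (Suc n) (\<phi>', y') \<and> Q n st (\<phi>', y')" by (simp add: P_def Q_def \<phi>'_def)
    then show "\<exists>st'. P (Suc n) st' \<and> Q n st st'" by blast
  qed
  then obtain st where st: "\<And>n. P n (st n)" "\<And>n. Q n (st n) (st (Suc n))" by blast
  define y where "y n = snd (st n)" for n
  define \<phi> where "\<phi> n = fst (st n)" for n
  have yM: "y n \<in> M" for n using st(1)[of n] by (simp add: P_def y_def)
  then have yZ: "y n \<in> Z" for n using MZ by auto
  have st0: "\<phi> 0 = \<phi>0" "y 0 = x0" using st(1)[of 0] by (auto simp: P_def y_def \<phi>_def)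
  have min: "F (y n) + \<phi> n (y n) - \<epsilon> n \<le> F z + \<phi> n z" if "z \<in> M" for n z
    using st(1)[of n] that by (simp add: P_def y_def \<phi>_def)
  have step: "\<phi> (Suc n) = (\<lambda>z. \<phi> n z + \<mu> n * g (z - y n))"
    and desc: "F (y (Suc n)) + \<phi> (Suc n) (y (Suc n)) \<le> F (y n) + \<phi> (Suc n) (y n)" for n
    using st(2)[of n] by (auto simp: Q_def y_def \<phi>_def)
  have \<phi>_eq: "\<phi> n z = \<phi>0 z + (\<Sum>i<n. \<mu> i * g (z - y i))" for n z
    by (induction n) (auto simp: st0 step)
  have tm: "0 \<le> \<mu> i * g (z - y i)" if "z \<in> Z" for i z
    using \<mu>(1)[of i] g_nonneg[OF that yZ[of i]] by (intro mult_nonneg_nonneg) auto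
  have \<phi>_mono: "\<phi> m z \<le> \<phi> n z" if "m \<le> n" "z \<in> Z" for m n z
    unfolding \<phi>_eq using that tm by (intro add_left_mono sum_mono2) auto
  define V where "V n = F (y n) + \<phi> n (y n)" for n
  have V_eq: "F (y n) + \<phi> (Suc n) (y n) = V n" for n by (simp add: V_def step g0)
  have "decseq V" using desc V_eq by (intro decseq_SucI) (metis V_def)
  \<comment> \<open>The perturbations only grow and the perturbed values decrease, so all points
    from stage n on stay below \<open>V n\<close> for the perturbation of stage n + 1.\<close>
  have later: "F (y j) + \<phi> (Suc n) (y j) \<le> V n" if "n \<le> j" for n j
  proof (cases "j = n")
    case True
    then show ?thesis using V_eq by simp
  next
    case False
    then have "F (y j) + \<phi> (Suc n) (y j) \<le> V j"
      using that \<phi>_mono[of "Suc n" j "y j"] yZ by (simp add: V_def)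
    also have "V j \<le> V n" using \<open>decseq V\<close> that by (simp add: decseq_def)
    finally show ?thesis .
  qed
  have gy: "g (y j - y n) \<le> inverse (Suc n)" if "n \<le> j" "n \<noteq> 0" for n j
  proof -
    have "\<mu> n * g (y j - y n) \<le> \<epsilon> n"
      using later[OF that(1)] min[OF yM[of j], of n] by (simp add: step V_def)
    then have "\<mu> n * g (y j - y n) \<le> \<mu> n * inverse (Suc n)" using that by (simp add: \<epsilon>_def)
    then show ?thesis using \<mu>(1)[of n] by (simp del: of_nat_Suc)
  qed
  have "Cauchy y"
  proof (rule metric_CauchyI)
    fix e :: real assume e: "0 < e"
    then obtain \<delta> where \<delta>: "0 < \<delta>" "\<And>z w. z \<in> Z \<Longrightarrow> w \<in> Z \<Longrightarrow> g (z - w) \<le> \<delta> \<Longrightarrow> norm (z - w) \<le> e / 3"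
      using gauge[of "e / 3"] by auto
    obtain n0 where n0: "inverse (real (Suc n0)) < \<delta>" using reals_Archimedean \<delta>(1) by blast
    define n where "n = Suc n0"
    have "inverse (real (Suc n)) \<le> inverse (real (Suc n0))" by (rule le_imp_inverse_le) (auto simp: n_def)
    with n0 have n: "inverse (real (Suc n)) \<le> \<delta>" by linarith
    have "norm (y j - y n) \<le> e / 3" if "n \<le> j" for j
      by (intro \<delta>(2) yZ order_trans[OF gy n] that) (simp add: n_def)
    then have near: "dist (y j) (y n) \<le> e / 3" if "n \<le> j" for j using that by (simp add: dist_norm)
    have "dist (y j) (y k) < e" if "n \<le> j" "n \<le> k" for j k
      using near[OF that(1)] near[OF that(2)]
        dist_triangle2[of "y j" "y k" "y n"] e by linarith
    then show "\<exists>M. \<forall>m\<ge>M. \<forall>n\<ge>M. dist (y m) (y n) < e" by blast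
  qed
  then obtain ybar where lim: "y \<longlonglongrightarrow> ybar" using Cauchy_convergent convergent_def by blast
  have barZ: "ybar \<in> Z" using closed_sequentially[OF Z, of y] yZ lim by blast
  have \<phi>_cont: "(\<lambda>j. \<phi> n (zs j)) \<longlonglongrightarrow> \<phi> n z" if zs: "\<And>j. zs j \<in> Z" "zs \<longlonglongrightarrow> z" for n zs z
  proof -
    have zZ: "z \<in> Z" using closed_sequentially[OF Z, of zs] zs by blast
    have "(\<lambda>j. g (zs j - y i)) \<longlonglongrightarrow> g (z - y i)" for i
    proof (rule LIM_zero_cancel, rule Lim_null_comparison)
      show "\<forall>\<^sub>F j in sequentially. norm (g (zs j - y i) - g (z - y i)) \<le> norm (zs j - z)"
        using g_lip[OF zs(1) zZ yZ] g_lip[OF zZ zs(1) yZ]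
        by (intro always_eventually allI) (simp add: abs_le_iff norm_minus_commute algebra_simps)
      show "(\<lambda>j. norm (zs j - z)) \<longlonglongrightarrow> 0" using LIM_zero[OF zs(2)] tendsto_norm_zero by blast
    qed
    moreover have "(\<lambda>j. \<phi>0 (zs j)) \<longlonglongrightarrow> \<phi>0 z"
      using cont zs zZ by (simp add: continuous_on_sequentially comp_def)
    ultimately show ?thesis unfolding \<phi>_eq by (intro tendsto_intros)
  qed
  have bar: "ybar \<in> M \<and> F ybar \<le> V n - \<phi> (Suc n) ybar" for n
  proof (rule seq_lsc_onD[OF lsc])
    show "y (k + n) \<in> M" for k by (rule yM)
    show tl: "(\<lambda>k. y (k + n)) \<longlonglongrightarrow> ybar" using lim by (rule LIMSEQ_ignore_initial_segment)
    show "F (y (k + n)) \<le> V n - \<phi> (Suc n) (y (k + n))" for k using later[of n "k + n"] by simp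
    show "(\<lambda>k. V n - \<phi> (Suc n) (y (k + n))) \<longlonglongrightarrow> V n - \<phi> (Suc n) ybar"
      by (intro tendsto_intros \<phi>_cont yZ tl)
  qed
  have summ: "summable (\<lambda>i. \<mu> i * g (z - y i))" if z: "z \<in> Z" for z
  proof -
    obtain K where K: "\<And>i. norm (y i) \<le> K"
      using convergent_imp_Bseq[of y] lim by (metis Bseq_def convergentI)
    have "norm (\<mu> i * g (z - y i)) \<le> \<mu> i * (norm z + K)" for i
    proof -
      have "g (z - y i) \<le> norm z + K"
        using g_lip[OF z yZ yZ, of i i] g0 norm_triangle_ineq4[of z "y i"] K[of i] by simp
      then show ?thesis using \<mu>(1)[of i] tm[OF z] g_nonneg[OF z yZ[of i]] by (simp add: abs_mult)
    qed
    then show ?thesis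
      by (intro summable_comparison_test'[OF summable_mult2[OF \<mu>(2), of "norm z + K"]]) auto
  qed
  show ?thesis
  proof (rule that[of y ybar])
    show "y i \<in> M" for i by (rule yM)
    show "y \<longlonglongrightarrow> ybar" by (rule lim)
    show "ybar \<in> M" using bar by blast
    have "\<phi>0 ybar \<le> \<phi> (Suc 0) ybar" using \<phi>_mono[of 0 "Suc 0" ybar] barZ st0 by simp
    then show "F ybar + \<phi>0 ybar \<le> F x0 + \<phi>0 x0" using bar[of 0] by (simp add: V_def st0)
  next
    fix z assume z: "z \<in> M"
    then have zZ: "z \<in> Z" using MZ by auto
    \<comment> \<open>The n + 1 terms at \<open>ybar\<close> come from lower semicontinuity, and the
      terms at z may be completed to the full series since they are nonnegative. The defect tends to
      0.\<close>
    have le: "F ybar + \<phi>0 ybar + (\<Sum>i<Suc n. \<mu> i * g (ybar - y i))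
        \<le> F z + \<phi>0 z + (\<Sum>i. \<mu> i * g (z - y i)) + \<epsilon> n" for n
    proof -
      have "(\<Sum>i<n. \<mu> i * g (z - y i)) \<le> (\<Sum>i. \<mu> i * g (z - y i))"
        using summ[OF zZ] tm[OF zZ] by (intro sum_le_suminf) auto
      then show ?thesis using bar[of n] min[OF z, of n] unfolding \<phi>_eq V_def by linarith
    qed
    have "\<epsilon> \<longlonglongrightarrow> 0"
    proof (rule Lim_null_comparison)
      have "norm (\<epsilon> n) \<le> \<mu> n" if "1 \<le> n" for n
      proof -
        have "inverse (real (Suc n)) \<le> 1" using le_imp_inverse_le[of 1 "real (Suc n)"] by simp
        then have "\<mu> n * inverse (real (Suc n)) \<le> \<mu> n * 1" using \<mu>(1)[of n] by (intro mult_left_mono) auto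
        then show ?thesis using that \<mu>(1)[of n] by (simp add: \<epsilon>_def abs_mult)
      qed
      then show "\<forall>\<^sub>F n in sequentially. norm (\<epsilon> n) \<le> \<mu> n" unfolding eventually_sequentially by blast
      show "\<mu> \<longlonglongrightarrow> 0" by (rule summable_LIMSEQ_zero[OF \<mu>(2)])
    qed
    then have r: "(\<lambda>n. F z + \<phi>0 z + (\<Sum>i. \<mu> i * g (z - y i)) + \<epsilon> n) \<longlonglongrightarrow> F z + \<phi>0 z + (\<Sum>i. \<mu> i * g (z - y i)) + 0"
      by (intro tendsto_intros)
    have "(\<lambda>n. \<Sum>i<Suc n. \<mu> i * g (ybar - y i)) \<longlonglongrightarrow> (\<Sum>i. \<mu> i * g (ybar - y i))"
      using summable_LIMSEQ[OF summ[OF barZ]] by (rule LIMSEQ_Suc)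
    then have "(\<lambda>n. F ybar + \<phi>0 ybar + (\<Sum>i<Suc n. \<mu> i * g (ybar - y i)))
        \<longlonglongrightarrow> F ybar + \<phi>0 ybar + (\<Sum>i. \<mu> i * g (ybar - y i))" by (intro tendsto_intros)
    from LIMSEQ_le[OF this r] le
    show "F ybar + \<phi>0 ybar + (\<Sum>i. \<mu> i * g (ybar - y i)) \<le> F z + \<phi>0 z + (\<Sum>i. \<mu> i * g (z - y i))"
      by simp
  qed
qed

section \<open>Separable reduction\<close>

text \<open>Iterate \<omega> times; a list over the union already lies over a single stage.\<close>

lemma countable_closed_set:
  fixes \<Phi> :: "'a list \<Rightarrow> 'a set"
  assumes "\<And>l. countable (\<Phi> l)"
  obtains T where "countable T" "x0 \<in> T" "\<And>l. set l \<subseteq> T \<Longrightarrow> \<Phi> l \<subseteq> T"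
proof -
  define S where "S = rec_nat {x0} (\<lambda>_ T. T \<union> (\<Union>l\<in>lists T. \<Phi> l))"
  have S: "S 0 = {x0}" "\<And>n. S (Suc n) = S n \<union> (\<Union>l\<in>lists (S n). \<Phi> l)" by (auto simp: S_def)
  have "countable (S n)" for n
    by (induction n) (auto simp: S assms intro!: countable_UN)
  moreover have "incseq S" by (rule incseq_SucI) (auto simp: S)
  have "\<exists>n. set l \<subseteq> S n" if "set l \<subseteq> (\<Union>n. S n)" for l
    using that
  proof (induction l)
    case (Cons x l)
    then obtain m n where "set l \<subseteq> S m" "x \<in> S n" by auto
    then have "set (x # l) \<subseteq> S (max m n)"
      using incseqD[OF \<open>incseq S\<close>, of m "max m n"] incseqD[OF \<open>incseq S\<close>, of n "max m n"] by auto
    then show ?case by blast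
  qed simp
  then have "\<Phi> l \<subseteq> (\<Union>n. S n)" if "set l \<subseteq> (\<Union>n. S n)" for l
  proof -
    obtain n where "set l \<subseteq> S n" using \<open>\<And>l. set l \<subseteq> (\<Union>n. S n) \<Longrightarrow> \<exists>n. set l \<subseteq> S n\<close> \<open>set l \<subseteq> (\<Union>n. S n)\<close> by blast
    then have "\<Phi> l \<subseteq> S (Suc n)" by (auto simp: S)
    then show ?thesis by blast
  qed
  ultimately show ?thesis using S(1) by (intro that[of "\<Union>n. S n"]) auto
qed

text \<open>Each entry of the list holds a weight, a bound for the value of \<open>f\<close> and a bound for the distance to \<open>t\<close>;
  the data are rational so that there are only countably many of them.\<close>
definition approx_family :: "('a::real_normed_vector \<Rightarrow> ereal) \<Rightarrow> 'a \<Rightarrow> (rat \<times> rat \<times> rat) list \<times> rat \<Rightarrow> (nat \<Rightarrow> 'a) \<Rightarrow> bool" where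
  "approx_family f t D z \<longleftrightarrow>
     (\<forall>i<length (fst D). f (z i) < ereal (of_rat (fst (snd (fst D ! i)))) \<and> norm (z i - t) < of_rat (snd (snd (fst D ! i))))
     \<and> norm ((\<Sum>i<length (fst D). of_rat (fst (fst D ! i)) *\<^sub>R z i) - t) < of_rat (snd D)"

text \<open>Closure under Skolem functions for \<open>approx_family\<close>, in the manner of an
  elementary submodel.\<close>

definition approx_closed :: "('a::real_normed_vector \<Rightarrow> ereal) \<Rightarrow> 'a set \<Rightarrow> bool" where
  "approx_closed f T \<longleftrightarrow> (\<forall>t\<in>T. \<forall>D z. approx_family f t D z \<longrightarrow>
     (\<exists>z'. approx_family f t D z' \<and> (\<forall>i<length (fst D). z' i \<in> T)))"

text \<open>\<open>T\<close> is generated from \<open>x0\<close> by sums, rational multiples and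
  selected witnesses, countably many operations in all; after closure the rational multiples yield
  all real ones.\<close>

lemma separable_reduction_set:
  fixes f :: "'a::real_normed_vector \<Rightarrow> ereal"
  obtains T where "countable T" "x0 \<in> T" "subspace (closure T)"
    "approx_closed f T"
proof -
  define sel where "sel t D = (SOME z. approx_family f t D z)" for t D
  \<comment> \<open>Lists encode arguments: [s, t] yields the sum, [t] the multiples and witnesses
    of t. The empty list contributes the countable set attached to the unspecified
    \<open>hd []\<close>, which does no harm.\<close>
  define \<Phi> where "\<Phi> l = {hd l + last l} \<union> range (\<lambda>r. of_rat r *\<^sub>R hd l)
      \<union> range (\<lambda>(D, i). sel (hd l) D i)" for l
  have "countable (\<Phi> l)" for l by (auto simp: \<Phi>_def)
  then obtain T where T: "countable T" "x0 \<in> T" "\<And>l. set l \<subseteq> T \<Longrightarrow> \<Phi> l \<subseteq> T"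
    using countable_closed_set[of \<Phi> x0] by blast
  have add: "s + t \<in> T" if "s \<in> T" "t \<in> T" for s t
    using T(3)[of "[s, t]"] that by (auto simp: \<Phi>_def)
  have scale: "of_rat r *\<^sub>R t \<in> T" if "t \<in> T" for r t
    using T(3)[of "[t]"] that by (auto simp: \<Phi>_def)
  have sel: "sel t D i \<in> T" if "t \<in> T" for t D i
    using T(3)[of "[t]"] that by (force simp: \<Phi>_def)
  have "subspace (closure T)"
    unfolding subspace_def
  proof (intro conjI ballI allI)
    show "0 \<in> closure T" using scale[OF T(2), of 0] closure_subset by auto
  next
    fix u v assume "u \<in> closure T" "v \<in> closure T"
    then obtain us vs where "\<And>n. us n \<in> T" "us \<longlonglongrightarrow> u" "\<And>n. vs n \<in> T" "vs \<longlonglongrightarrow> v"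
      by (auto simp: closure_sequential)
    then show "u + v \<in> closure T"
      using add by (auto simp: closure_sequential intro!: exI[of _ "\<lambda>n. us n + vs n"] tendsto_add)
  next
    fix c :: real and u assume "u \<in> closure T"
    then obtain us where us: "\<And>n. us n \<in> T" "us \<longlonglongrightarrow> u"
      by (auto simp: closure_sequential)
    have "\<exists>r. c < of_rat r \<and> real_of_rat r < c + inverse (Suc n)" for n
      by (rule of_rat_dense) simp
    then obtain r where r: "\<And>n. c < of_rat (r n)" "\<And>n. real_of_rat (r n) < c + inverse (Suc n)" by metis
    have "(\<lambda>n. real_of_rat (r n)) \<longlonglongrightarrow> c"
    proof (rule tendsto_sandwich)
      show "\<forall>\<^sub>F n in sequentially. c \<le> real_of_rat (r n)"
        "\<forall>\<^sub>F n in sequentially. real_of_rat (r n) \<le> c + inverse (real (Suc n))"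
        using r by (auto intro!: always_eventually less_imp_le simp del: of_nat_Suc)
      show "(\<lambda>n. c + inverse (real (Suc n))) \<longlonglongrightarrow> c"
        using tendsto_add[OF tendsto_const LIMSEQ_inverse_real_of_nat, of c] by simp
    qed simp
    then show "c *\<^sub>R u \<in> closure T"
      using us scale by (auto simp: closure_sequential intro!: exI[of _ "\<lambda>n. of_rat (r n) *\<^sub>R us n"] tendsto_scaleR)
  qed
  moreover have "\<exists>z'. approx_family f t D z' \<and> (\<forall>i<length (fst D). z' i \<in> T)"
    if "t \<in> T" "approx_family f t D z" for t D z
    using someI[of "approx_family f t D" z] that sel unfolding sel_def by blast
  ultimately show ?thesis using T by (intro that) (auto simp: approx_closed_def)
qed

text \<open>All data are rounded up to rationals and x is replaced by some t in \<open>T\<close>, so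
  that \<open>approx_closed\<close> applies. The last estimate spends 7\<gamma>/8: the rounding of c
  and two changes of centre at \<gamma>/8 each, two changes of weights at \<gamma>/4 each.\<close>

lemma approximate_family_in_closure:
  fixes f :: "'a::real_normed_vector \<Rightarrow> ereal" and u :: "nat \<Rightarrow> real"
  assumes T: "approx_closed f T"
    and x: "x \<in> closure T" and fz: "\<And>i. i < n \<Longrightarrow> f (z i) = ereal (F i)" and \<gamma>: "0 < \<gamma>"
  obtains z' where "\<And>i. i < n \<Longrightarrow> z' i \<in> T" "\<And>i. i < n \<Longrightarrow> f (z' i) \<le> ereal (F i + \<gamma>)"
    "\<And>i. i < n \<Longrightarrow> norm (z' i - x) < norm (z i - x) + \<gamma>"
    "norm ((\<Sum>i<n. u i *\<^sub>R z' i) - x) < norm ((\<Sum>i<n. u i *\<^sub>R z i) - x) + \<gamma>"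
proof -
  \<comment> \<open>\<open>K\<close> bounds the norms of the given points and of the points still to
    be found, whose distance to x exceeds that of the given ones by less than \<gamma>. It
    determines the rounding \<sigma> of the weights.\<close>
  define K where "K = 1 + norm x + \<gamma> + (\<Sum>i<n. norm (z i - x))"
  have K: "0 < K" using \<gamma> norm_ge_zero[of x] sum_nonneg[of "{..<n}" "\<lambda>i. norm (z i - x)", OF norm_ge_zero]
    unfolding K_def by linarith
  have zK: "norm x + norm (z i - x) + \<gamma> \<le> K" if "i < n" for i
    using member_le_sum[of i "{..<n}" "\<lambda>i. norm (z i - x)"] that by (simp add: K_def)
  define \<sigma> where "\<sigma> = \<gamma> / (4 * (real n + 1) * K)"
  have \<sigma>: "0 < \<sigma>" using \<gamma> K by (simp add: \<sigma>_def)
  have \<sigma>K: "real n * \<sigma> * K \<le> \<gamma> / 4"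
  proof -
    have "real n * (\<sigma> * K) \<le> (real n + 1) * (\<sigma> * K)" using \<sigma> K by (intro mult_right_mono) auto
    also have "\<dots> = (4 * (real n + 1) * K * \<sigma>) / 4" by simp
    also have "4 * (real n + 1) * K * \<sigma> = \<gamma>"
    proof -
      have "4 * (real n + 1) * K \<noteq> 0" using K by simp
      moreover have "X * (\<gamma> / X) = \<gamma>" if "X \<noteq> 0" for X using that by simp
      ultimately show ?thesis unfolding \<sigma>_def by blast
    qed
    finally show ?thesis by (simp add: mult.assoc)
  qed
  obtain t where t: "t \<in> T" "norm (t - x) < \<gamma> / 8"
    using x \<gamma> closure_approachable[of x T] by (auto simp: dist_norm dest!: spec[of _ "\<gamma> / 8"])
  have "\<exists>q. u i < real_of_rat q \<and> real_of_rat q < u i + \<sigma>" for i using \<sigma> by (intro of_rat_dense) simp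
  then obtain l where l: "\<And>i. u i < real_of_rat (l i)" "\<And>i. real_of_rat (l i) < u i + \<sigma>" by metis
  have "\<exists>q. F i < real_of_rat q \<and> real_of_rat q < F i + \<gamma>" for i using \<gamma> by (intro of_rat_dense) simp
  then obtain a where a: "\<And>i. F i < real_of_rat (a i)" "\<And>i. real_of_rat (a i) < F i + \<gamma>" by metis
  have "\<exists>q. norm (z i - t) < real_of_rat q \<and> real_of_rat q < norm (z i - t) + \<gamma> / 8" for i
    using \<gamma> by (intro of_rat_dense) simp
  then obtain b where b: "\<And>i. norm (z i - t) < real_of_rat (b i)"
      "\<And>i. real_of_rat (b i) < norm (z i - t) + \<gamma> / 8" by metis
  define \<Sigma> where "\<Sigma> z = (\<Sum>i<n. real_of_rat (l i) *\<^sub>R z i)" for z :: "nat \<Rightarrow> 'a"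
  obtain c where c: "norm (\<Sigma> z - t) < real_of_rat c" "real_of_rat c < norm (\<Sigma> z - t) + \<gamma> / 8"
    using of_rat_dense[of "norm (\<Sigma> z - t)" "norm (\<Sigma> z - t) + \<gamma> / 8"] \<gamma> by auto
  define D where "D = (map (\<lambda>i. (l i, a i, b i)) [0..<n], c)"
  have len: "length (fst D) = n" by (simp add: D_def)
  have nthD: "fst D ! i = (l i, a i, b i)" if "i < n" for i using that by (simp add: D_def)
  have AF: "approx_family f t D w \<longleftrightarrow> (\<forall>i<n. f (w i) < ereal (of_rat (a i)) \<and> norm (w i - t) < of_rat (b i))
      \<and> norm (\<Sigma> w - t) < of_rat c" for w
  proof -
    have "(\<Sum>i<length (fst D). of_rat (fst (fst D ! i)) *\<^sub>R w i) = \<Sigma> w"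
      unfolding len \<Sigma>_def by (intro sum.cong) (auto simp: nthD)
    then show ?thesis by (auto simp: approx_family_def len nthD) (auto simp: D_def)
  qed
  have "approx_family f t D z" using a b c fz by (auto simp: AF)
  then obtain z' where z': "approx_family f t D z'" "\<And>i. i < n \<Longrightarrow> z' i \<in> T"
    using T t(1) unfolding approx_closed_def by (metis len)
  have near: "norm (\<Sigma> w - (\<Sum>i<n. u i *\<^sub>R w i)) \<le> \<gamma> / 4" if w: "\<And>i. i < n \<Longrightarrow> norm (w i) \<le> K" for w
  proof -
    have "\<Sigma> w - (\<Sum>i<n. u i *\<^sub>R w i) = (\<Sum>i<n. (real_of_rat (l i) - u i) *\<^sub>R w i)"
      by (simp add: \<Sigma>_def sum_subtractf scaleR_diff_left)
    also have "norm \<dots> \<le> (\<Sum>i<n. \<sigma> * K)"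
    proof (rule sum_norm_le)
      fix i assume "i \<in> {..<n}"
      then show "norm ((real_of_rat (l i) - u i) *\<^sub>R w i) \<le> \<sigma> * K"
        using l[of i] w[of i] \<sigma> by (auto intro!: mult_mono)
    qed
    also have "\<dots> \<le> \<gamma> / 4" using \<sigma>K by (simp add: mult.assoc)
    finally show ?thesis .
  qed
  have z'x: "norm (z' i - x) < norm (z i - x) + \<gamma>" if "i < n" for i
  proof -
    have "norm (z' i - t) < norm (z i - t) + \<gamma> / 8" using z'(1) that b[of i] by (force simp: AF)
    then show ?thesis
      using t(2) norm_triangle_ineq[of "z' i - t" "t - x"] norm_triangle_ineq4[of "z i - x" "t - x"] \<gamma> by simp
  qed
  show ?thesis
  proof (rule that[of z'])
    show "z' i \<in> T" if "i < n" for i by (rule z'(2)[OF that])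
    show "f (z' i) \<le> ereal (F i + \<gamma>)" if "i < n" for i
    proof -
      have "f (z' i) < ereal (of_rat (a i))" using z'(1) that by (simp add: AF)
      also have "\<dots> \<le> ereal (F i + \<gamma>)" using a(2)[of i] by simp
      finally show ?thesis by simp
    qed
    show "norm (z' i - x) < norm (z i - x) + \<gamma>" if "i < n" for i by (rule z'x[OF that])
    have "norm (z' i) \<le> K" "norm (z i) \<le> K" if "i < n" for i
      using zK[OF that] z'x[OF that] norm_triangle_ineq2[of "z' i" x] norm_triangle_ineq2[of "z i" x] \<gamma> by linarith+
    then have nn: "norm (\<Sigma> z' - (\<Sum>i<n. u i *\<^sub>R z' i)) \<le> \<gamma> / 4" "norm (\<Sigma> z - (\<Sum>i<n. u i *\<^sub>R z i)) \<le> \<gamma> / 4"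
      using near by blast+
    have "norm (\<Sigma> z' - t) < norm (\<Sigma> z - t) + \<gamma> / 8" using z'(1) c by (simp add: AF)
    moreover have "norm ((\<Sum>i<n. u i *\<^sub>R z' i) - x)
        \<le> norm (\<Sigma> z' - t) + norm (\<Sigma> z' - (\<Sum>i<n. u i *\<^sub>R z' i)) + norm (t - x)"
      using norm_triangle_ineq[of "\<Sigma> z' - t" "t - x"]
        norm_triangle_ineq4[of "\<Sigma> z' - x" "\<Sigma> z' - (\<Sum>i<n. u i *\<^sub>R z' i)"] by simp
    moreover have "norm (\<Sigma> z - t)
        \<le> norm ((\<Sum>i<n. u i *\<^sub>R z i) - x) + norm (\<Sigma> z - (\<Sum>i<n. u i *\<^sub>R z i)) + norm (t - x)"
      using norm_triangle_ineq[of "\<Sigma> z - (\<Sum>i<n. u i *\<^sub>R z i)" "(\<Sum>i<n. u i *\<^sub>R z i) - x"]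
        norm_triangle_ineq4[of "\<Sigma> z - x" "t - x"] by simp
    ultimately show "norm ((\<Sum>i<n. u i *\<^sub>R z' i) - x) < norm ((\<Sum>i<n. u i *\<^sub>R z i) - x) + \<gamma>"
      using nn t(2) \<gamma> by linarith
  qed
qed

section \<open>Frechet subgradients from finite convex combinations\<close>

lemma frechet_subdiffI:
  fixes f :: "'a::real_normed_vector \<Rightarrow> ereal"
  assumes fx: "f x = ereal fx"
    and ineq: "\<And>\<epsilon>. 0 < \<epsilon> \<Longrightarrow> \<exists>\<delta>>0. \<forall>v. norm v < \<delta> \<longrightarrow> ereal (fx + blinfun_apply xs v - \<epsilon> * norm v) \<le> f (x + v)"
  shows "xs \<in> frechet_subdiff f x"
proof -
  have "0 \<le> Liminf (at x) (\<lambda>y. (f y - f x - ereal (blinfun_apply xs (y - x))) / ereal (norm (y - x)))"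
    unfolding le_Liminf_iff
  proof (intro allI impI)
    fix m :: ereal assume m: "m < 0"
    then obtain \<epsilon> where \<epsilon>: "0 < \<epsilon>" "m < ereal (- \<epsilon>)"
      using ereal_dense2[of m 0] by (metis ereal_less(2) ereal_less_eq(3) less_ereal.simps(1) minus_minus neg_less_0_iff_less zero_ereal_def)
    obtain \<delta> where \<delta>: "0 < \<delta>" "\<And>v. norm v < \<delta> \<Longrightarrow> ereal (fx + blinfun_apply xs v - \<epsilon> * norm v) \<le> f (x + v)"
      using ineq[OF \<epsilon>(1)] by blast
    have "m < (f y - f x - ereal (blinfun_apply xs (y - x))) / ereal (norm (y - x))"
      if y: "y \<noteq> x" "dist y x < \<delta>" for y
    proof -
      have le: "ereal (fx + blinfun_apply xs (y - x) - \<epsilon> * norm (y - x)) \<le> f y"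
        using \<delta>(2)[of "y - x"] y by (simp add: dist_norm)
      have "ereal (- \<epsilon>) \<le> (f y - f x - ereal (blinfun_apply xs (y - x))) / ereal (norm (y - x))"
      proof (cases "f y")
        case (real r)
        then show ?thesis using le y fx by (simp add: field_simps)
      next
        case PInf
        then show ?thesis using y fx by simp
      next
        case MInf
        then show ?thesis using le by simp
      qed
      with \<epsilon>(2) show ?thesis by (rule less_le_trans)
    qed
    then show "\<forall>\<^sub>F y in at x. m < (f y - f x - ereal (blinfun_apply xs (y - x))) / ereal (norm (y - x))"
      using \<delta>(1) by (auto simp: eventually_at)
  qed
  then show ?thesis using fx by (simp add: frechet_subdiff_def)
qed

lemma linear_on_sum:
  fixes \<psi> :: "'a::real_vector \<Rightarrow> real" and v :: "nat \<Rightarrow> 'a"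
  assumes Y: "subspace Y" and add: "\<And>u v. u \<in> Y \<Longrightarrow> v \<in> Y \<Longrightarrow> \<psi> (u + v) = \<psi> u + \<psi> v"
    and scale: "\<And>u r. u \<in> Y \<Longrightarrow> \<psi> (r *\<^sub>R u) = r * \<psi> u" and v: "\<And>i. i < n \<Longrightarrow> v i \<in> Y"
  shows "\<psi> (\<Sum>i<n. c i *\<^sub>R v i) = (\<Sum>i<n. c i * \<psi> (v i))"
  using v
proof (induction n)
  case 0
  then show ?case using scale[OF subspace_0[OF Y], of 0] by simp
next
  case (Suc n)
  have "(\<Sum>i<n. c i *\<^sub>R v i) \<in> Y" using Suc.prems by (intro subspace_sum[OF Y] subspace_scale[OF Y]) auto
  moreover have "c n *\<^sub>R v n \<in> Y" using Suc.prems by (intro subspace_scale[OF Y]) auto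
  ultimately show ?case using Suc.IH Suc.prems add scale[of "v n"] by simp
qed

text \<open>A functional of norm at most K below all points of \<open>E\<close> is a subgradient of
  \<open>f\<close>, and by the sandwich theorem it exists as soon as
  \<open>0 \<le> s + K * norm h\<close> on the convex hull. The finitely many points of a convex
  combination are moved into \<open>T\<close>, where \<psi> supplies the inequality. The functional
  obtained need not extend \<psi>; it inherits the bound K.\<close>

lemma subgradient_from_closure:
  fixes f :: "'a::real_normed_vector \<Rightarrow> ereal"
  assumes T: "approx_closed f T"
    and Y: "subspace (closure T)" and x: "x \<in> closure T" and notminf: "\<And>x. f x \<noteq> -\<infinity>" and fx: "f x = ereal fx"
    and \<psi>_add: "\<And>u v. u \<in> closure T \<Longrightarrow> v \<in> closure T \<Longrightarrow> \<psi> (u + v) = \<psi> u + \<psi> v"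
    and \<psi>_scale: "\<And>u r. u \<in> closure T \<Longrightarrow> \<psi> (r *\<^sub>R u) = r * \<psi> u"
    and \<psi>_le: "\<And>u. u \<in> closure T \<Longrightarrow> \<bar>\<psi> u\<bar> \<le> K * norm u" and K: "0 \<le> K"
    and loc: "\<And>\<epsilon>. 0 < \<epsilon> \<Longrightarrow> \<exists>\<delta>>0. \<forall>v\<in>closure T. norm v < \<delta> \<longrightarrow> ereal (fx + \<psi> v - \<epsilon> * norm v) \<le> f (x + v)"
  obtains xs where "xs \<in> frechet_subdiff f x" "norm xs \<le> K"
proof -
  have "\<forall>m. \<exists>\<delta>>0. \<forall>v\<in>closure T. norm v < \<delta> \<longrightarrow> ereal (fx + \<psi> v - inverse (Suc m) * norm v) \<le> f (x + v)"
    using loc by (simp del: of_nat_Suc)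
  then obtain \<delta> where \<delta>: "\<And>m. 0 < \<delta> m"
    "\<And>m v. v \<in> closure T \<Longrightarrow> norm v < \<delta> m \<Longrightarrow> ereal (fx + \<psi> v - inverse (Suc m) * norm v) \<le> f (x + v)"
    by metis
  \<comment> \<open>All precisions 1/(m+1) enter one set, so that a single functional serves every
    \<epsilon>.\<close>
  define E where "E = {(h, s). \<exists>m r. norm h < \<delta> m \<and> f (x + h) = ereal r \<and> s = r - fx + inverse (Suc m) * norm h}"
  have lb: "0 \<le> s + K * norm h" if hs_mem: "(h, s) \<in> convex hull E" for h s
  proof -
    obtain n :: nat and u e where e: "\<forall>i\<in>{1..n}. 0 \<le> u i \<and> e i \<in> E" "sum u {1..n} = 1"
      "(\<Sum>i\<in>{1..n}. u i *\<^sub>R e i) = (h, s)"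
      using hs_mem[unfolded convex_hull_indexed mem_Collect_eq] by (elim exE conjE) (rule that)
    define w where "w i = u (Suc i)" for i
    define \<eta> where "\<eta> i = fst (e (Suc i))" for i
    define \<tau> where "\<tau> i = snd (e (Suc i))" for i
    have w: "\<And>i. i < n \<Longrightarrow> 0 \<le> w i" "(\<Sum>i<n. w i) = 1"
      using e(1,2) by (auto simp: w_def sum.atLeast1_atMost_eq)
    have hs: "h = (\<Sum>i<n. w i *\<^sub>R \<eta> i)" "s = (\<Sum>i<n. w i * \<tau> i)"
      using arg_cong[OF e(3), of fst] arg_cong[OF e(3), of snd]
      by (simp_all add: w_def \<eta>_def \<tau>_def sum.atLeast1_atMost_eq fst_sum snd_sum)
    have "\<forall>i. \<exists>m r. i < n \<longrightarrow> norm (\<eta> i) < \<delta> m \<and> f (x + \<eta> i) = ereal r \<and> \<tau> i = r - fx + inverse (Suc m) * norm (\<eta> i)"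
    proof
      fix i
      have "i < n \<Longrightarrow> e (Suc i) \<in> E" using e(1) by simp
      then show "\<exists>m r. i < n \<longrightarrow> norm (\<eta> i) < \<delta> m \<and> f (x + \<eta> i) = ereal r \<and> \<tau> i = r - fx + inverse (Suc m) * norm (\<eta> i)"
        by (force simp: E_def \<eta>_def \<tau>_def)
    qed
    then obtain m r where mr: "\<And>i. i < n \<Longrightarrow> norm (\<eta> i) < \<delta> (m i)" "\<And>i. i < n \<Longrightarrow> f (x + \<eta> i) = ereal (r i)"
      "\<And>i. i < n \<Longrightarrow> \<tau> i = r i - fx + inverse (Suc (m i)) * norm (\<eta> i)" by metis
    \<comment> \<open>The bound on \<gamma> keeps each moved point inside the ball \<delta> (m i) of
      its own precision; one \<gamma> is lost in the value of \<open>f\<close>, one in the norm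
      term.\<close>
    have main: "- K * (norm h + \<gamma>) \<le> s + 2 * \<gamma>" if \<gamma>: "0 < \<gamma>" "\<And>i. i < n \<Longrightarrow> \<gamma> \<le> \<delta> (m i) - norm (\<eta> i)" for \<gamma>
    proof -
      obtain z where z: "\<And>i. i < n \<Longrightarrow> z i \<in> T" "\<And>i. i < n \<Longrightarrow> f (z i) \<le> ereal (r i + \<gamma>)"
        "\<And>i. i < n \<Longrightarrow> norm (z i - x) < norm (x + \<eta> i - x) + \<gamma>"
        "norm ((\<Sum>i<n. w i *\<^sub>R z i) - x) < norm ((\<Sum>i<n. w i *\<^sub>R (x + \<eta> i)) - x) + \<gamma>"
        using approximate_family_in_closure[OF T x, of n "\<lambda>i. x + \<eta> i" r \<gamma> w] mr(2) \<gamma>(1) by blast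
      define v where "v i = z i - x" for i
      have vY: "v i \<in> closure T" if "i < n" for i
        using z(1)[OF that] closure_subset[of T] x subspace_diff[OF Y] by (auto simp: v_def)
      have shift: "(\<Sum>i<n. w i *\<^sub>R (y i)) - x = (\<Sum>i<n. w i *\<^sub>R (y i - x))" for y
      proof -
        have "(\<Sum>i<n. w i *\<^sub>R (y i - x)) = (\<Sum>i<n. w i *\<^sub>R (y i)) - (\<Sum>i<n. w i) *\<^sub>R x"
          unfolding scaleR_left.sum by (simp add: scaleR_diff_right sum_subtractf)
        then show ?thesis using w(2) by simp
      qed
      have \<psi>v: "\<psi> (v i) \<le> \<tau> i + 2 * \<gamma>" if i: "i < n" for i
      proof -
        have nv: "norm (v i) < norm (\<eta> i) + \<gamma>" using z(3)[OF i] by (simp add: v_def)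
        then have "norm (v i) < \<delta> (m i)" using \<gamma>(2)[OF i] by linarith
        from \<delta>(2)[OF vY[OF i] this] z(2)[OF i]
        have "ereal (fx + \<psi> (v i) - inverse (Suc (m i)) * norm (v i)) \<le> ereal (r i + \<gamma>)"
          by (simp add: v_def del: of_nat_Suc ereal_less_eq)
        then have le: "\<psi> (v i) \<le> r i - fx + \<gamma> + inverse (Suc (m i)) * norm (v i)" by simp
        have "inverse (real (Suc (m i))) \<le> 1" using le_imp_inverse_le[of 1 "real (Suc (m i))"] by simp
        then have "inverse (real (Suc (m i))) * \<gamma> \<le> 1 * \<gamma>" using \<gamma>(1) by (intro mult_right_mono) auto
        moreover have "inverse (real (Suc (m i))) * norm (v i) \<le> inverse (real (Suc (m i))) * (norm (\<eta> i) + \<gamma>)"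
          using nv by (intro mult_left_mono) auto
        ultimately have "inverse (real (Suc (m i))) * norm (v i) \<le> inverse (real (Suc (m i))) * norm (\<eta> i) + \<gamma>"
          unfolding distrib_left by linarith
        with le mr(3)[OF i] show ?thesis by linarith
      qed
      have sumY: "(\<Sum>i<n. w i *\<^sub>R v i) \<in> closure T"
        using vY by (intro subspace_sum[OF Y] subspace_scale[OF Y]) auto
      have "norm (\<Sum>i<n. w i *\<^sub>R v i) \<le> norm h + \<gamma>"
        using z(4) unfolding shift by (simp add: v_def hs(1))
      then have "- K * (norm h + \<gamma>) \<le> - (K * norm (\<Sum>i<n. w i *\<^sub>R v i))"
        using K by (simp add: mult_left_mono)
      also have "\<dots> \<le> \<psi> (\<Sum>i<n. w i *\<^sub>R v i)" using \<psi>_le[OF sumY] by linarith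
      also have "\<dots> = (\<Sum>i<n. w i * \<psi> (v i))"
        by (rule linear_on_sum[OF Y \<psi>_add \<psi>_scale vY])
      also have "\<dots> \<le> (\<Sum>i<n. w i * (\<tau> i + 2 * \<gamma>))" using w(1) \<psi>v by (intro sum_mono mult_left_mono) auto
      also have "\<dots> = s + 2 * \<gamma>" using w(2) by (simp add: hs(2) distrib_left sum.distrib flip: sum_distrib_right)
      finally show ?thesis .
    qed
    show ?thesis
    proof (rule ccontr)
      assume neg: "\<not> ?thesis"
      \<comment> \<open>\<open>main\<close> gives s + K |h| \<ge> -(K + 2) \<gamma>, which half the
        supposed defect divided by K + 2 contradicts.\<close>
      define \<gamma>0 where "\<gamma>0 = Min (insert (- (s + K * norm h) / (2 * (K + 2))) ((\<lambda>i. \<delta> (m i) - norm (\<eta> i)) ` {..<n}))"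
      have pos: "0 < \<gamma>0" using neg K mr(1) by (auto simp: \<gamma>0_def divide_simps)
      have le: "\<gamma>0 \<le> - (s + K * norm h) / (2 * (K + 2))" "\<And>i. i < n \<Longrightarrow> \<gamma>0 \<le> \<delta> (m i) - norm (\<eta> i)"
        by (auto simp: \<gamma>0_def intro: Min_le)
      have "\<gamma>0 * (2 * (K + 2)) \<le> - (s + K * norm h)" using le(1) K by (simp add: pos_le_divide_eq)
      moreover have "- K * (norm h + \<gamma>0) \<le> s + 2 * \<gamma>0" by (rule main[OF pos le(2)])
      moreover have "0 < \<gamma>0 * (K + 2)" using pos K by simp
      ultimately show False by (simp add: algebra_simps)
    qed
  qed
  obtain xs :: "'a \<Rightarrow>\<^sub>L real" where xs: "norm xs \<le> K" "\<And>h s. (h, s) \<in> convex hull E \<Longrightarrow> blinfun_apply xs h \<le> s"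
    using sandwich_functional[OF convex_convex_hull K lb] by blast
  have "xs \<in> frechet_subdiff f x"
  proof (rule frechet_subdiffI[of f x fx, OF fx])
    fix \<epsilon> :: real assume \<epsilon>: "0 < \<epsilon>"
    obtain m where m: "inverse (real (Suc m)) < \<epsilon>" using reals_Archimedean \<epsilon> by blast
    have "ereal (fx + blinfun_apply xs v - \<epsilon> * norm v) \<le> f (x + v)" if v: "norm v < \<delta> m" for v
    proof (cases "f (x + v)")
      case (real r)
      then have "(v, r - fx + inverse (Suc m) * norm v) \<in> E" using v by (auto simp: E_def)
      then have "blinfun_apply xs v \<le> r - fx + inverse (Suc m) * norm v" by (intro xs hull_inc)
      also have "\<dots> \<le> r - fx + \<epsilon> * norm v" using m by (intro add_left_mono mult_right_mono) auto
      finally show ?thesis using real by simp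
    qed (use notminf in auto)
    then show "\<exists>\<delta>>0. \<forall>v. norm v < \<delta> \<longrightarrow> ereal (fx + blinfun_apply xs v - \<epsilon> * norm v) \<le> f (x + v)"
      using \<delta>(1) by blast
  qed
  with xs(1) that show ?thesis by blast
qed

section \<open>Fuzzy subgradients\<close>

lemma lsc_fun_sequentially:
  assumes lsc: "lsc_fun f" and lim: "zs \<longlonglongrightarrow> z" and le: "\<And>k. f (zs k) \<le> ereal (bs k)" and b: "bs \<longlonglongrightarrow> b"
  shows "f z \<le> ereal b"
proof (rule ccontr)
  assume "\<not> ?thesis"
  then obtain m where m: "ereal b < ereal m" "ereal m < f z" using ereal_dense2[of "ereal b" "f z"] by (auto simp: not_le)
  have "ereal m < Liminf (at z) f" using m(2) lsc unfolding lsc_fun_def by (meson less_le_trans)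
  then have "\<forall>\<^sub>F y in at z. ereal m < f y" using less_LiminfD by blast
  \<comment> \<open>The sequence may pass through z itself, so the punctured neighbourhood is filled
    in.\<close>
  then have "\<forall>\<^sub>F y in nhds z. ereal m < f y" unfolding eventually_at_filter by eventually_elim (use m(2) in auto)
  with lim have "\<forall>\<^sub>F k in sequentially. ereal m < f (zs k)" unfolding filterlim_iff by blast
  moreover have "\<forall>\<^sub>F k in sequentially. bs k < m" using order_tendstoD(2)[OF b] m(1) by simp
  ultimately have "\<forall>\<^sub>F k in sequentially. False"
  proof eventually_elim
    case (elim k)
    then show False using le[of k] by (metis ereal_less_eq(3) less_le_not_le order_trans order_less_le_trans)
  qed
  then show False by simp
qed

text \<open>Frechet smallness survives the infinite sum: finitely many terms are small near 0, and
  the tail is at most 2 |v| times a small tail of \<mu>.\<close>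

lemma series_of_small_terms:
  fixes k :: "nat \<Rightarrow> 'a::real_normed_vector \<Rightarrow> real"
  assumes \<mu>: "\<And>i. 0 < \<mu> i" "summable \<mu>"
    and le: "\<And>i v. v \<in> Y \<Longrightarrow> k i v \<le> 2 * norm v"
    and summ: "\<And>v. v \<in> Y \<Longrightarrow> summable (\<lambda>i. \<mu> i * k i v)"
    and small: "\<And>i \<epsilon>. 0 < \<epsilon> \<Longrightarrow> \<exists>\<delta>>0. \<forall>v\<in>Y. norm v < \<delta> \<longrightarrow> k i v \<le> \<epsilon> * norm v"
    and \<epsilon>: "0 < \<epsilon>"
  shows "\<exists>\<delta>>0. \<forall>v\<in>Y. norm v < \<delta> \<longrightarrow> (\<Sum>i. \<mu> i * k i v) \<le> \<epsilon> * norm v"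
proof -
  define S where "S = suminf \<mu>"
  have S: "0 \<le> S" unfolding S_def by (intro suminf_nonneg \<mu> less_imp_le)
  obtain N where N: "norm (\<Sum>i. \<mu> (i + N)) < \<epsilon> / 4"
    using suminf_exist_split[OF _ \<mu>(2), of "\<epsilon> / 4"] \<epsilon> by auto
  define \<epsilon>' where "\<epsilon>' = \<epsilon> / (2 * (S + 1))"
  have \<epsilon>': "0 < \<epsilon>'" using \<epsilon> S by (simp add: \<epsilon>'_def)
  obtain \<delta> where \<delta>: "\<And>i. 0 < \<delta> i" "\<And>i v. v \<in> Y \<Longrightarrow> norm v < \<delta> i \<Longrightarrow> k i v \<le> \<epsilon>' * norm v"
    using small[OF \<epsilon>'] by metis
  define \<delta>' where "\<delta>' = Min (insert 1 (\<delta> ` {..<N}))"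
  have \<delta>': "0 < \<delta>'" "\<And>i. i < N \<Longrightarrow> \<delta>' \<le> \<delta> i" using \<delta>(1) by (auto simp: \<delta>'_def)
  have "(\<Sum>i. \<mu> i * k i v) \<le> \<epsilon> * norm v" if v: "v \<in> Y" "norm v < \<delta>'" for v
  proof -
    have sumN: "sum \<mu> {..<N} \<le> S" unfolding S_def by (rule sum_le_suminf[OF \<mu>(2)]) (use \<mu>(1) in \<open>auto intro: less_imp_le\<close>)
    have "(\<Sum>i<N. \<mu> i * k i v) \<le> (\<Sum>i<N. \<mu> i * (\<epsilon>' * norm v))"
      using \<mu>(1) \<delta>' v by (intro sum_mono mult_left_mono \<delta>(2)) (auto intro: less_imp_le less_le_trans)
    also have "\<dots> = sum \<mu> {..<N} * (\<epsilon>' * norm v)" by (simp add: sum_distrib_right)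
    also have "\<dots> \<le> (S + 1) * (\<epsilon>' * norm v)" using sumN \<epsilon>' by (intro mult_right_mono) auto
    also have "\<dots> = \<epsilon> / 2 * norm v"
    proof -
      have "(S + 1) * \<epsilon>' = \<epsilon> / 2" using S by (simp add: \<epsilon>'_def divide_simps)
      then show ?thesis by (simp only: mult.assoc[symmetric])
    qed
    finally have head: "(\<Sum>i<N. \<mu> i * k i v) \<le> \<epsilon> / 2 * norm v" .
    have s1: "summable (\<lambda>i. \<mu> (i + N) * (2 * norm v))"
      by (intro summable_mult2 summable_ignore_initial_segment \<mu>(2))
    have "(\<Sum>i. \<mu> (i + N) * k (i + N) v) \<le> (\<Sum>i. \<mu> (i + N) * (2 * norm v))"
      using \<mu>(1) le[OF v(1)] summable_ignore_initial_segment[OF summ[OF v(1)], of N] s1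
      by (intro suminf_le mult_left_mono) (auto intro: less_imp_le)
    also have "\<dots> = (\<Sum>i. \<mu> (i + N)) * (2 * norm v)"
      using suminf_mult2[OF summable_ignore_initial_segment[OF \<mu>(2), of N]] by simp
    also have "\<dots> \<le> \<epsilon> / 4 * (2 * norm v)" using N by (intro mult_right_mono) auto
    finally have "(\<Sum>i. \<mu> (i + N) * k (i + N) v) \<le> \<epsilon> / 2 * norm v" by simp
    with head show ?thesis using suminf_split_initial_segment[OF summ[OF v(1)], of N] by simp
  qed
  with \<delta>'(1) show ?thesis by blast
qed

text \<open>On \<open>Y\<close> the function c |y - x0| is replaced by the smooth
  \<open>\<phi>0\<close>, and the variational principle with \<open>G 1\<close> as gauge adds a
  smooth series. At the minimizer the negative of the total derivative is a subgradient of the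
  restriction, of norm at most c' + \<eta>/2 = c + \<eta>, and
  \<open>subgradient_from_closure\<close> transfers it to the whole space.\<close>

lemma fuzzy_subgradient_asplund:
  fixes f :: "'a::banach \<Rightarrow> ereal"
  assumes asp: "asplund TYPE('a)" and lsc: "lsc_fun f" and notminf: "\<And>x. f x \<noteq> -\<infinity>"
    and fx0: "f x0 = ereal f0" and c: "0 \<le> c" and r: "0 < r"
    and loc: "\<And>y. dist y x0 < r \<Longrightarrow> ereal (f0 - c * dist y x0) \<le> f y" and \<eta>: "0 < \<eta>"
  obtains y fy xs where "f y = ereal fy" "dist y x0 < \<eta>" "fy \<le> f0" "xs \<in> frechet_subdiff f y" "norm xs \<le> c + \<eta>"
proof -
  obtain T where T: "countable T" "x0 \<in> T" "subspace (closure T)" "approx_closed f T"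
    by (rule separable_reduction_set)
  define Y where "Y = closure T"
  have Y: "subspace Y" "x0 \<in> Y" "closed Y" "T \<subseteq> Y" using T closure_subset by (auto simp: Y_def)
  obtain D where D: "countable D" "D \<subseteq> dual_ball Y"
    "\<And>a \<epsilon>. a \<in> dual_ball Y \<Longrightarrow> 0 < \<epsilon> \<Longrightarrow> \<exists>d\<in>D. \<forall>u\<in>Y. \<bar>a u - d u\<bar> \<le> \<epsilon> * norm u"
    using dual_ball_separable[OF asp Y(1) T(1) Y(4)] by (auto simp: Y_def)
  have "(\<lambda>_. 0) \<in> dual_ball Y" by (auto simp: dual_ball_def)
  with D(3)[of _ 1] have "D \<noteq> {}" by force
  \<comment> \<open>Radial projection yields a countable dense subset of the unit ball of
    \<open>Y\<close>; it moves t no further than the distance of t to any point of the ball.\<close>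
  define S where "S = (\<lambda>t. inverse (max 1 (norm t)) *\<^sub>R t) ` T"
  have S: "countable S" "S \<noteq> {}" using T by (auto simp: S_def)
  have S_ball: "s \<in> Y \<and> norm s \<le> 1" if "s \<in> S" for s
    using that Y(4) subspace_scale[OF Y(1)] by (auto simp: S_def divide_simps max_def)
  have S_dense: "\<exists>s\<in>S. norm (u - s) < \<epsilon>" if u: "u \<in> Y" "norm u \<le> 1" "0 < \<epsilon>" for u \<epsilon>
  proof -
    obtain t where t: "t \<in> T" "norm (t - u) < \<epsilon> / 2"
      using u closure_approachable[of u T] by (auto simp: Y_def dist_norm dest!: spec[of _ "\<epsilon> / 2"])
    define s where "s = inverse (max 1 (norm t)) *\<^sub>R t"
    have "norm (t - s) \<le> norm (t - u)"
    proof (cases "norm t \<le> 1")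
      case True
      then show ?thesis by (simp add: s_def max_def)
    next
      case False
      then have "t - s = (1 - inverse (norm t)) *\<^sub>R t" by (simp add: s_def max_def scaleR_diff_left)
      moreover have "inverse (norm t) \<le> 1" using False le_imp_inverse_le[of 1 "norm t"] by simp
      ultimately have "norm (t - s) = (1 - inverse (norm t)) * norm t" by simp
      also have "\<dots> = norm t - 1"
      proof -
        have "norm t \<noteq> 0" using False by linarith
        then show ?thesis unfolding left_diff_distrib by simp
      qed
      finally have "norm (t - s) = norm t - 1" .
      then show ?thesis using norm_triangle_ineq2[of t u] u(2) by simp
    qed
    then have "norm (u - s) < \<epsilon>" using t(2) norm_triangle_ineq4[of "t - s" "t - u"] by simp
    with t(1) show ?thesis by (auto simp: S_def s_def)
  qed
  interpret sd: separable_dual Y "from_nat_into S" "from_nat_into D"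
  proof
    show "subspace Y" by (rule Y(1))
    show "from_nat_into S n \<in> Y" "norm (from_nat_into S n) \<le> 1" for n
      using S_ball from_nat_into[OF S(2)] by auto
    show "\<exists>n. norm (u - from_nat_into S n) < \<epsilon>" if "u \<in> Y" "norm u \<le> 1" "0 < \<epsilon>" for u \<epsilon>
      using S_dense[OF that] from_nat_into_surj[OF S(1)] by metis
    show "from_nat_into D n \<in> dual_ball Y" for n using from_nat_into[OF \<open>D \<noteq> {}\<close>] D(2) by auto
    show "\<exists>n. \<forall>u\<in>Y. \<bar>a u - from_nat_into D n u\<bar> \<le> \<epsilon> * norm u" if "a \<in> dual_ball Y" "0 < \<epsilon>" for a \<epsilon>
      using D(3)[OF that] from_nat_into_surj[OF D(1)] by metis
  qed
  \<comment> \<open>\<eta> is split evenly: one half raises the slope of \<open>\<phi>0\<close>, the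
    other is the total weight of the series of perturbations.\<close>
  define c' where "c' = c + \<eta> / 2"
  have c': "0 < c'" using c \<eta> by (simp add: c'_def)
  define \<rho> where "\<rho> = min \<eta> (r / 2) / 2"
  have \<rho>: "0 < \<rho>" "\<rho> < \<eta>" "\<rho> < r / 2" using \<eta> r by (auto simp: \<rho>_def)
  \<comment> \<open>The smoothing error 10 c' \<theta> becomes \<eta>\<rho>/2; the extra slope
    \<eta>/2 beats it outside the \<rho>-ball, which confines the minimizer to that ball.\<close>
  define \<theta> where "\<theta> = \<eta> * \<rho> / (20 * c')"
  have \<theta>: "0 < \<theta>" using \<eta> \<rho> c' by (simp add: \<theta>_def)
  have c'\<theta>: "10 * c' * \<theta> = \<eta> / 2 * \<rho>" using c' by (simp add: \<theta>_def)
  \<comment> \<open>The closed ball of radius r/2 keeps \<open>M\<close> inside the region of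
    \<open>loc\<close>, and \<rho> < r/2 puts the minimizer in its interior.\<close>
  define M where "M = {y\<in>Y. dist y x0 \<le> r / 2 \<and> f y < \<infinity>}"
  define F where "F y = real_of_ereal (f y)" for y
  have F: "f y = ereal (F y)" if "y \<in> M" for y
    using that notminf[of y] by (cases "f y") (auto simp: M_def F_def)
  have x0M: "x0 \<in> M" using Y(2) fx0 r by (auto simp: M_def)
  have Fx0: "F x0 = f0" by (simp add: F_def fx0)
  define \<phi>0 where "\<phi>0 y = c' * sd.G \<theta> (y - x0)" for y
  have \<phi>x0: "\<phi>0 x0 = 0" using sd.G_zero[of \<theta>] \<theta> by (simp add: \<phi>0_def)
  have diffY: "z - y \<in> Y" if "z \<in> Y" "y \<in> Y" for z y using subspace_diff[OF Y(1)] that by auto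
  have low: "f0 + \<eta> / 2 * norm (z - x0) - \<eta> / 2 * \<rho> \<le> F z + \<phi>0 z" if z: "z \<in> M" for z
  proof -
    have "ereal (f0 - c * dist z x0) \<le> ereal (F z)" using loc[of z] F[OF z] z r by (auto simp: M_def)
    then have "f0 - c * norm (z - x0) \<le> F z" by (simp add: dist_norm)
    moreover have "c' * (norm (z - x0) - 10 * \<theta>) \<le> \<phi>0 z"
      unfolding \<phi>0_def using sd.G_lower[of \<theta> "z - x0" 1] \<theta> c' z diffY[OF _ Y(2)]
      by (intro mult_left_mono) (auto simp: M_def)
    then have "c * norm (z - x0) + \<eta> / 2 * norm (z - x0) - \<eta> / 2 * \<rho> \<le> \<phi>0 z"
    proof -
      have "c' * (norm (z - x0) - 10 * \<theta>) = c * norm (z - x0) + \<eta> / 2 * norm (z - x0) - 10 * c' * \<theta>"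
        by (simp add: c'_def algebra_simps)
      with \<open>c' * (norm (z - x0) - 10 * \<theta>) \<le> \<phi>0 z\<close> c'\<theta> show ?thesis by linarith
    qed
    ultimately show ?thesis by linarith
  qed
  define \<mu> where "\<mu> i = \<eta> / 2 * (1/2) ^ Suc i" for i :: nat
  have \<mu>: "\<And>i. 0 < \<mu> i" "summable \<mu>" "suminf \<mu> = \<eta> / 2"
  proof -
    show "0 < \<mu> i" for i using \<eta> by (simp add: \<mu>_def)
    have "\<mu> sums (\<eta> / 2 * 1)" unfolding \<mu>_def by (intro sums_mult power_half_series)
    then show "summable \<mu>" "suminf \<mu> = \<eta> / 2" by (auto simp: sums_iff)
  qed
  have gauge: "\<exists>\<delta>>0. \<forall>z\<in>Y. \<forall>y\<in>Y. sd.G 1 (z - y) \<le> \<delta> \<longrightarrow> norm (z - y) \<le> \<epsilon>" if \<epsilon>: "0 < \<epsilon>" for \<epsilon>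
  proof -
    \<comment> \<open>With s \<le> \<epsilon>/20 the loss 10 s^2 in \<open>G_lower\<close> is at
      most half of the gain s \<epsilon>.\<close>
    define s where "s = min 1 (\<epsilon> / 20)"
    have s: "0 < s" "s \<le> 1" "s \<le> \<epsilon> / 20" using \<epsilon> by (auto simp: s_def)
    have "norm u \<le> \<epsilon>" if "u \<in> Y" "sd.G 1 u \<le> s * \<epsilon> / 4" for u
    proof (rule ccontr)
      assume "\<not> ?thesis"
      then have "s * \<epsilon> \<le> s * norm u" using s by (intro mult_left_mono) auto
      moreover have "10 * s\<^sup>2 \<le> s * \<epsilon> / 2"
        using mult_left_mono[OF s(3), of "10 * s"] s(1) by (simp add: power2_eq_square)
      moreover have "0 < s * \<epsilon>" using s(1) \<epsilon> by simp
      moreover have "s * norm u - 10 * 1 * s\<^sup>2 \<le> sd.G 1 u" using that(1) s by (intro sd.G_lower) auto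
      ultimately show False using that(2) by linarith
    qed
    then show ?thesis using s(1) \<epsilon> diffY by (intro exI[of _ "s * \<epsilon> / 4"]) auto
  qed
  have glip: "sd.G \<theta>' u \<le> sd.G \<theta>' v + norm (u - v)" if "0 < \<theta>'" "u \<in> Y" "v \<in> Y" for \<theta>' u v
    using sd.G_lipschitz[of \<theta>' u v] that by simp
  have "continuous_on Y \<phi>0"
  proof -
    have "1-lipschitz_on Y (\<lambda>y. sd.G \<theta> (y - x0))"
    proof (rule lipschitz_onI)
      fix y z assume "y \<in> Y" "z \<in> Y"
      then show "dist (sd.G \<theta> (y - x0)) (sd.G \<theta> (z - x0)) \<le> 1 * dist y z"
        using glip[OF \<theta>, of "y - x0" "z - x0"] glip[OF \<theta>, of "z - x0" "y - x0"] diffY Y(2)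
        by (simp add: dist_real_def dist_norm abs_le_iff norm_minus_commute)
    qed simp
    then show ?thesis unfolding \<phi>0_def by (intro continuous_intros lipschitz_on_continuous_on)
  qed
  moreover have "M \<subseteq> Y" by (auto simp: M_def)
  moreover have "F x0 + \<phi>0 x0 - \<eta> / 2 * \<rho> \<le> F z + \<phi>0 z" if "z \<in> M" for z
  proof -
    have "0 \<le> \<eta> / 2 * norm (z - x0)" using \<eta> by simp
    then show ?thesis using low[OF that] Fx0 \<phi>x0 by linarith
  qed
  moreover have "sd.G 1 (z - y) \<le> sd.G 1 (w - y) + norm (z - w)" if "z \<in> Y" "w \<in> Y" "y \<in> Y" for z w y
    using glip[of 1 "z - y" "w - y"] that diffY by simp
  moreover have "0 \<le> sd.G 1 (z - y)" if "z \<in> Y" "y \<in> Y" for z y using sd.G_nonneg[of 1] that diffY by simp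
  moreover have "sd.G 1 0 = 0" using sd.G_zero[of 1] by simp
  moreover have "seq_lsc_on M F"
  proof (rule seq_lsc_onI)
    fix zs z bs b assume zs: "\<And>k. zs k \<in> M" "zs \<longlonglongrightarrow> z" "\<And>k. F (zs k) \<le> bs k" "bs \<longlonglongrightarrow> (b::real)"
    have fz: "f z \<le> ereal b"
      by (rule lsc_fun_sequentially[OF lsc zs(2) _ zs(4)]) (use zs F in auto)
    have "z \<in> Y" using closed_sequentially[OF Y(3), of zs z] zs by (auto simp: M_def)
    moreover have "dist z x0 \<le> r / 2"
      by (rule LIMSEQ_le_const2[OF tendsto_dist[OF zs(2) tendsto_const]]) (use zs(1) in \<open>auto simp: M_def\<close>)
    ultimately have zM: "z \<in> M" using fz by (auto simp: M_def)
    with fz show "z \<in> M \<and> F z \<le> b" using F[OF zM] by simp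
  qed
  ultimately obtain y ybar where y: "\<And>i. y i \<in> M" "y \<longlonglongrightarrow> ybar" "ybar \<in> M" "F ybar + \<phi>0 ybar \<le> F x0 + \<phi>0 x0"
    and min: "\<And>z. z \<in> M \<Longrightarrow> F ybar + \<phi>0 ybar + (\<Sum>i. \<mu> i * sd.G 1 (ybar - y i)) \<le> F z + \<phi>0 z + (\<Sum>i. \<mu> i * sd.G 1 (z - y i))"
    using variational_principle[OF x0M _ Y(3), of F \<phi>0 "\<eta> / 2 * \<rho>" "sd.G 1" \<mu>] gauge \<mu>(1,2) by blast
  define fy where "fy = F ybar"
  have fyb: "f ybar = ereal fy" using F[OF y(3)] by (simp add: fy_def)
  have yY: "y i \<in> Y" "ybar \<in> Y" for i using y by (auto simp: M_def)
  have \<phi>_nonneg: "0 \<le> \<phi>0 ybar" using sd.G_nonneg[of \<theta>] \<theta> c' diffY[OF yY(2) Y(2)] by (simp add: \<phi>0_def)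
  have "\<eta> / 2 * norm (ybar - x0) \<le> \<eta> / 2 * \<rho>" using low[OF y(3)] y(4) \<phi>x0 Fx0 by simp
  then have near: "norm (ybar - x0) \<le> \<rho>" using \<eta> by simp
  obtain a0 where a0: "a0 \<in> dual_ball Y" "\<And>\<epsilon>. 0 < \<epsilon> \<Longrightarrow> \<exists>\<delta>>0. \<forall>v\<in>Y. norm v < \<delta> \<longrightarrow>
      sd.G \<theta> (ybar - x0 + v) \<le> sd.G \<theta> (ybar - x0) + a0 v + \<epsilon> * norm v"
    using sd.G_smooth[OF \<theta> diffY[OF yY(2) Y(2)]] by blast
  have "\<forall>i. \<exists>a. a \<in> dual_ball Y \<and> (\<forall>\<epsilon>>0. \<exists>\<delta>>0. \<forall>v\<in>Y. norm v < \<delta> \<longrightarrow>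
      sd.G 1 (ybar - y i + v) \<le> sd.G 1 (ybar - y i) + a v + \<epsilon> * norm v)"
  proof
    fix i
    obtain a where "a \<in> dual_ball Y" "\<And>\<epsilon>. 0 < \<epsilon> \<Longrightarrow> \<exists>\<delta>>0. \<forall>v\<in>Y. norm v < \<delta> \<longrightarrow>
        sd.G 1 (ybar - y i + v) \<le> sd.G 1 (ybar - y i) + a v + \<epsilon> * norm v"
      using sd.G_smooth[OF zero_less_one diffY[OF yY(2) yY(1)[of i]]] by blast
    then show "\<exists>a. a \<in> dual_ball Y \<and> (\<forall>\<epsilon>>0. \<exists>\<delta>>0. \<forall>v\<in>Y. norm v < \<delta> \<longrightarrow>
        sd.G 1 (ybar - y i + v) \<le> sd.G 1 (ybar - y i) + a v + \<epsilon> * norm v)" by blast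
  qed
  then obtain a where a: "\<And>i. a i \<in> dual_ball Y" "\<And>i \<epsilon>. 0 < \<epsilon> \<Longrightarrow> \<exists>\<delta>>0. \<forall>v\<in>Y. norm v < \<delta> \<longrightarrow>
      sd.G 1 (ybar - y i + v) \<le> sd.G 1 (ybar - y i) + a i v + \<epsilon> * norm v" by metis
  have summa: "summable (\<lambda>i. \<mu> i * a i v)" if "v \<in> Y" for v
  proof (rule summable_comparison_test'[OF summable_mult2[OF \<mu>(2), of "norm v"]])
    show "norm (\<mu> i * a i v) \<le> \<mu> i * norm v" if "0 \<le> i" for i
      using \<mu>(1)[of i] dual_ball_le[OF a(1) \<open>v \<in> Y\<close>, of i] by (simp add: abs_mult)
  qed
  obtain Ky where Ky: "\<And>i. norm (y i) \<le> Ky"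
    using convergent_imp_Bseq[of y] y(2) by (metis Bseq_def convergentI)
  have summG: "summable (\<lambda>i. \<mu> i * sd.G 1 (z - y i))" if z: "z \<in> Y" for z
  proof -
    have "norm (\<mu> i * sd.G 1 (z - y i)) \<le> \<mu> i * (norm z + Ky)" for i
    proof -
      have "sd.G 1 (z - y i) \<le> norm z + Ky"
        using glip[of 1 "z - y i" 0] sd.G_zero[of 1] diffY[OF z yY(1)] subspace_0[OF Y(1)]
          norm_triangle_ineq4[of z "y i"] Ky[of i] by simp
      then show ?thesis using \<mu>(1)[of i] sd.G_nonneg[of 1 "z - y i"] diffY[OF z yY(1)] by (simp add: abs_mult)
    qed
    then show ?thesis
      by (intro summable_comparison_test'[OF summable_mult2[OF \<mu>(2), of "norm z + Ky"]]) auto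
  qed
  \<comment> \<open>\<psi> is minus the derivative of the whole perturbation, and
    \<open>k i v\<close> is the error of the linear estimate for the i-th term of the
    series.\<close>
  define \<psi> where "\<psi> v = - (c' * a0 v + (\<Sum>i. \<mu> i * a i v))" for v
  define k where "k i v = sd.G 1 (ybar - y i + v) - sd.G 1 (ybar - y i) - a i v" for i v
  have k_sums: "summable (\<lambda>i. \<mu> i * k i v)"
    "(\<Sum>i. \<mu> i * k i v) = (\<Sum>i. \<mu> i * sd.G 1 (ybar + v - y i)) - (\<Sum>i. \<mu> i * sd.G 1 (ybar - y i)) - (\<Sum>i. \<mu> i * a i v)"
    if v: "v \<in> Y" for v
  proof -
    have eq: "\<mu> i * k i v = \<mu> i * sd.G 1 (ybar + v - y i) - \<mu> i * sd.G 1 (ybar - y i) - \<mu> i * a i v" for i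
      by (simp add: k_def algebra_simps)
    have s: "summable (\<lambda>i. \<mu> i * sd.G 1 (ybar + v - y i))" "summable (\<lambda>i. \<mu> i * sd.G 1 (ybar - y i))"
      using summG subspace_add[OF Y(1) yY(2) v] yY(2) by auto
    show "summable (\<lambda>i. \<mu> i * k i v)" unfolding eq by (intro summable_diff s summa v)
    show "(\<Sum>i. \<mu> i * k i v) = (\<Sum>i. \<mu> i * sd.G 1 (ybar + v - y i)) - (\<Sum>i. \<mu> i * sd.G 1 (ybar - y i)) - (\<Sum>i. \<mu> i * a i v)"
      unfolding eq by (simp add: suminf_diff[symmetric] s summa[OF v] summable_diff)
  qed
  have k_le: "k i v \<le> 2 * norm v" if v: "v \<in> Y" for i v
    using glip[of 1 "ybar - y i + v" "ybar - y i"] diffY[OF yY(2) yY(1)] subspace_add[OF Y(1) _ v]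
      dual_ball_le[OF a(1) v, of i] by (force simp: k_def)
  have k_small: "\<exists>\<delta>>0. \<forall>v\<in>Y. norm v < \<delta> \<longrightarrow> k i v \<le> \<epsilon> * norm v" if "0 < \<epsilon>" for i \<epsilon>
    using a(2)[OF that, of i] by (auto simp: k_def algebra_simps)
  have "\<exists>\<delta>>0. \<forall>v\<in>closure T. norm v < \<delta> \<longrightarrow> ereal (fy + \<psi> v - \<epsilon> * norm v) \<le> f (ybar + v)" if \<epsilon>: "0 < \<epsilon>" for \<epsilon>
  proof -
    obtain \<delta>1 where \<delta>1: "0 < \<delta>1" "\<And>v. v \<in> Y \<Longrightarrow> norm v < \<delta>1 \<Longrightarrow>
        sd.G \<theta> (ybar - x0 + v) \<le> sd.G \<theta> (ybar - x0) + a0 v + \<epsilon> / (2 * c') * norm v"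
      using a0(2)[of "\<epsilon> / (2 * c')"] \<epsilon> c' by auto
    obtain \<delta>2 where \<delta>2: "0 < \<delta>2" "\<And>v. v \<in> Y \<Longrightarrow> norm v < \<delta>2 \<Longrightarrow> (\<Sum>i. \<mu> i * k i v) \<le> \<epsilon> / 2 * norm v"
      using series_of_small_terms[OF \<mu>(1,2) k_le k_sums(1) k_small, of "\<epsilon> / 2"] \<epsilon> by auto
    have "ereal (fy + \<psi> v - \<epsilon> * norm v) \<le> f (ybar + v)"
      if v: "v \<in> Y" "norm v < min (r / 2 - \<rho>) (min \<delta>1 \<delta>2)" for v
    proof (cases "f (ybar + v) = \<infinity>")
      case False
      have "dist (ybar + v) x0 \<le> r / 2"
        using near v(2) norm_triangle_ineq[of "ybar - x0" v] by (simp add: dist_norm algebra_simps)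
      then have zM: "ybar + v \<in> M" using False subspace_add[OF Y(1) yY(2) v(1)] by (auto simp: M_def less_top[symmetric] top_ereal_def)
      have "\<phi>0 (ybar + v) \<le> c' * (sd.G \<theta> (ybar - x0) + a0 v + \<epsilon> / (2 * c') * norm v)"
        unfolding \<phi>0_def using \<delta>1(2)[OF v(1)] v(2) c' by (intro mult_left_mono) (auto simp: algebra_simps)
      also have "\<dots> = \<phi>0 ybar + c' * a0 v + \<epsilon> / 2 * norm v" using c' by (simp add: \<phi>0_def distrib_left)
      finally have "\<phi>0 (ybar + v) \<le> \<phi>0 ybar + c' * a0 v + \<epsilon> / 2 * norm v" .
      moreover have "(\<Sum>i. \<mu> i * k i v) \<le> \<epsilon> / 2 * norm v" using \<delta>2(2)[OF v(1)] v(2) by simp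
      ultimately have "fy + \<psi> v - \<epsilon> * norm v \<le> F (ybar + v)"
        using min[OF zM] k_sums(2)[OF v(1)] unfolding \<psi>_def fy_def by argo
      then show ?thesis using F[OF zM] by simp
    qed simp
    moreover have "0 < min (r / 2 - \<rho>) (min \<delta>1 \<delta>2)" using \<delta>1(1) \<delta>2(1) \<rho>(3) by simp
    ultimately show ?thesis unfolding Y_def by blast
  qed
  note loc' = this
  have \<psi>_add: "\<psi> (u + v) = \<psi> u + \<psi> v" if "u \<in> closure T" "v \<in> closure T" for u v
  proof -
    have uv: "u \<in> Y" "v \<in> Y" using that by (auto simp: Y_def)
    have "(\<Sum>i. \<mu> i * a i (u + v)) = (\<Sum>i. \<mu> i * a i u) + (\<Sum>i. \<mu> i * a i v)"
      using suminf_add[OF summa[OF uv(1)] summa[OF uv(2)]] dual_ball_add[OF a(1) uv] by (simp add: distrib_left)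
    then show ?thesis using dual_ball_add[OF a0(1) uv] by (simp add: \<psi>_def distrib_left)
  qed
  have \<psi>_scale: "\<psi> (t *\<^sub>R u) = t * \<psi> u" if "u \<in> closure T" for t u
  proof -
    have u: "u \<in> Y" using that by (auto simp: Y_def)
    have "(\<Sum>i. \<mu> i * a i (t *\<^sub>R u)) = t * (\<Sum>i. \<mu> i * a i u)"
      using suminf_mult[OF summa[OF u], of t] dual_ball_scale[OF a(1) u] by (simp add: mult.left_commute)
    then show ?thesis using dual_ball_scale[OF a0(1) u, of t] by (simp add: \<psi>_def algebra_simps)
  qed
  have \<psi>_le: "\<bar>\<psi> u\<bar> \<le> (c + \<eta>) * norm u" if "u \<in> closure T" for u
  proof -
    have u: "u \<in> Y" using that by (auto simp: Y_def)
    have t: "\<bar>\<mu> i * a i u\<bar> \<le> \<mu> i * norm u" for i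
      using \<mu>(1)[of i] dual_ball_le[OF a(1) u] by (simp add: abs_mult)
    have "\<bar>\<Sum>i. \<mu> i * a i u\<bar> \<le> (\<Sum>i. \<mu> i * norm u)"
    proof -
      have s: "summable (\<lambda>i. \<bar>\<mu> i * a i u\<bar>)"
        using t by (intro summable_comparison_test'[OF summable_mult2[OF \<mu>(2), of "norm u"]]) auto
      have "\<bar>\<Sum>i. \<mu> i * a i u\<bar> \<le> (\<Sum>i. \<bar>\<mu> i * a i u\<bar>)" by (rule summable_rabs[OF s])
      also have "\<dots> \<le> (\<Sum>i. \<mu> i * norm u)" by (intro suminf_le t s summable_mult2 \<mu>(2))
      finally show ?thesis .
    qed
    also have "\<dots> = \<eta> / 2 * norm u" using suminf_mult2[OF \<mu>(2), of "norm u"] \<mu>(3) by simp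
    finally have "\<bar>\<Sum>i. \<mu> i * a i u\<bar> \<le> \<eta> / 2 * norm u" .
    moreover have "\<bar>c' * a0 u\<bar> \<le> c' * norm u" using c' dual_ball_le[OF a0(1) u] by (simp add: abs_mult)
    moreover have "c' * norm u + \<eta> / 2 * norm u = (c + \<eta>) * norm u" by (simp add: c'_def algebra_simps)
    ultimately show ?thesis unfolding \<psi>_def by linarith
  qed
  obtain xs where xs: "xs \<in> frechet_subdiff f ybar" "norm xs \<le> c + \<eta>"
    using subgradient_from_closure[OF T(4,3) yY(2)[unfolded Y_def] notminf fyb \<psi>_add \<psi>_scale \<psi>_le _ loc'] c \<eta> by auto
  show ?thesis
  proof (rule that[OF fyb _ _ xs])
    show "dist ybar x0 < \<eta>" using near \<rho>(2) by (simp add: dist_norm)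
    show "fy \<le> f0" using y(4) \<phi>_nonneg \<phi>x0 Fx0 by (simp add: fy_def)
  qed
qed

text \<open>By convexity the local bound extends to the whole shifted epigraph: (h, s) is contracted
  towards (0, 0) until it enters the ball, and the inequality scales back. The sandwich theorem then
  acts directly on the epigraph.\<close>

lemma subgradient_convex:
  fixes f :: "'a::real_normed_vector \<Rightarrow> ereal"
  assumes conv: "convex_ext f" and notminf: "\<And>x. f x \<noteq> -\<infinity>"
    and fx0: "f x0 = ereal f0" and c: "0 \<le> c" and r: "0 < r"
    and loc: "\<And>y. dist y x0 < r \<Longrightarrow> ereal (f0 - c * dist y x0) \<le> f y"
  obtains xs where "xs \<in> frechet_subdiff f x0" "norm xs \<le> c"
proof -
  define C where "C = {(h, s). f (x0 + h) \<le> ereal (f0 + s)}"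
  have "convex C"
    unfolding convex_alt
  proof (intro ballI allI impI)
    fix p p' and u :: real assume p: "p \<in> C" "p' \<in> C" and u: "0 \<le> u \<and> u \<le> 1"
    obtain h s h' s' where [simp]: "p = (h, s)" "p' = (h', s')" by (cases p, cases p')
    have "x0 + ((1 - u) *\<^sub>R h + u *\<^sub>R h') = (1 - u) *\<^sub>R (x0 + h) + u *\<^sub>R (x0 + h')" by (simp add: algebra_simps)
    then have "f (x0 + ((1 - u) *\<^sub>R h + u *\<^sub>R h')) \<le> ereal (1 - u) * f (x0 + h) + ereal u * f (x0 + h')"
      using conv u unfolding convex_ext_def by simp
    also have "\<dots> \<le> ereal (1 - u) * ereal (f0 + s) + ereal u * ereal (f0 + s')"
      using p u by (intro add_mono ereal_mult_left_mono) (auto simp: C_def)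
    also have "\<dots> = ereal (f0 + ((1 - u) * s + u * s'))" by (simp add: algebra_simps)
    finally show "(1 - u) *\<^sub>R p + u *\<^sub>R p' \<in> C" by (simp add: C_def)
  qed
  moreover have "0 \<le> s + c * norm h" if hs: "(h, s) \<in> C" for h s
  proof -
    define t where "t = min 1 (r / 2 / (norm h + 1))"
    have pos: "0 < norm h + 1" by (simp add: add_nonneg_pos)
    have t: "0 < t" "t \<le> 1" using r pos by (auto simp: t_def)
    have "t * norm h \<le> r / 2 / (norm h + 1) * (norm h + 1)"
      using r pos by (intro mult_mono) (auto simp: t_def)
    also have "\<dots> = r / 2"
    proof -
      have "a / b * b = a" if "0 < b" for a b :: real using that by simp
      from this[OF pos] show ?thesis .
    qed
    also have "\<dots> < r" using r by simp
    finally have tr: "t * norm h < r" .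
    have "(0, 0) \<in> C" using fx0 by (simp add: C_def)
    then have "(1 - t) *\<^sub>R (0, 0) + t *\<^sub>R (h, s) \<in> C"
      using \<open>convex C\<close> hs t unfolding convex_alt by (meson less_imp_le)
    then have "f (x0 + t *\<^sub>R h) \<le> ereal (f0 + t * s)" by (simp add: C_def)
    moreover have "ereal (f0 - c * (t * norm h)) \<le> f (x0 + t *\<^sub>R h)"
      using loc[of "x0 + t *\<^sub>R h"] tr t by (simp add: dist_norm)
    ultimately have "ereal (f0 - c * (t * norm h)) \<le> ereal (f0 + t * s)" by (rule order_trans[rotated])
    then have "0 \<le> t * (s + c * norm h)" by (simp add: algebra_simps)
    then show ?thesis using t(1) by (simp add: zero_le_mult_iff)
  qed
  ultimately obtain xs :: "'a \<Rightarrow>\<^sub>L real" where xs: "norm xs \<le> c" "\<And>h s. (h, s) \<in> C \<Longrightarrow> blinfun_apply xs h \<le> s"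
    using sandwich_functional[of C c] c by blast
  have "xs \<in> frechet_subdiff f x0"
  proof (rule frechet_subdiffI[of f x0 f0, OF fx0])
    fix \<epsilon> :: real assume "0 < \<epsilon>"
    have "ereal (f0 + blinfun_apply xs v - \<epsilon> * norm v) \<le> f (x0 + v)" for v
    proof (cases "f (x0 + v)")
      case (real r)
      then have "blinfun_apply xs v \<le> r - f0" by (intro xs) (simp add: C_def)
      moreover have "0 \<le> \<epsilon> * norm v" using \<open>0 < \<epsilon>\<close> by simp
      ultimately show ?thesis using real by simp
    qed (use notminf in auto)
    then show "\<exists>\<delta>>0. \<forall>v. norm v < \<delta> \<longrightarrow> ereal (f0 + blinfun_apply xs v - \<epsilon> * norm v) \<le> f (x0 + v)"
      by (auto intro: exI[of _ 1])
  qed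
  with xs(1) that show ?thesis by blast
qed

text \<open>In the convex case y = x0 works; the common form lets the error bound treat both cases
  at once.\<close>

lemma fuzzy_subgradient:
  fixes f :: "'a::banach \<Rightarrow> ereal"
  assumes "asplund TYPE('a) \<or> convex_ext f" and "lsc_fun f" and "\<And>x. f x \<noteq> -\<infinity>"
    and "f x0 = ereal f0" and "0 \<le> c" and "0 < r"
    and "\<And>y. dist y x0 < r \<Longrightarrow> ereal (f0 - c * dist y x0) \<le> f y" and "0 < \<eta>"
  obtains y fy xs where "f y = ereal fy" "dist y x0 < \<eta>" "fy \<le> f0" "xs \<in> frechet_subdiff f y" "norm xs \<le> c + \<eta>"
  using assms(1)
proof
  assume "asplund TYPE('a)"
  from fuzzy_subgradient_asplund[OF this assms(2-8)] that show ?thesis by blast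
next
  assume "convex_ext f"
  then obtain xs where "xs \<in> frechet_subdiff f x0" "norm xs \<le> c"
    using subgradient_convex[of f x0 f0 c r] assms by blast
  then show ?thesis using that[of x0 f0 xs] assms by simp
qed

section \<open>The error bound\<close>

text \<open>The initial perturbation \<open>\<kappa> * norm (z - x)\<close> yields the decrease
  estimate; the series of perturbations has total weight \<kappa>' - \<kappa>, which accounts for
  the larger slope in the minimality.\<close>

lemma Ekeland_type_principle:
  fixes F :: "'a::banach \<Rightarrow> real"
  assumes x: "x \<in> M" and nonneg: "\<And>z. z \<in> M \<Longrightarrow> 0 \<le> F z"
    and lsc: "seq_lsc_on M F"
    and \<kappa>: "0 < \<kappa>" "\<kappa> < \<kappa>'"
  obtains y where "y \<in> M" "F y + \<kappa> * norm (y - x) \<le> F x" "\<And>z. z \<in> M \<Longrightarrow> F y \<le> F z + \<kappa>' * norm (z - y)"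
proof -
  define \<mu> where "\<mu> i = (\<kappa>' - \<kappa>) * (1/2) ^ Suc i" for i :: nat
  have \<mu>: "\<And>i. 0 < \<mu> i" "summable \<mu>" "suminf \<mu> = \<kappa>' - \<kappa>"
  proof -
    show "0 < \<mu> i" for i using \<kappa> by (simp add: \<mu>_def)
    have "\<mu> sums ((\<kappa>' - \<kappa>) * 1)" unfolding \<mu>_def by (intro sums_mult power_half_series)
    then show "summable \<mu>" "suminf \<mu> = \<kappa>' - \<kappa>" by (auto simp: sums_iff)
  qed
  have "\<And>z. z \<in> M \<Longrightarrow> F x + \<kappa> * norm (x - x) - F x \<le> F z + \<kappa> * norm (z - x)"
    using nonneg \<kappa> by (simp add: add_nonneg_nonneg)
  moreover have "continuous_on UNIV (\<lambda>z. \<kappa> * norm (z - x))" by (intro continuous_intros)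
  moreover have "norm (z - y) \<le> norm (w - y) + norm (z - w)" for z w y :: 'a
    using norm_triangle_ineq[of "w - y" "z - w"] by simp
  moreover have "\<exists>\<delta>>0. \<forall>z\<in>UNIV. \<forall>y\<in>UNIV. norm (z - y) \<le> \<delta> \<longrightarrow> norm (z - y :: 'a) \<le> \<epsilon>" if "0 < \<epsilon>" for \<epsilon>
    using that by blast
  ultimately obtain y ybar where y: "\<And>i. y i \<in> M" "y \<longlonglongrightarrow> ybar" "ybar \<in> M"
      "F ybar + \<kappa> * norm (ybar - x) \<le> F x + \<kappa> * norm (x - x)"
    and min: "\<And>z. z \<in> M \<Longrightarrow> F ybar + \<kappa> * norm (ybar - x) + (\<Sum>i. \<mu> i * norm (ybar - y i))
        \<le> F z + \<kappa> * norm (z - x) + (\<Sum>i. \<mu> i * norm (z - y i))"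
    using variational_principle[OF x subset_UNIV closed_UNIV lsc, of "\<lambda>z. \<kappa> * norm (z - x)" "F x" norm \<mu>] \<mu>(1,2)
      norm_ge_zero norm_zero by blast
  obtain K where K: "\<And>i. norm (y i) \<le> K"
    using convergent_imp_Bseq[of y] y(2) by (metis Bseq_def convergentI)
  have summ: "summable (\<lambda>i. \<mu> i * norm (z - y i))" for z
  proof -
    have "norm (z - y i) \<le> norm z + K" for i using norm_triangle_ineq4[of z "y i"] K[of i] by simp
    then show ?thesis using \<mu>(1)
      by (intro summable_comparison_test'[OF summable_mult2[OF \<mu>(2), of "norm z + K"]])
        (auto simp: abs_mult less_imp_le intro!: mult_left_mono)
  qed
  show ?thesis
  proof (rule that[OF y(3)])
    show "F ybar + \<kappa> * norm (ybar - x) \<le> F x" using y(4) by simp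
    fix z assume z: "z \<in> M"
    have "(\<Sum>i. \<mu> i * norm (z - y i)) \<le> (\<Sum>i. \<mu> i * norm (ybar - y i) + \<mu> i * norm (z - ybar))"
    proof (intro suminf_le summ summable_add summable_mult2 \<mu>(2))
      fix i
      have "\<mu> i * norm (z - y i) \<le> \<mu> i * (norm (ybar - y i) + norm (z - ybar))"
        using \<mu>(1)[of i] norm_triangle_ineq[of "ybar - y i" "z - ybar"] by (intro mult_left_mono) auto
      then show "\<mu> i * norm (z - y i) \<le> \<mu> i * norm (ybar - y i) + \<mu> i * norm (z - ybar)"
        by (simp add: distrib_left)
    qed
    also have "\<dots> = (\<Sum>i. \<mu> i * norm (ybar - y i)) + (\<kappa>' - \<kappa>) * norm (z - ybar)"
      using suminf_add[OF summ[of ybar] summable_mult2[OF \<mu>(2), of "norm (z - ybar)"]]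
        suminf_mult2[OF \<mu>(2), of "norm (z - ybar)"] \<mu>(3) by simp
    finally have "(\<Sum>i. \<mu> i * norm (z - y i)) \<le> (\<Sum>i. \<mu> i * norm (ybar - y i)) + (\<kappa>' - \<kappa>) * norm (z - ybar)" .
    moreover have "\<kappa> * norm (z - x) \<le> \<kappa> * norm (ybar - x) + \<kappa> * norm (z - ybar)"
      using \<kappa>(1) norm_triangle_ineq[of "ybar - x" "z - ybar"] by (simp flip: distrib_left)
    ultimately show "F ybar \<le> F z + \<kappa>' * norm (z - ybar)"
      using min[OF z] unfolding left_diff_distrib by linarith
  qed
qed

text \<open>The derivative of (s - c t)^q + \<kappa> t at 0 is negative. Nothing beyond the
  derivative is used, as the power is convex for some q and concave for others. This relates slopes
  of \<open>f\<close> to slopes of its q-th power.\<close>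

lemma powr_below_tangent:
  fixes s q c \<kappa> :: real
  assumes s: "0 < s" and c: "0 < c" and slope: "\<kappa> < q * s powr (q - 1) * c"
  obtains r where "0 < r" "\<And>t. 0 \<le> t \<Longrightarrow> t < r \<Longrightarrow> 0 < s - c * t \<and> (s - c * t) powr q \<le> s powr q - \<kappa> * t"
proof -
  define g where "g t = (s - c * t) powr q + \<kappa> * t" for t
  have "(g has_real_derivative (q * s powr (q - 1) * (- c) + \<kappa>)) (at 0)"
    unfolding g_def using s by (auto intro!: derivative_eq_intros simp: field_simps powr_diff)
  moreover have "q * s powr (q - 1) * (- c) + \<kappa> < 0" using slope by simp
  ultimately obtain d where d: "0 < d" "\<And>h. 0 < h \<Longrightarrow> h < d \<Longrightarrow> g (0 + h) < g 0"
    using DERIV_neg_dec_right[of g _ 0] by blast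
  show ?thesis
  proof (rule that[of "min d (s / c)"])
    show "0 < min d (s / c)" using d(1) s c by simp
    fix t assume t: "0 \<le> t" "t < min d (s / c)"
    then have "0 < s - c * t" using c by (simp add: pos_less_divide_eq mult.commute)
    moreover have "g t \<le> g 0" using d(2)[of t] t by (cases "t = 0") auto
    ultimately show "0 < s - c * t \<and> (s - c * t) powr q \<le> s powr q - \<kappa> * t" by (simp add: g_def)
  qed
qed

theorem theorem3p7:
  fixes f :: "'a::banach \<Rightarrow> ereal" and xbar :: 'a and \<tau> q :: real and \<delta> :: ereal
  assumes notminf: "\<And>x. f x \<noteq> -\<infinity>"
    and lsc: "lsc_fun f"
    and xbar: "f xbar \<le> 0"
    and tau: "\<tau> > 0" and delta: "\<delta> > 0" and q: "q > 0"
    and asp_or_conv: "asplund TYPE('a) \<or> convex_ext f"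
    and H: "\<And>x. ereal (dist x xbar) < \<delta> \<Longrightarrow> 0 < f x \<Longrightarrow> f x < \<infinity> \<Longrightarrow>
              real_of_ereal (f x) powr q < \<tau> * infdist x {y. f y \<le> 0} \<Longrightarrow>
              ereal (q * real_of_ereal (f x) powr (q - 1)) * dist0_subdiff f x \<ge> ereal \<tau>"
  shows "\<forall>\<alpha>::real. 0 < \<alpha> \<and> \<alpha> \<le> 1 \<longrightarrow>
          (\<forall>x. ereal (dist x xbar) < \<delta> / ereal (1 + \<alpha>) \<longrightarrow>
             ereal (\<alpha> * \<tau> * infdist x {y. f y \<le> 0}) \<le> pos_pow (f x) q)"
proof (intro allI impI, rule ccontr)
  fix \<alpha> :: real and x
  assume \<alpha>: "0 < \<alpha> \<and> \<alpha> \<le> 1" and xdist: "ereal (dist x xbar) < \<delta> / ereal (1 + \<alpha>)"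
  define S where "S = {y. f y \<le> 0}"
  define d where "d = infdist x S"
  assume "\<not> ereal (\<alpha> * \<tau> * infdist x {y. f y \<le> 0}) \<le> pos_pow (f x) q"
  then have lt: "pos_pow (f x) q < ereal (\<alpha> * \<tau> * d)" by (simp add: d_def S_def)
  \<comment> \<open>\<open>infdist\<close> to the empty set is 0 instead of \<infinity>;
    \<open>xbar\<close> keeps \<open>S\<close> nonempty, so it is the true distance.\<close>
  have "xbar \<in> S" using xbar by (simp add: S_def)
  have d0: "0 \<le> d" by (simp add: d_def infdist_nonneg)
  obtain fx where fx: "f x = ereal fx" using lt notminf[of x] by (cases "f x") (auto simp: pos_pow_def)
  have "x \<notin> S"
  proof
    assume "x \<in> S"
    then have "d = 0" by (simp add: d_def)
    with lt fx show False by (simp add: pos_pow_def)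
  qed
  then have fx_pos: "0 < fx" using fx by (simp add: S_def zero_ereal_def)
  have fxq: "fx powr q < \<alpha> * \<tau> * d" using lt fx fx_pos by (simp add: pos_pow_def)
  have "0 < fx powr q" using fx_pos by simp
  then have "0 < \<alpha> * \<tau> * d" using fxq by linarith
  then have d: "0 < d" using \<alpha> tau d0 by (cases "d = 0") auto
  \<comment> \<open>X is the rate at which the bound fails. The constants will satisfy X < \<kappa>
    < \<kappa>' < w c < A c < \<tau>: \<kappa> for the decrease, \<kappa>' for the minimality, c for
    the slope of \<open>f\<close> at y, w for the derivative of the power at f(y) and A for a bound
    on it nearby.\<close>
  define X where "X = fx powr q / (\<alpha> * d)"
  have X: "0 < X" "X < \<tau>" using fxq \<alpha> d \<open>0 < fx powr q\<close> by (auto simp: X_def pos_divide_less_eq mult_ac)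
  define \<kappa> where "\<kappa> = (X + \<tau>) / 2"
  have \<kappa>: "0 < \<kappa>" "\<kappa> < \<tau>" "X < \<kappa>" using X by (auto simp: \<kappa>_def)
  then have fx\<kappa>: "fx powr q < \<kappa> * (\<alpha> * d)" using \<alpha> d by (simp add: X_def pos_divide_less_eq)
  define \<kappa>' where "\<kappa>' = (\<kappa> + \<tau>) / 2"
  have \<kappa>': "\<kappa> < \<kappa>'" "\<kappa>' < \<tau>" using \<kappa> by (auto simp: \<kappa>'_def)
  define M where "M = {z. f z < \<infinity>}"
  define F where "F z = max (real_of_ereal (f z)) 0 powr q" for z
  have fin: "f z = ereal (real_of_ereal (f z))" if "z \<in> M" for z
    using that notminf[of z] by (cases "f z") (auto simp: M_def)
  have "x \<in> M" using fx by (simp add: M_def)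
  moreover have "seq_lsc_on M F"
  proof (rule seq_lsc_onI)
    fix zs z bs b assume zs: "\<And>k. zs k \<in> M" "zs \<longlonglongrightarrow> z" "\<And>k. F (zs k) \<le> bs k" "bs \<longlonglongrightarrow> (b::real)"
    have bs: "0 \<le> bs k" for k using zs(3)[of k] order_trans[OF powr_ge_zero] unfolding F_def by blast
    then have b: "0 \<le> b" using LIMSEQ_le_const[OF zs(4)] by blast
    \<comment> \<open>Taking q-th roots of the bounds reduces lower semicontinuity of the power of
      the positive part to that of \<open>f\<close>.\<close>
    have "f (zs k) \<le> ereal (bs k powr (1 / q))" for k
    proof -
      have "max (real_of_ereal (f (zs k))) 0 = F (zs k) powr (1 / q)" using q by (simp add: F_def powr_powr)
      also have "\<dots> \<le> bs k powr (1 / q)" using zs(3)[of k] q by (intro powr_mono2) (auto simp: F_def)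
      finally show ?thesis by (subst fin[OF zs(1)]) simp
    qed
    moreover have "(\<lambda>k. bs k powr (1 / q)) \<longlonglongrightarrow> b powr (1 / q)"
      using q bs by (intro tendsto_powr' zs(4) tendsto_const) auto
    ultimately have fz: "f z \<le> ereal (b powr (1 / q))" by (rule lsc_fun_sequentially[OF lsc zs(2)])
    then have zM: "z \<in> M" by (auto simp: M_def)
    have "real_of_ereal (f z) \<le> b powr (1 / q)" using fz by (subst (asm) fin[OF zM]) simp
    then have "max (real_of_ereal (f z)) 0 \<le> b powr (1 / q)" by simp
    then have "F z \<le> (b powr (1 / q)) powr q" unfolding F_def by (rule powr_mono2[OF less_imp_le[OF q] max.cobounded2])
    also have "\<dots> = b" using q b by (simp add: powr_powr)
    finally show "z \<in> M \<and> F z \<le> b" using zM by simp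
  qed
  moreover have F_nonneg: "0 \<le> F z" for z by (simp add: F_def)
  ultimately obtain y where yM: "y \<in> M" and yx: "F y + \<kappa> * norm (y - x) \<le> F x"
    and ymin: "\<And>z. z \<in> M \<Longrightarrow> F y \<le> F z + \<kappa>' * norm (z - y)"
    using Ekeland_type_principle[of x M F \<kappa> \<kappa>'] \<kappa>(1) \<kappa>'(1) by blast
  have Fx: "F x = fx powr q" unfolding F_def fx using fx_pos by (simp add: max_def)
  have "\<kappa> * norm (y - x) < \<kappa> * (\<alpha> * d)" using yx Fx fx\<kappa> F_nonneg[of y] by linarith
  then have yx\<alpha>: "norm (y - x) < \<alpha> * d" using \<kappa>(1) by simp
  have \<alpha>d: "\<alpha> * d \<le> d" using \<alpha> d by simp
  define D where "D = infdist y S"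
  have D: "d - norm (y - x) \<le> D"
    using infdist_triangle[of x S y] by (simp add: d_def D_def dist_norm norm_minus_commute)
  then have Dpos: "0 < D" using yx\<alpha> \<alpha>d by linarith
  then have "y \<notin> S" by (auto simp: D_def)
  define s where "s = real_of_ereal (f y)"
  have fy: "f y = ereal s" using fin[OF yM] by (simp add: s_def)
  have s: "0 < s" using \<open>y \<notin> S\<close> fy by (simp add: S_def zero_ereal_def)
  have Fy: "F y = s powr q" using s by (simp add: F_def s_def)
  \<comment> \<open>The amount \<kappa> |y - x| gained in value covers what the distance to
    \<open>S\<close> may lose, so y satisfies the inequality required in \<open>H\<close>.\<close>
  have sq: "s powr q < \<tau> * D"
  proof -
    have "s powr q < \<kappa> * (\<alpha> * d) - \<kappa> * norm (y - x)" using yx Fx Fy fx\<kappa> by linarith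
    also have "\<dots> = \<kappa> * (\<alpha> * d - norm (y - x))" by (simp add: right_diff_distrib)
    also have "\<dots> \<le> \<kappa> * D" using D \<alpha>d \<kappa>(1) by (intro mult_left_mono) auto
    also have "\<dots> \<le> \<tau> * D" using \<kappa>(2) Dpos by (intro mult_right_mono) auto
    finally show ?thesis .
  qed
  \<comment> \<open>|y - x| < \<alpha> d and d \<le> |x - xbar| give the factor 1 +
    \<alpha>.\<close>
  have ydist: "ereal (dist y xbar) < \<delta>"
  proof -
    have "d \<le> dist x xbar" unfolding d_def by (rule infdist_le[OF \<open>xbar \<in> S\<close>])
    then have "\<alpha> * d \<le> \<alpha> * dist x xbar" using \<alpha> by (intro mult_left_mono) auto
    then have "dist y xbar < (1 + \<alpha>) * dist x xbar"
      using yx\<alpha> dist_triangle[of y xbar x] by (simp add: dist_norm algebra_simps)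
    moreover have "ereal ((1 + \<alpha>) * dist x xbar) < \<delta>"
    proof (cases \<delta>)
      case (real \<delta>')
      with xdist \<alpha> have "dist x xbar < \<delta>' / (1 + \<alpha>)" by simp
      with \<alpha> real show ?thesis by (simp add: pos_less_divide_eq mult.commute)
    qed (use delta in auto)
    ultimately show ?thesis by (meson ereal_less_eq(3) less_imp_le order_le_less_trans)
  qed
  define w where "w = q * s powr (q - 1)"
  have w: "0 < w" using q s by (simp add: w_def)
  define c where "c = (\<kappa>' + \<tau>) / 2 / w"
  have wc: "\<kappa>' < w * c" "w * c < \<tau>" using w \<kappa>' by (auto simp: c_def)
  have c: "0 < c" using w \<kappa> \<kappa>' by (simp add: c_def)
  obtain r where r: "0 < r" "\<And>t. 0 \<le> t \<Longrightarrow> t < r \<Longrightarrow> 0 < s - c * t \<and> (s - c * t) powr q \<le> s powr q - \<kappa>' * t"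
    using powr_below_tangent[OF s c, of \<kappa>' q] wc(1) by (auto simp: w_def)
  \<comment> \<open>If \<open>f\<close> dropped faster than with slope c, its q-th power would drop
    faster than with slope \<kappa>', against the minimality at y.\<close>
  have loc: "ereal (s - c * dist z y) \<le> f z" if z: "dist z y < r" for z
  proof (rule ccontr)
    assume neg: "\<not> ?thesis"
    then have zM: "z \<in> M" by (auto simp: M_def not_le)
    have "real_of_ereal (f z) < s - c * dist z y" using neg fin[OF zM] by (metis ereal_less_eq(3) not_le)
    then have "F z < (s - c * dist z y) powr q"
      unfolding F_def using r(2)[of "dist z y"] z q by (intro powr_less_mono2) auto
    then show False using r(2)[of "dist z y"] z ymin[OF zM] Fy by (simp add: dist_norm)
  qed
  define A where "A = (w * c + \<tau>) / 2 / c"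
  have A: "w < A" "A * c < \<tau>" "0 < A" using wc c w tau by (auto simp: A_def field_simps intro: add_pos_pos)
  \<comment> \<open>The factor q u^(q-1) has to be bounded near s and not only at s, since the
    subgradient sits at a point with possibly another value of \<open>f\<close>.\<close>
  have "((\<lambda>u. q * u powr (q - 1)) \<longlongrightarrow> q * s powr (q - 1)) (nhds s)"
    using s by (intro tendsto_intros tendsto_ident_at) (auto simp: filterlim_ident)
  then have "\<forall>\<^sub>F u in nhds s. q * u powr (q - 1) < A" using A(1) by (intro order_tendstoD) (auto simp: w_def)
  then obtain \<rho> where \<rho>: "0 < \<rho>" "\<And>u. \<bar>u - s\<bar> < \<rho> \<Longrightarrow> q * u powr (q - 1) < A"
    by (auto simp: eventually_nhds_metric dist_real_def)
  obtain \<delta>' where \<delta>': "dist y xbar < \<delta>'" "ereal \<delta>' < \<delta>"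
    using ereal_dense2[OF ydist] by auto
  \<comment> \<open>In this order the entries ensure: the local estimate at y', f(y') within \<rho>
    of s, f(y') > 0, y' in the ball, the strict inequality for \<open>H\<close>, and A (c + \<eta>)
    < \<tau>.\<close>
  define \<eta> where "\<eta> = Min {r, \<rho> / (2 * c), s / (2 * c), \<delta>' - dist y xbar, (D - s powr q / \<tau>) / 2, (\<tau> / A - c) / 2}"
  have "s powr q / \<tau> < D" "c < \<tau> / A" using sq tau A by (auto simp: pos_divide_less_eq pos_less_divide_eq mult.commute)
  then have \<eta>: "0 < \<eta>" using r(1) \<rho>(1) s c \<delta>'(1) by (simp add: \<eta>_def)
  have \<eta>_le: "\<eta> \<le> r" "\<eta> \<le> \<rho> / (2 * c)" "\<eta> \<le> s / (2 * c)" "\<eta> \<le> \<delta>' - dist y xbar"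
      "\<eta> \<le> (D - s powr q / \<tau>) / 2" "\<eta> \<le> (\<tau> / A - c) / 2"
    unfolding \<eta>_def by (rule Min_le; simp)+
  obtain y' fy' xs where y': "f y' = ereal fy'" "dist y' y < \<eta>" "fy' \<le> s"
    and xs: "xs \<in> frechet_subdiff f y'" "norm xs \<le> c + \<eta>"
    using fuzzy_subgradient[OF asp_or_conv lsc notminf fy less_imp_le[OF c] r(1) loc \<eta>] by blast
  have "ereal (s - c * dist y' y) \<le> ereal fy'" using loc[of y'] y' \<eta>_le(1) by simp
  then have "s - c * dist y' y \<le> fy'" by simp
  moreover have "c * dist y' y \<le> c * \<eta>" using y'(2) c by (intro mult_left_mono) auto
  ultimately have lower: "s - c * \<eta> \<le> fy'" by linarith
  have c\<eta>: "c * \<eta> \<le> \<rho> / 2" "c * \<eta> \<le> s / 2"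
    using mult_left_mono[OF \<eta>_le(2), of c] mult_left_mono[OF \<eta>_le(3), of c] c by auto
  have fy'_pos: "0 < fy'" using lower c\<eta>(2) s by linarith
  have "ereal \<tau> \<le> ereal (q * real_of_ereal (f y') powr (q - 1)) * dist0_subdiff f y'"
  proof (rule H)
    have "dist y' xbar < \<delta>'" using dist_triangle[of y' xbar y] y'(2) \<eta>_le(4) by linarith
    then show "ereal (dist y' xbar) < \<delta>" using \<delta>'(2) by (meson less_ereal.simps(1) less_trans)
    show "0 < f y'" "f y' < \<infinity>" using y'(1) fy'_pos by auto
    have "D - \<eta> \<le> infdist y' S"
      using infdist_triangle[of y S y'] y'(2) by (simp add: D_def dist_commute)
    moreover have "s powr q / \<tau> < D - \<eta>" using \<eta>_le(5) \<eta> by argo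
    ultimately have "s powr q / \<tau> < infdist y' S" by linarith
    then have "s powr q < \<tau> * infdist y' S" using tau by (simp add: pos_divide_less_eq mult.commute)
    moreover have "fy' powr q \<le> s powr q" using y'(3) fy'_pos q by (intro powr_mono2) auto
    ultimately show "real_of_ereal (f y') powr q < \<tau> * infdist y' {y. f y \<le> 0}"
      using y'(1) by (simp add: S_def)
  qed
  also have "\<dots> \<le> ereal (q * real_of_ereal (f y') powr (q - 1)) * ereal (norm xs)"
    using q xs(1) unfolding dist0_subdiff_def by (intro ereal_mult_left_mono INF_lower) auto
  finally have "\<tau> \<le> q * fy' powr (q - 1) * norm xs" using y'(1) by simp
  also have "\<dots> \<le> A * (c + \<eta>)"
    using \<rho>(2)[of fy'] lower c\<eta>(1) y'(3) \<rho>(1) A(3) xs(2) by (intro mult_mono) auto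
  also have "\<dots> < A * (\<tau> / A)"
    using \<eta>_le(6) \<open>c < \<tau> / A\<close> A(3) by (intro mult_strict_left_mono) auto
  also have "\<dots> = \<tau>" using A(3) by simp
  finally show False by simp
qed

end
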